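(* Let $n,r$ be integers with $1\le r\le n$ and $n-r$ even. Then for all real $X\ge1$, $$\#\{A\in \mathrm{M}_n(\mathbb{Z})_{\mathrm{alt},\le X}:\ \mathrm{rk}(\ker A)\ge r\}\asymp_n X^{n(n-r)/2},$$ i.e. the left side is bounded above and below by positive constants depending only on $n$ times $X^{n(n-r)/2}$.
   Context: $\mathrm{M}_n(\mathbb{Z})_{\mathrm{alt},\le X}$ is the set of $n\times n$ integer matrices $A$ with $A^T=-A$, zero diagonal, and all entries of absolute value at most $X$. $\mathrm{rk}(\ker A)$ is the rank of the kernel of $A$ (equivalently $n-\operatorname{rank}A$). *)

theory Defs
  imports Complex_Main "Jordan_Normal_Form.Matrix_Kernel"
begin

definition alt_mats :: "nat \<Rightarrow> real \<Rightarrow> int mat set" where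
  "alt_mats n X = {A \<in> carrier_mat n n.
     transpose_mat A = - A \<and> (\<forall>i<n. A $$ (i, i) = 0) \<and>
     (\<forall>i<n. \<forall>j<n. \<bar>real_of_int (A $$ (i, j))\<bar> \<le> X)}"

text \<open>The rank of a subgroup \<open>L\<close> of \<open>\<int>\<^sup>n\<close>, i.e. the largest size of a \<open>\<int>\<close>-linearly
  independent subset of \<open>L\<close>. The maximum ranges over a finite set by \<open>int_lin_indpt_card_le\<close>.\<close>

definition lattice_rank :: "nat \<Rightarrow> int vec set \<Rightarrow> nat" where
  "lattice_rank n L = Max {card S | S. finite S \<and> S \<subseteq> L \<and>
     \<not> LinearCombinations.module.lin_dep class_ring (module_vec TYPE(int) n) S}"

lemma finite_alt_mats: "finite (alt_mats n X)"
proof -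
  let ?I = "{..<n} \<times> {..<n}"
  let ?F = "?I \<rightarrow>\<^sub>E {-\<lfloor>\<bar>X\<bar>\<rfloor>..\<lfloor>\<bar>X\<bar>\<rfloor>}"
  have "A \<in> (\<lambda>f. mat n n f) ` ?F" if A: "A \<in> alt_mats n X" for A
  proof
    let ?f = "restrict (\<lambda>ij. A $$ ij) ?I"
    show "A = mat n n ?f"
      using A by (intro eq_matI) (auto simp: alt_mats_def)
    have "\<bar>A $$ (i, j)\<bar> \<le> \<lfloor>\<bar>X\<bar>\<rfloor>" if "i < n" "j < n" for i j
    proof -
      have "\<bar>real_of_int (A $$ (i, j))\<bar> \<le> X" using A that by (auto simp: alt_mats_def)
      then show ?thesis by (simp add: le_floor_iff)
    qed
    then show "?f \<in> ?F"
      by (auto simp: restrict_PiE_iff abs_le_iff) (smt (verit, best))+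
  qed
  then have "alt_mats n X \<subseteq> (\<lambda>f. mat n n f) ` ?F" by blast
  moreover have "finite ((\<lambda>f. mat n n f) ` ?F)" by (intro finite_imageI finite_PiE) auto
  ultimately show ?thesis by (rule finite_subset)
qed

lemma int_lin_indpt_card_le:
  assumes S: "S \<subseteq> carrier_vec n"
    and indep: "\<not> LinearCombinations.module.lin_dep class_ring (module_vec TYPE(int) n) S"
  shows "finite S \<and> card S \<le> n"
proof -
  interpret Z: vec_module "TYPE(int)" n .
  interpret Q: vec_space "TYPE(rat)" n .
  let ?h = "map_vec rat_of_int"
  have inj: "inj_on ?h S"
    by (rule inj_onI) (simp add: of_int_hom.vec_hom_inj)
  have hS: "?h ` S \<subseteq> carrier_vec n" using S by auto
  have "\<not> Q.lin_dep (?h ` S)"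
  proof
    assume "Q.lin_dep (?h ` S)"
    then obtain B a v where B: "finite B" "B \<subseteq> ?h ` S" and a: "Q.lincomb a B = 0\<^sub>v n"
      and v: "v \<in> B" "a v \<noteq> 0"
      unfolding Q.lin_dep_def by auto
    obtain T where T: "T \<subseteq> S" "finite T" "B = ?h ` T"
      using B by (meson finite_subset_image)
    define d where "d = (\<Prod>x\<in>B. snd (quotient_of (a x)))"
    have d0: "d \<noteq> 0" unfolding d_def using B(1)
      by (simp add: quotient_of_denom_pos' less_imp_neq[symmetric])
    have ex: "\<exists>k. rat_of_int k = rat_of_int d * a x" if x: "x \<in> B" for x
    proof -
      obtain p q where pq: "quotient_of (a x) = (p, q)" by fastforce
      then have q0: "q > 0" and ax: "a x = rat_of_int p / rat_of_int q"
        by (auto simp: quotient_of_denom_pos quotient_of_div)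
      have "d = q * (\<Prod>y\<in>B - {x}. snd (quotient_of (a y)))"
        unfolding d_def using B(1) x pq by (simp add: prod.remove)
      then have "rat_of_int ((\<Prod>y\<in>B - {x}. snd (quotient_of (a y))) * p) = rat_of_int d * a x"
        using q0 ax by simp
      then show ?thesis by blast
    qed
    define b where "b x = (SOME k. rat_of_int k = rat_of_int d * a (?h x))" for x
    have b: "rat_of_int (b x) = rat_of_int d * a (?h x)" if "x \<in> T" for x
      unfolding b_def using someI_ex[OF ex] T(3) that by blast
    have Tc: "T \<subseteq> carrier_vec n" using T S by auto
    have injT: "inj_on ?h T" using inj T(1) by (rule inj_on_subset)
    have "Z.lincomb b T = 0\<^sub>v n"
    proof (rule eq_vecI)
      show "dim_vec (Z.lincomb b T) = dim_vec (0\<^sub>v n :: int vec)"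
        using Z.lincomb_closed[OF Tc, of b] by simp
    next
      fix i assume "i < dim_vec (0\<^sub>v n :: int vec)"
      then have i: "i < n" by simp
      have "Z.lincomb b T $ i = (\<Sum>x\<in>T. (b x \<cdot>\<^sub>v x) $ i)"
        unfolding Z.lincomb_def using Tc by (intro Z.finsum_index[OF i]) auto
      also have "\<dots> = (\<Sum>x\<in>T. b x * x $ i)"
        using Tc i by (intro sum.cong) auto
      finally have "rat_of_int (Z.lincomb b T $ i) = (\<Sum>x\<in>T. rat_of_int (b x) * rat_of_int (x $ i))"
        by simp
      also have "\<dots> = (\<Sum>x\<in>T. rat_of_int d * (a (?h x) * ?h x $ i))"
        using Tc i by (intro sum.cong) (auto simp: b)
      also have "\<dots> = rat_of_int d * (\<Sum>x\<in>B. a x * x $ i)"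
        unfolding T(3) sum.reindex[OF injT] by (simp add: sum_distrib_left)
      also have "(\<Sum>x\<in>B. a x * x $ i) = Q.lincomb a B $ i"
        using Q.lincomb_index[OF i] B(2) hS by (metis order_trans)
      finally show "Z.lincomb b T $ i = 0\<^sub>v n $ i" using a i by simp
    qed
    moreover obtain w where w: "w \<in> T" "v = ?h w" using v T(3) by blast
    moreover have "b w \<noteq> 0" using b[OF w(1)] v(2) d0 w(2) by auto
    ultimately have "Z.lin_dep S"
      unfolding Z.lin_dep_def using T by auto
    with indep show False by simp
  qed
  then have "finite (?h ` S) \<and> card (?h ` S) \<le> n"
    using Q.li_le_dim[OF Q.fin_dim hS] Q.dim_is_n by simp
  then show ?thesis using inj finite_imageD card_image by metis
qed

end

theory Submission
  imports Defs "HOL-Analysis.Inner_Product" "HOL-Library.FuncSet"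
begin

text \<open>
  Write \<open>n - r = 2k\<close>.

  Upper bound. An alternating matrix of rank at most \<open>2k\<close> is a skew operator \<open>A\<close> that is integral on
  the lattice \<open>G = \<int>\<^sup>n\<close>. Let \<open>v\<close> be a shortest vector of the dual lattice lying in the image of \<open>A\<close>.
  A transference argument gives \<open>|v|\<^sup>2 \<le> const * X\<close>. Compressing \<open>A\<close> to the complement of \<open>v\<close>
  yields an operator of rank at most \<open>2k - 2\<close>, integral on the sublattice of \<open>G\<close> orthogonal to \<open>v\<close>,
  and the operators with a given compression are counted by dual lattice points in a ball of radius
  \<open>2X / |v|\<close>. Induction on \<open>k\<close> and summation over \<open>v\<close> give \<open>X\<^sup>n\<^sup>k\<close>. As \<open>v\<close> is shortest, the
  vectors met later have length at least \<open>|v| / 2\<close>, so very short vectors never occur and skewed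
  lattices need no separate treatment.

  Lower bound. Take \<open>C\<^sup>T P C\<close> with \<open>P\<close> a well-conditioned alternating matrix of size \<open>2k\<close> and
  \<open>C = (I | c\<^sub>1, \<dots>, c\<^sub>r)\<close>, where the \<open>c\<^sub>j\<close> are pairwise orthogonal elements of the finite group
  \<open>P\<^sup>-\<^sup>1 \<int>\<^sup>2\<^sup>k / \<int>\<^sup>2\<^sup>k\<close>, of order about \<open>X\<^sup>2\<^sup>k\<close>, for its pairing into \<open>\<rat> / \<int>\<close>. There are about
  \<open>X\<^sup>2\<^sup>k\<close> choices of \<open>c\<^sub>1\<close>, and an isotropic set has an orthogonal complement of at least the
  square root of the group order, which leaves at least about \<open>X\<^sup>k\<close> choices of each later \<open>c\<^sub>j\<close>.
\<close>

section \<open>Shortest vectors of dual lattices\<close>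

text \<open>The exponent is a balance of three powers. Suppose the dual lattice has rank m and at
  most K R^m points in balls of radius R \<ge> 1. Passing to the complement of v multiplies K by
  about |v|, because the new dual lattice is the old one projected along v. For rank 2 (k + 1) the
  number of compressions is therefore about X^(k (m - 1)) (K |v|)^(2 k), and each fibre has about K
  |v| (X / |v|)^(m - 1) elements, so v contributes X^((k + 1) (m - 1)) K^(2 k + 1) |v|^(2 (k + 1) -
  m). Over |v| up to about sqrt X this sum is governed by the longest v, since 2 (k + 1) > 0; no
  logarithm appears and the total is X^((k + 1) m) K^(2 (k + 1)). Hence the induction hypothesis
  must be uniform in the lattice and carry K explicitly. In the lower bound, P supplies k (2k - 1)
  free entries of size about X, and k (2k - 1) + 2k + k (r - 1) = n k.\<close>

definition add_subgroup :: "'a::real_vector set \<Rightarrow> bool" where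
  "add_subgroup G \<longleftrightarrow> 0 \<in> G \<and> (\<forall>x\<in>G. \<forall>y\<in>G. x - y \<in> G)"

text \<open>For \<open>W = span G\<close> this is the usual dual lattice. For a smaller subspace it
  consists of the dual vectors that happen to lie in \<open>W\<close>; below, \<open>W\<close> is
  the image of an operator, and its shortest nonzero dual vector is the one split off in the
  induction.\<close>

definition dual_lattice :: "'a::real_inner set \<Rightarrow> 'a set \<Rightarrow> 'a set" where
  "dual_lattice W G = {p \<in> W. \<forall>x\<in>G. inner p x \<in> \<int>}"

definition perp :: "'a::real_inner \<Rightarrow> 'a set \<Rightarrow> 'a set" where
  "perp v S = {x \<in> S. inner v x = 0}"

definition proj_perp :: "'a::real_inner \<Rightarrow> 'a \<Rightarrow> 'a" where
  "proj_perp v x = x - (inner v x / inner v v) *\<^sub>R v"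

lemma add_subgroup_uminus: "add_subgroup G \<Longrightarrow> x \<in> G \<Longrightarrow> - x \<in> G"
  unfolding add_subgroup_def by (metis diff_0)

lemma add_subgroup_add: "add_subgroup G \<Longrightarrow> x \<in> G \<Longrightarrow> y \<in> G \<Longrightarrow> x + y \<in> G"
  using add_subgroup_uminus[of G y] unfolding add_subgroup_def by (metis diff_minus_eq_add)

lemma add_subgroup_of_nat_scaleR:
  "add_subgroup G \<Longrightarrow> x \<in> G \<Longrightarrow> of_nat n *\<^sub>R x \<in> G"
  by (induction n) (auto simp: add_subgroup_def[of G] add_subgroup_add scaleR_add_left)

lemma add_subgroup_of_int_scaleR:
  assumes "add_subgroup G" "x \<in> G"
  shows "of_int i *\<^sub>R x \<in> G"
proof (cases "i \<ge> 0")
  case True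
  then show ?thesis using add_subgroup_of_nat_scaleR[OF assms, of "nat i"] by simp
next
  case False
  then show ?thesis
    using add_subgroup_uminus[OF assms(1) add_subgroup_of_nat_scaleR[OF assms, of "nat (- i)"]] by simp
qed

lemma add_subgroup_perp: "add_subgroup G \<Longrightarrow> add_subgroup (perp v G)"
  by (auto simp: add_subgroup_def perp_def inner_diff_right)

lemma subspace_perp: "subspace W \<Longrightarrow> subspace (perp v W)"
  by (auto simp: subspace_def perp_def inner_add_right)

lemma inner_proj_perp: "v \<noteq> 0 \<Longrightarrow> inner v (proj_perp v x) = 0"
  by (simp add: proj_perp_def inner_diff_right)

lemma proj_perp_id: "inner v x = 0 \<Longrightarrow> proj_perp v x = x"
  by (simp add: proj_perp_def)

lemma linear_proj_perp: "linear (proj_perp v)"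
  by (auto simp: proj_perp_def linear_iff inner_add_right add_divide_distrib algebra_simps)

lemma proj_perp_in_perp:
  "subspace W \<Longrightarrow> v \<in> W \<Longrightarrow> v \<noteq> 0 \<Longrightarrow> x \<in> W \<Longrightarrow> proj_perp v x \<in> perp v W"
  by (simp add: perp_def inner_proj_perp) (simp add: proj_perp_def subspace_diff subspace_scale)

lemma inner_proj_perp_swap: "inner x (proj_perp v y) = inner (proj_perp v x) y"
  by (simp add: proj_perp_def inner_diff_left inner_diff_right inner_commute)

lemma norm_add_orth: "inner v x = 0 \<Longrightarrow> (norm (x + s *\<^sub>R v))\<^sup>2 = (norm x)\<^sup>2 + s\<^sup>2 * (norm v)\<^sup>2"
  unfolding power2_norm_eq_inner
  by (simp add: inner_add_left inner_add_right inner_commute power2_eq_square)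

lemma norm_proj_perp_le: "norm (proj_perp v x) \<le> norm x"
proof (cases "v = 0")
  case False
  have "x = proj_perp v x + (inner v x / inner v v) *\<^sub>R v" by (simp add: proj_perp_def)
  then have "(norm x)\<^sup>2 = (norm (proj_perp v x))\<^sup>2 + (inner v x / inner v v)\<^sup>2 * (norm v)\<^sup>2"
    using norm_add_orth[OF inner_proj_perp[OF False]] by metis
  then have "(norm (proj_perp v x))\<^sup>2 \<le> (norm x)\<^sup>2" by simp
  then show ?thesis by (rule power2_le_imp_le) simp
qed (simp add: proj_perp_def)

text \<open>The values of v on \<open>G\<close> form a subgroup of the integers. If some g > 1
  divided all of them, v / g would be a shorter dual vector, so the generator is 1.\<close>

lemma exists_inner_eq_one_if_shortest:
  assumes G: "add_subgroup G" and W: "subspace W" and v: "v \<in> dual_lattice W G" "v \<noteq> 0"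
    and min: "\<And>p. p \<in> dual_lattice W G \<Longrightarrow> p \<noteq> 0 \<Longrightarrow> norm v \<le> norm p"
  shows "\<exists>f\<in>G. inner v f = 1"
proof -
  define H where "H = {k::int. \<exists>x\<in>G. inner v x = of_int k}"
  have small: False if g: "g > 1" and div: "\<And>k. k \<in> H \<Longrightarrow> g dvd k" for g :: int
  proof -
    let ?p = "(1 / of_int g) *\<^sub>R v"
    have "?p \<in> dual_lattice W G"
      unfolding dual_lattice_def
    proof (safe)
      show "?p \<in> W" using v W by (auto simp: dual_lattice_def subspace_scale)
      fix x assume x: "x \<in> G"
      then have "inner v x \<in> \<int>" using v by (auto simp: dual_lattice_def)
      then obtain k where k: "inner v x = of_int k" by (elim Ints_cases)
      then have "g dvd k" using div x by (auto simp: H_def)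
      then obtain l where "k = g * l" by (elim dvdE)
      then have "inner ?p x = of_int l" using k g by simp
      then show "inner ?p x \<in> \<int>" by simp
    qed
    then have "norm v \<le> norm ?p" using v(2) g by (intro min) auto
    then have "norm v * of_int g \<le> norm v" using g by (simp add: field_simps)
    then show False using v(2) g by simp
  qed
  have Hdiff: "a - b \<in> H" if ab: "a \<in> H" "b \<in> H" for a b
  proof -
    obtain x y where xy: "x \<in> G" "y \<in> G" "inner v x = of_int a" "inner v y = of_int b"
      using ab by (auto simp: H_def)
    then have "x - y \<in> G" "inner v (x - y) = of_int (a - b)"
      using G by (auto simp: add_subgroup_def inner_diff_right)
    then show ?thesis unfolding H_def by blast
  qed
  have Hmult: "k * a \<in> H" if aH: "a \<in> H" for a k
  proof -
    obtain x where x: "x \<in> G" "inner v x = of_int a" using aH by (auto simp: H_def)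
    then have "inner v (of_int k *\<^sub>R x) = of_int (k * a)" by simp
    then show ?thesis unfolding H_def using add_subgroup_of_int_scaleR[OF G x(1), of k] by blast
  qed
  have "\<exists>a\<in>H. a > 0"
  proof (rule ccontr)
    assume neg: "\<not> ?thesis"
    have "a = 0" if "a \<in> H" for a
    proof -
      have "\<not> a > 0" "\<not> - a > 0" using neg Hmult[OF that, of "-1"] that by auto
      then show ?thesis by simp
    qed
    \<comment> \<open>Without a positive value the subgroup is 0 and every g divides it; g = 2
      already gives the contradiction.\<close>
    then have "2 dvd a" if "a \<in> H" for a using that by fastforce
    then show False using small[of 2] by simp
  qed
  then obtain a where a: "a \<in> H" "a > 0" by blast
  define n where "n = (LEAST n. n > 0 \<and> int n \<in> H)"
  have ex: "nat a > 0 \<and> int (nat a) \<in> H" using a by simp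
  have n: "n > 0" "int n \<in> H" using LeastI[of "\<lambda>n. n > 0 \<and> int n \<in> H", OF ex] by (auto simp: n_def)
  have "int n dvd k" if k: "k \<in> H" for k
  proof (rule ccontr)
    assume nd: "\<not> int n dvd k"
    have "k mod int n = k - (k div int n) * int n" by (simp add: minus_div_mult_eq_mod)
    then have "k mod int n \<in> H" using Hdiff[OF k Hmult[OF n(2)]] by simp
    moreover have pos: "0 < k mod int n"
      using nd n(1) by (metis dvd_eq_mod_eq_0 le_less of_nat_0_less_iff pos_mod_sign)
    ultimately have "n \<le> nat (k mod int n)"
      unfolding n_def by (intro Least_le) (simp add: n_def[symmetric])
    moreover have "k mod int n < int n" using n(1) by simp
    ultimately show False using pos by linarith
  qed
  then have "\<not> int n > 1" using small by blast
  then have "n = 1" using n(1) by simp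
  then show ?thesis using n(2) by (auto simp: H_def)
qed

text \<open>\<open>G\<close> is the direct sum of \<open>perp v G\<close> and the integer multiples
  of \<open>f\<close>; the coefficient of \<open>f\<close> can only be the value of v.\<close>

lemma decompose_by_unit:
  assumes G: "add_subgroup G" and v: "v \<in> dual_lattice W G" and f: "f \<in> G" "inner v f = 1" and x: "x \<in> G"
  obtains k :: int and y where "y \<in> perp v G" "x = y + of_int k *\<^sub>R f" "inner v x = of_int k"
proof -
  have "inner v x \<in> \<int>" using v x by (auto simp: dual_lattice_def)
  then obtain k where k: "inner v x = of_int k" by (elim Ints_cases)
  have "of_int k *\<^sub>R f \<in> G" using add_subgroup_of_int_scaleR[OF G f(1)] .
  then have "x - of_int k *\<^sub>R f \<in> perp v G"
    using G x f k by (auto simp: perp_def add_subgroup_def inner_diff_right)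
  then show ?thesis using that[of "x - of_int k *\<^sub>R f" k] k by simp
qed

text \<open>By the splitting of \<open>G\<close>, a vector of \<open>W\<close> that pairs integrally
  with \<open>perp v G\<close> is dual to \<open>G\<close> once its pairing with \<open>f\<close> is
  integral. Adding \<open>s *\<^sub>R v\<close> changes only that pairing, by s, so p has one lift
  for each s in a coset of the integers.\<close>

lemma lift_dual_perp:
  assumes G: "add_subgroup G" and W: "subspace W" and v: "v \<in> dual_lattice W G"
    and f: "f \<in> G" "inner v f = 1"
    and p: "p \<in> dual_lattice (perp v W) (perp v G)" and s: "inner p f + s \<in> \<int>"
  shows "p + s *\<^sub>R v \<in> dual_lattice W G"
  unfolding dual_lattice_def
proof safe
  show "p + s *\<^sub>R v \<in> W" using p v W
    by (auto simp: dual_lattice_def perp_def subspace_add subspace_scale)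
  fix x assume "x \<in> G"
  then obtain k y where y: "y \<in> perp v G" "x = y + of_int k *\<^sub>R f"
    using decompose_by_unit[OF G v f] by metis
  have "inner (p + s *\<^sub>R v) x = inner p y + of_int k * (inner p f + s)"
    using y f by (simp add: perp_def inner_add_left inner_add_right algebra_simps)
  moreover have "inner p y \<in> \<int>" using p y by (auto simp: dual_lattice_def)
  ultimately show "inner (p + s *\<^sub>R v) x \<in> \<int>" using s by simp
qed

text \<open>The map sending u to u - (inner v u) f carries \<open>G\<close> into
  \<open>perp v G\<close> and fixes every vector orthogonal to v.\<close>

lemma span_perp:
  assumes G: "add_subgroup G" and v: "v \<in> dual_lattice W G" and f: "f \<in> G" "inner v f = 1"
  shows "span (perp v G) = perp v (span G)"
proof
  have "subspace (perp v (span G))" by (simp add: subspace_perp)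
  moreover have "perp v G \<subseteq> perp v (span G)" by (auto simp: perp_def span_base)
  ultimately show "span (perp v G) \<subseteq> perp v (span G)" by (rule span_minimal[rotated])
next
  have *: "u - inner v u *\<^sub>R f \<in> span (perp v G)" if "u \<in> span G" for u
    using that
  proof (induction rule: span_induct_alt)
    case base
    then show ?case by (simp add: span_zero)
  next
    case (step c x y)
    obtain k z where z: "z \<in> perp v G" "x = z + of_int k *\<^sub>R f" "inner v x = of_int k"
      using decompose_by_unit[OF G v f step(1)] by metis
    have "inner v (c *\<^sub>R x + y) = c * of_int k + inner v y"
      using z(3) by (simp only: inner_add_right inner_scaleR_right)
    then have "c *\<^sub>R x + y - inner v (c *\<^sub>R x + y) *\<^sub>R f = c *\<^sub>R z + (y - inner v y *\<^sub>R f)"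
      by (simp only: z(2)) (simp add: algebra_simps)
    moreover have "c *\<^sub>R z + (y - inner v y *\<^sub>R f) \<in> span (perp v G)"
      by (intro span_add span_scale span_base z(1) step(2))
    ultimately show ?case by (simp only:)
  qed
  show "perp v (span G) \<subseteq> span (perp v G)"
  proof
    fix u assume "u \<in> perp v (span G)"
    then show "u \<in> span (perp v G)" using *[of u] by (simp add: perp_def)
  qed
qed

text \<open>One of the lifts p + s v has |s| \<le> 1/2. It is nonzero, hence at least as long as v,
  and Pythagoras gives |p|^2 \<ge> (3/4) |v|^2, which is more than enough.\<close>

lemma norm_lower_bound_dual_perp:
  assumes G: "add_subgroup G" and W: "subspace W" and v: "v \<in> dual_lattice W G" "v \<noteq> 0"
    and min: "\<And>p. p \<in> dual_lattice W G \<Longrightarrow> p \<noteq> 0 \<Longrightarrow> norm v \<le> norm p"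
    and f: "f \<in> G" "inner v f = 1"
    and p: "p \<in> dual_lattice (perp v W) (perp v G)" "p \<noteq> 0"
  shows "norm v / 2 \<le> norm p"
proof -
  define s where "s = of_int (round (inner p f)) - inner p f"
  have s: "\<bar>s\<bar> \<le> 1 / 2" unfolding s_def using of_int_round_abs_le by blast
  have "p + s *\<^sub>R v \<in> dual_lattice W G"
    by (rule lift_dual_perp[OF G W v(1) f p(1)]) (simp add: s_def)
  moreover have vp: "inner v p = 0" using p by (auto simp: dual_lattice_def perp_def)
  moreover have "p + s *\<^sub>R v \<noteq> 0"
  proof
    assume "p + s *\<^sub>R v = 0"
    then have "inner p (p + s *\<^sub>R v) = 0" by simp
    then show False using vp p(2) by (simp add: inner_add_right inner_commute)
  qed
  ultimately have "(norm v)\<^sup>2 \<le> (norm (p + s *\<^sub>R v))\<^sup>2" using min by (intro power_mono) auto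
  also have "\<dots> = (norm p)\<^sup>2 + s\<^sup>2 * (norm v)\<^sup>2" using norm_add_orth[OF vp] .
  also have "s\<^sup>2 \<le> (1/2)\<^sup>2" using s power_mono[OF s abs_ge_zero, of 2] by simp
  then have "s\<^sup>2 * (norm v)\<^sup>2 \<le> (1/2)\<^sup>2 * (norm v)\<^sup>2" by (rule mult_right_mono) simp
  finally have "(norm v)\<^sup>2 \<le> (norm p)\<^sup>2 + (norm v)\<^sup>2 / 4" by (simp add: power2_eq_square)
  then have "(norm v / 2)\<^sup>2 \<le> (norm p)\<^sup>2"
    using zero_le_power2[of "norm p"] by (simp only: power_divide power2_eq_square[of 2])
  then show ?thesis by (rule power2_le_imp_le) simp
qed

section \<open>Shortest dual vectors, dimension reduction and transference\<close>

definition locally_finite :: "'a::real_normed_vector set \<Rightarrow> bool" where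
  "locally_finite L \<longleftrightarrow> (\<forall>R. finite {p \<in> L. norm p \<le> R})"

lemma locally_finite_subset: "locally_finite L \<Longrightarrow> M \<subseteq> L \<Longrightarrow> locally_finite M"
  unfolding locally_finite_def
  by (intro allI, rule finite_subset[where B = "{p \<in> L. norm p \<le> R}" for R]) auto

lemma exists_shortest:
  assumes "locally_finite L" "p \<in> L" "p \<noteq> 0"
  shows "\<exists>v\<in>L. v \<noteq> 0 \<and> (\<forall>q\<in>L. q \<noteq> 0 \<longrightarrow> norm v \<le> norm q)"
proof -
  let ?S = "{q \<in> L. norm q \<le> norm p} - {0}"
  have fin: "finite ?S" using assms(1) by (simp add: locally_finite_def)
  have ne: "?S \<noteq> {}" using assms by auto
  define v where "v = arg_min_on norm ?S"
  have v: "v \<in> ?S" "\<And>q. q \<in> ?S \<Longrightarrow> norm v \<le> norm q"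
    unfolding v_def using arg_min_if_finite(1)[OF fin ne] arg_min_least[OF fin ne] by blast+
  have "norm v \<le> norm q" if "q \<in> L" "q \<noteq> 0" for q
  proof (cases "norm q \<le> norm p")
    case True
    then show ?thesis using v(2)[of q] that by auto
  next
    case False
    then show ?thesis using v(1) by auto
  qed
  then show ?thesis using v(1) by blast
qed

text \<open>Lifting with bounded s embeds the vectors of norm at most R into a ball of the dual of
  \<open>G\<close>; projecting along v undoes the lift.\<close>

lemma locally_finite_dual_perp:
  assumes G: "add_subgroup G" and W: "subspace W" and v: "v \<in> dual_lattice W G"
    and f: "f \<in> G" "inner v f = 1"
    and lf: "locally_finite (dual_lattice W G)"
  shows "locally_finite (dual_lattice (perp v W) (perp v G))"
  unfolding locally_finite_def
proof
  fix R
  define s where "s p = of_int (round (inner p f)) - inner p f" for p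
  let ?S = "{p \<in> dual_lattice (perp v W) (perp v G). norm p \<le> R}"
  have sb: "\<bar>s p\<bar> \<le> 1" for p
  proof -
    have "\<bar>s p\<bar> \<le> 1 / 2" unfolding s_def by (rule of_int_round_abs_le)
    then show ?thesis by simp
  qed
  have "(\<lambda>p. p + s p *\<^sub>R v) ` ?S \<subseteq> {p \<in> dual_lattice W G. norm p \<le> R + norm v}"
  proof safe
    fix p assume p: "p \<in> dual_lattice (perp v W) (perp v G)" "norm p \<le> R"
    show "p + s p *\<^sub>R v \<in> dual_lattice W G"
      by (rule lift_dual_perp[OF G W v f p(1)]) (simp add: s_def)
    have "norm (p + s p *\<^sub>R v) \<le> norm p + \<bar>s p\<bar> * norm v"
      by (metis norm_scaleR norm_triangle_ineq)
    also have "\<bar>s p\<bar> * norm v \<le> 1 * norm v" using sb by (intro mult_right_mono) auto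
    finally show "norm (p + s p *\<^sub>R v) \<le> R + norm v" using p by simp
  qed
  then have "finite ((\<lambda>p. p + s p *\<^sub>R v) ` ?S)"
    by (rule finite_subset) (use lf in \<open>simp add: locally_finite_def\<close>)
  moreover have "inj_on (\<lambda>p. p + s p *\<^sub>R v) ?S"
  proof (rule inj_onI)
    fix p q assume pq: "p \<in> ?S" "q \<in> ?S" "p + s p *\<^sub>R v = q + s q *\<^sub>R v"
    then have "inner v p = 0" "inner v q = 0" by (auto simp: dual_lattice_def perp_def)
    moreover have "proj_perp v (p + s p *\<^sub>R v) = proj_perp v (q + s q *\<^sub>R v)" using pq by simp
    moreover have "v \<noteq> 0" using f by auto
    ultimately show "p = q" by (simp add: proj_perp_def inner_add_right algebra_simps)
  qed
  ultimately show "finite ?S" by (rule finite_imageD)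
qed

text \<open>The size of a spanning set serves as the dimension. By exchange v replaces some b in
  \<open>B\<close>; since \<open>proj_perp v\<close> kills v and fixes \<open>perp v W\<close>, the
  projections of the remaining elements of \<open>B\<close> suffice.\<close>

lemma span_perp_reduce_card:
  assumes B: "finite B" "W \<subseteq> span B" and v: "v \<in> W" "v \<noteq> 0"
  obtains B' where "finite B'" "card B' < card B" "perp v W \<subseteq> span B'"
proof -
  have "\<exists>b\<in>B. b \<in> span (insert v (B - {b}))"
  proof -
    obtain T where T: "T \<subseteq> B" "independent T" "B \<subseteq> span T"
      using maximal_independent_subset by metis
    have "v \<in> span T" using v(1) B(2) span_minimal[OF T(3) subspace_span] by blast
    then have "\<exists>t\<in>T. t \<in> span (insert v (T - {t}))"
    proof -
      obtain t u where tu: "finite t" "t \<subseteq> T" "v = (\<Sum>a\<in>t. u a *\<^sub>R a)"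
        using \<open>v \<in> span T\<close> unfolding span_explicit by blast
      then obtain a where a: "a \<in> t" "u a \<noteq> 0" using v(2) by (metis (no_types, lifting) scaleR_zero_left sum.neutral)
      have "v = u a *\<^sub>R a + (\<Sum>b\<in>t - {a}. u b *\<^sub>R b)" using tu a by (simp add: sum.remove)
      then have eq: "a = (1 / u a) *\<^sub>R (v - (\<Sum>b\<in>t - {a}. u b *\<^sub>R b))" using a by simp
      have "a \<in> span (insert v (T - {a}))"
        apply (subst eq)
        by (intro span_scale span_diff span_sum) (use tu in \<open>auto intro!: span_base\<close>)
      then show ?thesis using a tu by blast
    qed
    then obtain t where t: "t \<in> T" "t \<in> span (insert v (T - {t}))" by blast
    have "span (insert v (T - {t})) \<subseteq> span (insert v (B - {t}))" using T by (intro span_mono) auto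
    then show ?thesis using t T by blast
  qed
  then obtain b where b: "b \<in> B" "b \<in> span (insert v (B - {b}))" by blast
  have B2: "B \<subseteq> span (insert v (B - {b}))" using b(2) by (auto intro: span_base)
  let ?B' = "proj_perp v ` (B - {b})"
  have "perp v W \<subseteq> span ?B'"
  proof
    fix w assume w: "w \<in> perp v W"
    then have "w \<in> span (insert v (B - {b}))"
      using B(2) span_minimal[OF B2 subspace_span] by (auto simp: perp_def)
    then have "proj_perp v w \<in> proj_perp v ` span (insert v (B - {b}))" by blast
    also have "\<dots> = span (proj_perp v ` insert v (B - {b}))"
      by (rule linear_span_image[OF linear_proj_perp, symmetric])
    also have "\<dots> = span ?B'" using v by (simp add: proj_perp_def[of v v])
    finally show "w \<in> span ?B'" using w by (simp add: perp_def proj_perp_id)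
  qed
  moreover have "card ?B' < card B"
    using b(1) B(1) by (metis card_Diff1_less card_image_le finite_Diff order_le_less_trans)
  ultimately show ?thesis using that[of ?B'] B(1) by blast
qed

text \<open>In terms of pairings this says that the projection of \<open>G\<close> to
  \<open>W\<close> has a nonzero vector of length at most 2^d / l. If v is shortest and
  \<open>W\<close> is a line, a vector f with inner v f = 1 will do. Otherwise the vector found for
  \<open>perp v W\<close> works unchanged, because it is orthogonal to v. The lower bound l may be
  halved at each step, which is the source of 2^d.\<close>

lemma transference:
  assumes "finite B" "W \<subseteq> span B" "card B \<le> d"
    and "add_subgroup G" "subspace W" "W \<noteq> {0}" "W \<subseteq> span (dual_lattice W G)"
    and "locally_finite (dual_lattice W G)"
    and "l > 0" "\<And>p. p \<in> dual_lattice W G \<Longrightarrow> p \<noteq> 0 \<Longrightarrow> l \<le> norm p"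
  shows "\<exists>f\<in>G. (\<exists>w\<in>W. inner w f \<noteq> 0) \<and> (\<forall>w\<in>W. \<bar>inner w f\<bar> \<le> 2 ^ d * norm w / l)"
  using assms
proof (induction d arbitrary: B W G l)
  case 0
  then have "B = {}" by simp
  then have "W \<subseteq> {0}" using 0 by simp
  then show ?case using 0(5,6) subspace_0 by blast
next
  case (Suc d)
  note G = Suc.prems(4) and W = Suc.prems(5)
  have "\<exists>p\<in>dual_lattice W G. p \<noteq> 0"
  proof (rule ccontr)
    assume "\<not> ?thesis"
    then have "span (dual_lattice W G) \<subseteq> span {0}" by (intro span_mono) auto
    then have "W \<subseteq> {0}" using Suc.prems(7) by simp
    then show False using Suc.prems(6) subspace_0[OF W] by blast
  qed
  then obtain v where v: "v \<in> dual_lattice W G" "v \<noteq> 0"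
    and min: "\<And>p. p \<in> dual_lattice W G \<Longrightarrow> p \<noteq> 0 \<Longrightarrow> norm v \<le> norm p"
    using exists_shortest[OF Suc.prems(8)] by blast
  obtain f where f: "f \<in> G" "inner v f = 1"
    using exists_inner_eq_one_if_shortest[OF G W v min] by blast
  have vW: "v \<in> W" using v by (simp add: dual_lattice_def)
  have lv: "l \<le> norm v" using Suc.prems(10) v by blast
  define W' where "W' = perp v W"
  define G' where "G' = perp v G"
  have decomp: "w = proj_perp v w + (inner v w / inner v v) *\<^sub>R v" for w by (simp add: proj_perp_def)
  show ?case
  proof (cases "W' = {0}")
    case True
    have "\<bar>inner w f\<bar> \<le> 2 ^ Suc d * norm w / l" if "w \<in> W" for w
    proof -
      have "proj_perp v w = 0" using True proj_perp_in_perp[OF W vW v(2) that] W'_def by blast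
      then have "w = (inner v w / inner v v) *\<^sub>R v" using decomp by (metis add_0)
      then obtain t where t: "w = t *\<^sub>R v" by blast
      have "\<bar>inner w f\<bar> * l = \<bar>t\<bar> * l" using t f by simp
      also have "\<dots> \<le> \<bar>t\<bar> * norm v" using lv by (intro mult_left_mono) auto
      also have "\<dots> = 1 * norm w" using t by simp
      also have "\<dots> \<le> 2 ^ Suc d * norm w" by (intro mult_right_mono one_le_power) auto
      finally show ?thesis using Suc.prems(9) by (simp add: field_simps)
    qed
    then show ?thesis using f vW by (intro bexI[of _ f] conjI bexI[of _ v]) auto
  next
    case False
    obtain B' where B': "finite B'" "card B' < card B" "W' \<subseteq> span B'"
      using span_perp_reduce_card[OF Suc.prems(1,2) vW v(2)] W'_def by metis
    have W's: "W' \<subseteq> span (dual_lattice W' G')"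
    proof
      fix w assume w: "w \<in> W'"
      then have "w \<in> span (dual_lattice W G)" using Suc.prems(7) by (auto simp: W'_def perp_def)
      then have "proj_perp v w \<in> span (proj_perp v ` dual_lattice W G)"
        using linear_span_image[OF linear_proj_perp] by (metis imageI)
      moreover have "proj_perp v ` dual_lattice W G \<subseteq> dual_lattice W' G'"
      proof safe
        fix p assume p: "p \<in> dual_lattice W G"
        have "proj_perp v p \<in> W'"
          unfolding W'_def using p by (intro proj_perp_in_perp[OF W vW v(2)]) (simp add: dual_lattice_def)
        moreover have "inner (proj_perp v p) x = inner p x" if "x \<in> G'" for x
          using that by (simp add: G'_def perp_def inner_proj_perp_swap[symmetric] proj_perp_id)
        ultimately show "proj_perp v p \<in> dual_lattice W' G'"
          using p by (auto simp: dual_lattice_def G'_def perp_def)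
      qed
      ultimately have "proj_perp v w \<in> span (dual_lattice W' G')" using span_mono by blast
      then show "w \<in> span (dual_lattice W' G')" using w by (simp add: W'_def perp_def proj_perp_id)
    qed
    have lf: "locally_finite (dual_lattice W' G')"
      unfolding W'_def G'_def by (rule locally_finite_dual_perp[OF G W v(1) f Suc.prems(8)])
    have lb: "l / 2 \<le> norm p" if "p \<in> dual_lattice W' G'" "p \<noteq> 0" for p
      using norm_lower_bound_dual_perp[OF G W v min f, of p] that lv by (simp add: W'_def G'_def)
    obtain h where h: "h \<in> G'" "\<exists>w\<in>W'. inner w h \<noteq> 0"
      "\<And>w. w \<in> W' \<Longrightarrow> \<bar>inner w h\<bar> \<le> 2 ^ d * norm w / (l / 2)"
    proof -
      have "card B' \<le> d" "l / 2 > 0" "add_subgroup G'" "subspace W'"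
        using B'(2) Suc.prems(3,9) subspace_perp[OF W, of v] add_subgroup_perp[OF G, of v]
        by (auto simp: W'_def G'_def)
      from Suc.IH[OF B'(1,3) this(1,3,4) False W's lf this(2) lb] show thesis using that by blast
    qed
    have "\<bar>inner w h\<bar> \<le> 2 ^ Suc d * norm w / l" if w: "w \<in> W" for w
    proof -
      have "inner w h = inner (proj_perp v w) h"
        using h(1) by (simp add: G'_def perp_def inner_proj_perp_swap[symmetric] proj_perp_id)
      then have "\<bar>inner w h\<bar> \<le> 2 ^ d * norm (proj_perp v w) / (l / 2)"
        using h(3)[of "proj_perp v w"] proj_perp_in_perp[OF W vW v(2) w] by (simp add: W'_def)
      also have "\<dots> \<le> 2 ^ d * norm w / (l / 2)"
        using Suc.prems(9) norm_proj_perp_le by (intro divide_right_mono mult_left_mono) auto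
      finally show ?thesis by (simp add: field_simps)
    qed
    then show ?thesis using h by (auto simp: G'_def W'_def perp_def)
  qed
qed

section \<open>Lattice points in balls\<close>

text \<open>\<open>K\<close> plays the role of a constant over the covolume of a lattice of rank
  \<open>m\<close>. The centre is arbitrary because \<open>point_bound_perp\<close> covers a long
  segment by translated balls.\<close>

definition point_bound :: "'a::real_normed_vector set \<Rightarrow> nat \<Rightarrow> real \<Rightarrow> bool" where
  "point_bound L m K \<longleftrightarrow> (\<forall>p0 R. R \<ge> 1 \<longrightarrow>
     finite {p \<in> L. norm (p - p0) \<le> R} \<and> real (card {p \<in> L. norm (p - p0) \<le> R}) \<le> K * R ^ m)"

lemma point_boundD:
  assumes "point_bound L m K" "R \<ge> 1"
  shows "finite {p \<in> L. norm (p - p0) \<le> R}" "real (card {p \<in> L. norm (p - p0) \<le> R}) \<le> K * R ^ m"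
  using assms by (auto simp: point_bound_def)

lemma point_boundD0:
  assumes "point_bound L m K" "R \<ge> 1"
  shows "finite {p \<in> L. norm p \<le> R}" "real (card {p \<in> L. norm p \<le> R}) \<le> K * R ^ m"
  using point_boundD[OF assms, of 0] by auto

lemma point_bound_imp_locally_finite:
  assumes "point_bound L m K"
  shows "locally_finite L"
  unfolding locally_finite_def
proof
  fix R
  show "finite {p \<in> L. norm p \<le> R}"
    by (rule finite_subset[OF _ point_boundD0(1)[OF assms, of "max 1 R"]]) auto
qed

lemma point_bound_ge_one:
  assumes "point_bound L m K" "0 \<in> L"
  shows "K \<ge> 1"
proof -
  have "card {0::'a} \<le> card {p \<in> L. norm p \<le> 1}"
    using assms point_boundD0(1)[OF assms(1), of 1] by (intro card_mono) auto
  then show ?thesis using point_boundD0(2)[OF assms(1), of 1] by simp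
qed

lemma perp_add_scaleR_inject:
  assumes "inner v p = 0" "inner v q = 0" "v \<noteq> 0" "p + s *\<^sub>R v = q + t *\<^sub>R v"
  shows "p = q \<and> s = t"
proof -
  have "inner v (p + s *\<^sub>R v) = inner v (q + t *\<^sub>R v)" using assms(4) by simp
  then have "s = t" using assms(1-3) by (simp add: inner_add_right)
  then show ?thesis using assms(4) by simp
qed

text \<open>Projection along v multiplies the density by about |v|. If |v| \<le> R, every point of
  the smaller dual lattice has about R / |v| lifts in a ball of radius 3 R. If |v| > R, one lift per
  point is kept, and the lifts are caught by about |v| / R balls of radius 2 R with centres on the
  segment from p0 to p0 + v.\<close>

lemma point_bound_perp:
  assumes G: "add_subgroup G" and W: "subspace W" and v: "v \<in> dual_lattice W G"
    and f: "f \<in> G" "inner v f = 1"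
    and pb: "point_bound (dual_lattice W G) (Suc m) K"
  shows "point_bound (dual_lattice (perp v W) (perp v G)) m (2 * 3 ^ Suc m * norm v * K)"
  unfolding point_bound_def
proof (intro allI impI)
  fix p0 :: 'a and R :: real assume R: "R \<ge> 1"
  let ?D = "dual_lattice W G"
  let ?S = "{p \<in> dual_lattice (perp v W) (perp v G). norm (p - p0) \<le> R}"
  \<comment> \<open>Rounding up makes \<open>s p\<close> nonnegative, so that
    \<open>s p + real i\<close> with i < N stays between 0 and N.\<close>
  define s where "s p = of_int \<lceil>inner p f\<rceil> - inner p f" for p
  have s: "0 \<le> s p" "s p \<le> 1" for p unfolding s_def by linarith+
  have v0: "v \<noteq> 0" using f by auto
  then have nv: "norm v > 0" by simp
  have K: "K \<ge> 1" using pb W by (intro point_bound_ge_one[OF pb]) (simp add: dual_lattice_def subspace_0)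
  have lift: "p + (s p + real i) *\<^sub>R v \<in> ?D" if "p \<in> ?S" for p i
    using that by (intro lift_dual_perp[OF G W v f]) (auto simp: s_def)
  have orth: "inner v p = 0" if "p \<in> ?S" for p using that by (auto simp: dual_lattice_def perp_def)
  show "finite ?S \<and> real (card ?S) \<le> 2 * 3 ^ Suc m * norm v * K * R ^ m"
  proof (cases "norm v \<le> R")
    case True
    \<comment> \<open>Large enough for N |v| \<ge> R, and small enough for N |v| \<le> R + |v| \<le>
      2 R, which keeps all N lifts within 3 R of the centre.\<close>
    define N where "N = nat \<lceil>R / norm v\<rceil>"
    have Nr: "R / norm v \<le> real N" unfolding N_def by linarith
    have "real N \<le> R / norm v + 1" unfolding N_def using R nv by (simp add: of_nat_ceiling)
    then have Nu: "real N * norm v \<le> R + norm v" using nv by (simp add: field_simps)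
    have "R / norm v > 0" using R nv by simp
    then have N0: "N > 0" using Nr by (cases "N = 0") auto
    let ?T = "{q \<in> ?D. norm (q - p0) \<le> 3 * R}"
    let ?h = "\<lambda>(p, i). p + (s p + real i) *\<^sub>R v"
    have "inj_on ?h (?S \<times> {..<N})"
    proof (rule inj_onI, clarsimp)
      fix p i q j
      assume pq: "p \<in> dual_lattice (perp v W) (perp v G)" "norm (p - p0) \<le> R"
        "q \<in> dual_lattice (perp v W) (perp v G)" "norm (q - p0) \<le> R"
        and eq: "p + (s p + real i) *\<^sub>R v = q + (s q + real j) *\<^sub>R v"
      have "p = q \<and> s p + real i = s q + real j"
        using pq by (intro perp_add_scaleR_inject[OF _ _ v0 eq] orth) auto
      then show "p = q \<and> i = j" by auto
    qed
    moreover have "?h ` (?S \<times> {..<N}) \<subseteq> ?T"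
    proof (clarify, intro conjI)
      fix p i assume p: "p \<in> dual_lattice (perp v W) (perp v G)" "norm (p - p0) \<le> R" and i: "i < N"
      show "p + (s p + real i) *\<^sub>R v \<in> ?D" using lift p by blast
      have "norm (p + (s p + real i) *\<^sub>R v - p0) = norm ((p - p0) + (s p + real i) *\<^sub>R v)"
        by (simp add: algebra_simps)
      also have "\<dots> \<le> norm (p - p0) + \<bar>s p + real i\<bar> * norm v"
        by (metis norm_scaleR norm_triangle_ineq)
      also have "\<bar>s p + real i\<bar> * norm v \<le> real N * norm v"
      proof -
        have "real i + 1 \<le> real N" using i by linarith
        then show ?thesis using s[of p] by (intro mult_right_mono) auto
      qed
      finally show "norm (p + (s p + real i) *\<^sub>R v - p0) \<le> 3 * R" using Nu p True by linarith
    qed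
    moreover have T: "finite ?T" "real (card ?T) \<le> K * (3 * R) ^ Suc m"
      using point_boundD[OF pb, of "3 * R" p0] R by auto
    ultimately have fin: "finite (?S \<times> {..<N})" and "card (?S \<times> {..<N}) \<le> card ?T"
      by (meson inj_on_finite, meson card_inj_on_le)
    then have "real (card ?S) * real N \<le> K * (3 * R) ^ Suc m"
      using T(2) by (simp add: card_cartesian_product flip: of_nat_mult)
    moreover have "real (card ?S) * (R / norm v) \<le> real (card ?S) * real N"
      using Nr by (intro mult_left_mono) auto
    ultimately have "real (card ?S) * (R / norm v) \<le> K * (3 * R) ^ Suc m" by linarith
    then have "real (card ?S) * R \<le> (3 ^ Suc m * norm v * K * R ^ m) * R"
      using nv by (simp add: field_simps power_mult_distrib)
    then have "real (card ?S) \<le> 3 ^ Suc m * norm v * K * R ^ m" using R by simp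
    also have "\<dots> \<le> 2 * (3 ^ Suc m * norm v * K * R ^ m)"
      using K nv R by simp
    finally have "real (card ?S) \<le> 2 * 3 ^ Suc m * norm v * K * R ^ m" by (simp add: mult.assoc)
    moreover have "finite ?S" using finite_cartesian_productD1[OF fin] N0 by (metis lessThan_empty_iff not_gr_zero)
    ultimately show ?thesis by blast
  next
    case False
    \<comment> \<open>Ball number i, centred at distance i R from \<open>p0\<close>, takes the lifts
      with s |v| between i R and (i + 1) R. As s \<le> 1, the indices up to the floor of |v| / R
      suffice.\<close>
    define N where "N = Suc (nat \<lfloor>norm v / R\<rfloor>)"
    let ?T = "\<lambda>i. {q \<in> ?D. norm (q - (p0 + (real i * R / norm v) *\<^sub>R v)) \<le> 2 * R}"
    let ?h = "\<lambda>p. p + s p *\<^sub>R v"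
    have "inj_on ?h ?S"
    proof (rule inj_onI)
      fix p q assume pq: "p \<in> ?S" "q \<in> ?S" and eq: "p + s p *\<^sub>R v = q + s q *\<^sub>R v"
      show "p = q" using perp_add_scaleR_inject[OF orth[OF pq(1)] orth[OF pq(2)] v0 eq] by simp
    qed
    moreover have "?h ` ?S \<subseteq> (\<Union>i<N. ?T i)"
    proof
      fix x assume "x \<in> ?h ` ?S"
      then obtain p where p: "p \<in> ?S" "x = p + s p *\<^sub>R v" by blast
      define i where "i = nat \<lfloor>s p * norm v / R\<rfloor>"
      have pos: "s p * norm v / R \<ge> 0" using s R by simp
      have i: "real i \<le> s p * norm v / R" "s p * norm v / R < real i + 1"
        using pos unfolding i_def by (auto simp: floor_le_iff)
      have "s p * norm v / R \<le> 1 * norm v / R" using s R by (intro divide_right_mono mult_right_mono) auto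
      then have "i \<le> nat \<lfloor>norm v / R\<rfloor>" unfolding i_def by (intro nat_mono floor_mono) simp
      then have iN: "i < N" by (simp add: N_def)
      have b: "real i * R \<le> s p * norm v" "s p * norm v \<le> real i * R + R"
        using i R by (auto simp: field_simps)
      have "x - (p0 + (real i * R / norm v) *\<^sub>R v) = (p - p0) + (s p - real i * R / norm v) *\<^sub>R v"
        using p by (simp add: algebra_simps)
      also have "norm \<dots> \<le> norm (p - p0) + \<bar>s p - real i * R / norm v\<bar> * norm v"
        by (metis norm_scaleR norm_triangle_ineq)
      also have "\<bar>s p - real i * R / norm v\<bar> * norm v = \<bar>(s p - real i * R / norm v) * norm v\<bar>"
        by (simp add: abs_mult)
      also have "(s p - real i * R / norm v) * norm v = s p * norm v - real i * R"
        using nv by (simp add: field_simps)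
      also have "\<bar>s p * norm v - real i * R\<bar> \<le> R" using b by linarith
      finally have "norm (x - (p0 + (real i * R / norm v) *\<^sub>R v)) \<le> 2 * R" using p by simp
      moreover have "x \<in> ?D" using lift[OF p(1), of 0] p(2) by simp
      ultimately show "x \<in> (\<Union>i<N. ?T i)" using iN by blast
    qed
    moreover have T: "finite (?T i)" "real (card (?T i)) \<le> K * (2 * R) ^ Suc m" for i
      using point_boundD[OF pb, of "2 * R"] R by auto
    have finT: "finite (\<Union>i<N. ?T i)" using T by blast
    ultimately have fin: "finite ?S" and "card ?S \<le> card (\<Union>i<N. ?T i)"
      by (meson inj_on_finite, meson card_inj_on_le)
    then have "real (card ?S) \<le> real (\<Sum>i<N. card (?T i))"
      using card_UN_le[OF finite_lessThan, of ?T N] by (meson of_nat_mono order_trans)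
    also have "\<dots> \<le> (\<Sum>i<N. K * (2 * R) ^ Suc m)"
      unfolding of_nat_sum using T(2) by (intro sum_mono) auto
    also have "\<dots> = real N * (K * (2 * R) ^ Suc m)" by simp
    also have "\<dots> \<le> (2 * norm v / R) * (K * (2 * R) ^ Suc m)"
    proof (intro mult_right_mono)
      have "norm v / R \<ge> 1" using False R by simp
      moreover have "real N \<le> norm v / R + 1" unfolding N_def using R by simp
      ultimately show "real N \<le> 2 * norm v / R" by simp
    qed (use K R in auto)
    also have "\<dots> = 2 * 2 ^ Suc m * norm v * K * R ^ m"
      using R by (simp add: power_mult_distrib)
    also have "\<dots> \<le> 2 * 3 ^ Suc m * norm v * K * R ^ m"
      using K R by (intro mult_right_mono mult_left_mono power_mono) auto
    finally show ?thesis using fin by blast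
  qed
qed

text \<open>Dyadic shells: between R / 2 and R there are at most K R^m vectors, each contributing at
  most R^(2 k) / (R / 2)^m. As k \<ge> 1, halving R divides the bound by at least 4, so the shells
  add up geometrically. The first summand of the constant pays for radii up to 2, where only
  \<open>c\<close> controls the denominator; the second satisfies 2^(m + 1) / 4 + 2^m \<le> 2^(m +
  1) and absorbs the outer shells.\<close>

lemma sum_norm_powers_le:
  fixes c :: real
  assumes pb: "point_bound L m K" and c: "c > 0" and k: "k \<ge> 1" and K: "K \<ge> 0" and R: "R \<ge> 1"
  shows "(\<Sum>v | v \<in> L \<and> c \<le> norm v \<and> norm v \<le> R. norm v ^ (2 * k) / norm v ^ m)
    \<le> (2 ^ (2 * k + m) / c ^ m + 2 ^ (m + 1)) * K * R ^ (2 * k)"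
proof -
  let ?C = "2 ^ (2 * k + m) / c ^ m + 2 ^ (m + 1)"
  let ?g = "\<lambda>v::'a. norm v ^ (2 * k) / norm v ^ m"
  let ?V = "\<lambda>R. {v \<in> L. c \<le> norm v \<and> norm v \<le> R}"
  have fin: "finite (?V R)" for R
    by (rule finite_subset[of _ "{p \<in> L. norm p \<le> max 1 R}"]) (auto intro: point_boundD0[OF pb])
  have "sum ?g (?V R) \<le> ?C * K * R ^ (2 * k)" if "R \<le> 2 ^ j" "R \<ge> 1" for j R
    using that
  proof (induction j arbitrary: R)
    case 0
    then have R1: "R = 1" by simp
    have "sum ?g (?V R) \<le> real (card (?V R)) * (1 / c ^ m)"
    proof (rule sum_bounded_above)
      fix v assume v: "v \<in> ?V R"
      then have "norm v ^ (2 * k) \<le> 1" using R1 by (simp add: power_le_one)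
      moreover have "c ^ m \<le> norm v ^ m" using v c by (intro power_mono) auto
      ultimately show "?g v \<le> 1 / c ^ m" using c by (intro frac_le) auto
    qed
    also have "real (card (?V R)) \<le> real (card {p \<in> L. norm p \<le> 1})"
      using R1 point_boundD0[OF pb, of 1] by (intro of_nat_mono card_mono) auto
    then have "real (card (?V R)) * (1 / c ^ m) \<le> K * (1 / c ^ m)"
      using point_boundD0[OF pb, of 1] c by (intro mult_right_mono) auto
    also have "K * (1 / c ^ m) \<le> K * ?C"
    proof (intro mult_left_mono)
      have "1 / c ^ m \<le> 2 ^ (2 * k + m) / c ^ m" using c by (intro divide_right_mono one_le_power) auto
      then show "1 / c ^ m \<le> ?C" by (simp add: add_increasing2)
    qed fact
    finally show ?case using R1 by (simp add: mult.commute)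
  next
    case (Suc j)
    show ?case
    proof (cases "R \<le> 2")
      case True
      have "sum ?g (?V R) \<le> real (card (?V R)) * (2 ^ (2 * k) / c ^ m)"
      proof (rule sum_bounded_above)
        fix v assume v: "v \<in> ?V R"
        then have "norm v ^ (2 * k) \<le> 2 ^ (2 * k)" using True by (intro power_mono) auto
        moreover have "c ^ m \<le> norm v ^ m" using v c by (intro power_mono) auto
        ultimately show "?g v \<le> 2 ^ (2 * k) / c ^ m" using c by (intro frac_le) auto
      qed
      also have "real (card (?V R)) \<le> real (card {p \<in> L. norm p \<le> 2})"
        using True point_boundD0[OF pb, of 2] by (intro of_nat_mono card_mono) auto
      then have "real (card (?V R)) * (2 ^ (2 * k) / c ^ m) \<le> (K * 2 ^ m) * (2 ^ (2 * k) / c ^ m)"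
        using point_boundD0[OF pb, of 2] c by (intro mult_right_mono) auto
      also have "\<dots> = (2 ^ (2 * k + m) / c ^ m) * K * 1" by (simp add: power_add)
      also have "\<dots> \<le> ?C * K * R ^ (2 * k)"
        using K c Suc.prems by (intro mult_mono one_le_power) auto
      finally show ?thesis .
    next
      case False
      have split: "?V R = ?V (R / 2) \<union> (?V R - ?V (R / 2))" using False by auto
      have "sum ?g (?V R) = sum ?g (?V (R / 2)) + sum ?g (?V R - ?V (R / 2))"
        by (subst split, subst sum.union_disjoint) (use fin[of R] fin[of "R / 2"] in auto)
      also have "sum ?g (?V (R / 2)) \<le> ?C * K * (R / 2) ^ (2 * k)"
        using Suc.prems False by (intro Suc.IH) auto
      also have "sum ?g (?V R - ?V (R / 2)) \<le> real (card (?V R - ?V (R / 2))) * (R ^ (2 * k) / (R / 2) ^ m)"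
      proof (rule sum_bounded_above)
        fix v assume v: "v \<in> ?V R - ?V (R / 2)"
        then have "norm v ^ (2 * k) \<le> R ^ (2 * k)" by (intro power_mono) auto
        moreover have "(R / 2) ^ m \<le> norm v ^ m" using v False by (intro power_mono) auto
        ultimately show "?g v \<le> R ^ (2 * k) / (R / 2) ^ m" using False by (intro frac_le) auto
      qed
      also have "real (card (?V R - ?V (R / 2))) \<le> real (card {p \<in> L. norm p \<le> R})"
        using Suc.prems point_boundD0[OF pb, of R] by (intro of_nat_mono card_mono) auto
      then have "real (card (?V R - ?V (R / 2))) * (R ^ (2 * k) / (R / 2) ^ m)
        \<le> (K * R ^ m) * (R ^ (2 * k) / (R / 2) ^ m)"
        using point_boundD0[OF pb, of R] Suc.prems by (intro mult_right_mono) auto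
      also have "(K * R ^ m) * (R ^ (2 * k) / (R / 2) ^ m) = 2 ^ m * K * R ^ (2 * k)"
        using Suc.prems by (simp add: power_divide)
      finally have "sum ?g (?V R) \<le> ?C * K * (R / 2) ^ (2 * k) + 2 ^ m * K * R ^ (2 * k)" by simp
      also have "?C * K * (R / 2) ^ (2 * k) \<le> ?C * K * (R ^ (2 * k) / 4)"
      proof (intro mult_left_mono)
        have "(2::real) ^ 2 \<le> 2 ^ (2 * k)" using k by (intro power_increasing) auto
        then show "(R / 2) ^ (2 * k) \<le> R ^ (2 * k) / 4"
          unfolding power_divide using Suc.prems by (intro divide_left_mono) auto
      qed (use K c in auto)
      finally have "sum ?g (?V R) \<le> ?C * K * (R ^ (2 * k) / 4) + 2 ^ m * K * R ^ (2 * k)" by simp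
      moreover have "a * b * (d / 4) + e * b * d = (a / 4 + e) * (b * d)" for a b d e :: real
        by (simp add: field_simps)
      ultimately have "sum ?g (?V R) \<le> (?C / 4 + 2 ^ m) * (K * R ^ (2 * k))" by (simp only:)
      also have "\<dots> \<le> ?C * (K * R ^ (2 * k))"
      proof (intro mult_right_mono)
        have "(a + 2 * b) / 4 + b \<le> a + 2 * b" if "a \<ge> 0" "b \<ge> 0" for a b :: real
          using that by simp
        from this[of "2 ^ (2 * k + m) / c ^ m" "2 ^ m"]
        show "?C / 4 + 2 ^ m \<le> ?C" using c by (simp only: power_add power_one_right mult.commute[of 2]) simp
      qed (use K Suc.prems in auto)
      finally show ?thesis by (simp add: mult.assoc)
    qed
  qed
  moreover obtain j where "R \<le> 2 ^ j" using real_arch_pow[of 2 R] by (meson less_imp_le one_less_numeral_iff semiring_norm(76))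
  ultimately show ?thesis using R by blast
qed

section \<open>Counting integral skew operators\<close>

text \<open>\<open>X\<close> bounds the operator norm, and \<open>S\<close> expresses rank at most 2
  k through independent kernel vectors. The kernel is measured in \<open>span B\<close>, which stays
  fixed while \<open>G\<close> shrinks along the induction; the directions split off earlier count
  as kernel. The bound \<open>c\<close> on dual vectors in the image is the invariant, halved at
  each compression, that controls the sum over v uniformly in \<open>G\<close>.\<close>

definition skew_forms :: "'a::real_inner set \<Rightarrow> 'a set \<Rightarrow> nat \<Rightarrow> real \<Rightarrow> real \<Rightarrow> ('a \<Rightarrow> 'a) set" where
  "skew_forms B G k c X = {A. linear A \<and> (\<forall>x y. inner x (A y) = - inner (A x) y) \<and>
     range A \<subseteq> span G \<and> (\<forall>x\<in>G. \<forall>y\<in>G. inner x (A y) \<in> \<int>) \<and> (\<forall>x. norm (A x) \<le> X * norm x) \<and>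
     (\<exists>S. finite S \<and> independent S \<and> S \<subseteq> span B \<and> card B \<le> card S + 2 * k \<and> (\<forall>s\<in>S. A s = 0)) \<and>
     (\<forall>p\<in>dual_lattice (A ` span G) G. p \<noteq> 0 \<longrightarrow> c \<le> norm p)}"

definition compress :: "'a::real_inner \<Rightarrow> ('a \<Rightarrow> 'a) \<Rightarrow> 'a \<Rightarrow> 'a" where
  "compress v A x = proj_perp v (A (proj_perp v x))"

lemma skew_formsD:
  assumes "A \<in> skew_forms B G k c X"
  shows "linear A" "inner x (A y) = - inner (A x) y" "A x \<in> span G"
    "x \<in> G \<Longrightarrow> y \<in> G \<Longrightarrow> inner x (A y) \<in> \<int>" "norm (A x) \<le> X * norm x"
    "\<exists>S. finite S \<and> independent S \<and> S \<subseteq> span B \<and> card B \<le> card S + 2 * k \<and> (\<forall>s\<in>S. A s = 0)"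
    "p \<in> dual_lattice (A ` span G) G \<Longrightarrow> p \<noteq> 0 \<Longrightarrow> c \<le> norm p"
  using assms by (auto simp: skew_forms_def)

lemma skew_forms_mono:
  assumes "X \<le> Y"
  shows "skew_forms B G k c X \<subseteq> skew_forms B G k c Y"
proof
  fix A assume A: "A \<in> skew_forms B G k c X"
  have "\<forall>x. norm (A x) \<le> Y * norm x"
    using order_trans[OF skew_formsD(5)[OF A] mult_right_mono[OF assms norm_ge_zero]] by blast
  then show "A \<in> skew_forms B G k c Y" using A unfolding skew_forms_def mem_Collect_eq by (elim conjE) (intro conjI)
qed

lemma subspace_image_span: "linear A \<Longrightarrow> subspace (A ` span G)"
  by (simp add: linear_subspace_image)

lemma skew_zero_if_zero_on_range:
  fixes A :: "'a::real_inner \<Rightarrow> 'a"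
  assumes skew: "\<And>x y. inner x (A y) = - inner (A x) y" and "\<And>x. A (A x) = 0"
  shows "A = (\<lambda>x. 0)"
proof
  fix x
  have "inner (A x) (A x) = - inner (A (A x)) x" by (rule skew)
  then show "A x = 0" using assms(2) by simp
qed

text \<open>With k = 0 the set \<open>S\<close> spans \<open>span B\<close>, as no independent set
  there has more than \<open>card B\<close> elements. So A vanishes on its own image, and inner (A
  x) (A x) = - inner (A (A x)) x = 0.\<close>

lemma skew_forms_0_subset:
  assumes B: "finite B" and GB: "span G \<subseteq> span B"
  shows "skew_forms B G 0 c X \<subseteq> {\<lambda>x. 0}"
proof
  fix A assume A: "A \<in> skew_forms B G 0 c X"
  obtain S where S: "finite S" "independent S" "S \<subseteq> span B" "card B \<le> card S" "\<forall>s\<in>S. A s = 0"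
    using skew_formsD(6)[OF A] by auto
  have "b \<in> span S" if b: "b \<in> span B" for b
  proof (rule ccontr)
    assume nb: "b \<notin> span S"
    then have "b \<notin> S" using span_base by blast
    have "independent (insert b S)" using S(2) nb by (simp add: independent_insertI)
    then have "card (insert b S) \<le> card B" using independent_span_bound[OF B] S(3) b by blast
    then show False using S(1,4) \<open>b \<notin> S\<close> by simp
  qed
  then have "A x = 0" if "x \<in> span B" for x
    using linear_eq_0_on_span[OF skew_formsD(1)[OF A], of S x] S(5) that by blast
  then have "A = (\<lambda>x. 0)" using skew_formsD(3)[OF A] GB
    by (intro skew_zero_if_zero_on_range skew_formsD(2)[OF A]) blast
  then show "A \<in> {\<lambda>x. 0}" by simp
qed

text \<open>Let v be a shortest dual vector in the image and f the vector from
  \<open>transference\<close>. Then A f is itself a dual vector, so |v| \<le> |A f|. On the other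
  hand |A f|^2 = - inner (A (A f)) f is at most 2^(card B) |A (A f)| / |v|, whence |A f| \<le>
  2^(card B) X / |v|.\<close>

lemma exists_short_dual_vector:
  assumes B: "finite B" and GB: "span G \<subseteq> span B" and G: "add_subgroup G"
    and A: "A \<in> skew_forms B G k c X" "A \<noteq> (\<lambda>x. 0)"
    and lf: "locally_finite (dual_lattice (span G) G)"
  shows "\<exists>v\<in>dual_lattice (A ` span G) G. v \<noteq> 0 \<and> (norm v)\<^sup>2 \<le> 2 ^ card B * X \<and>
    (\<forall>q\<in>dual_lattice (A ` span G) G. q \<noteq> 0 \<longrightarrow> norm v \<le> norm q)"
proof -
  define W where "W = A ` span G"
  note lin = skew_formsD(1)[OF A(1)] and skew = skew_formsD(2)[OF A(1)]
  have WG: "W \<subseteq> span G" using skew_formsD(3)[OF A(1)] by (auto simp: W_def)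
  have W: "subspace W" unfolding W_def by (rule subspace_image_span[OF lin])
  have W0: "W \<noteq> {0}"
  proof
    assume "W = {0}"
    then have "A (A x) = 0" for x using skew_formsD(3)[OF A(1), of x] unfolding W_def by blast
    then show False using skew_zero_if_zero_on_range[OF skew] A(2) by blast
  qed
  have AG: "A x \<in> dual_lattice W G" if "x \<in> G" for x
    using that skew_formsD(4)[OF A(1)] by (auto simp: dual_lattice_def W_def span_base inner_commute)
  have Wspan: "W \<subseteq> span (dual_lattice W G)"
  proof -
    have "W = span (A ` G)" unfolding W_def by (rule linear_span_image[OF lin, symmetric])
    also have "\<dots> \<subseteq> span (dual_lattice W G)" using AG by (intro span_mono) blast
    finally show ?thesis .
  qed
  have lfW: "locally_finite (dual_lattice W G)"
    by (rule locally_finite_subset[OF lf]) (use WG in \<open>auto simp: dual_lattice_def\<close>)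
  have "\<exists>p\<in>dual_lattice W G. p \<noteq> 0"
  proof (rule ccontr)
    assume "\<not> ?thesis"
    then have "span (dual_lattice W G) \<subseteq> span {0}" by (intro span_mono) auto
    then have "W \<subseteq> {0}" using Wspan by simp
    then show False using W0 subspace_0[OF W] by blast
  qed
  then obtain v where v: "v \<in> dual_lattice W G" "v \<noteq> 0"
    and min: "\<And>q. q \<in> dual_lattice W G \<Longrightarrow> q \<noteq> 0 \<Longrightarrow> norm v \<le> norm q"
    using exists_shortest[OF lfW] by blast
  have nv: "norm v > 0" using v by simp
  have WB: "W \<subseteq> span B" using WG GB by blast
  from transference[OF B WB order_refl G W W0 Wspan lfW nv min]
  obtain f where f: "f \<in> G" "\<exists>w\<in>W. inner w f \<noteq> 0"
    "\<And>w. w \<in> W \<Longrightarrow> \<bar>inner w f\<bar> \<le> 2 ^ card B * norm w / norm v" by blast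
  have Af: "A f \<in> dual_lattice W G" using AG f by blast
  \<comment> \<open>f is not orthogonal to the image, and inner (A e) f = - inner e (A f).\<close>
  have Af0: "A f \<noteq> 0"
  proof
    assume "A f = 0"
    obtain w where w: "w \<in> W" "inner w f \<noteq> 0" using f(2) by blast
    then obtain e where "w = A e" by (auto simp: W_def)
    then show False using skew[of e f] w \<open>A f = 0\<close> by simp
  qed
  have "A (A f) \<in> W" using skew_formsD(3)[OF A(1), of f] by (simp add: W_def)
  then have "norm (A f) * norm (A f) \<le> 2 ^ card B * norm (A (A f)) / norm v"
    using f(3)[of "A (A f)"] skew[of "A f" f] by (simp flip: power2_eq_square add: power2_norm_eq_inner)
  also have "\<dots> \<le> 2 ^ card B * (X * norm (A f)) / norm v"
    using skew_formsD(5)[OF A(1)] nv by (intro divide_right_mono mult_left_mono) auto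
  also have "\<dots> = (2 ^ card B * X / norm v) * norm (A f)" by simp
  finally have "norm (A f) \<le> 2 ^ card B * X / norm v"
    using Af0 by (simp only: mult_le_cancel_right) simp
  then have "norm v \<le> 2 ^ card B * X / norm v" using min[OF Af Af0] by linarith
  then have "(norm v)\<^sup>2 \<le> 2 ^ card B * X" using nv by (simp add: field_simps power2_eq_square)
  then show ?thesis using v min unfolding W_def by blast
qed

text \<open>Besides v, the kernel gains a preimage e of v, because A e = v is projected away; this
  is why the rank drops by two. Independence of v from e and the old kernel vectors is the delicate
  point: otherwise v would be an eigenvector of A, skewness leaves only the eigenvalue 0, and A v is
  not 0.\<close>

lemma compress_mem_skew_forms:
  assumes B: "finite B" and GB: "span G \<subseteq> span B" and G: "add_subgroup G"
    and A: "A \<in> skew_forms B G (Suc k) c X"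
    and v: "v \<in> dual_lattice (A ` span G) G" "v \<noteq> 0"
    and min: "\<And>q. q \<in> dual_lattice (A ` span G) G \<Longrightarrow> q \<noteq> 0 \<Longrightarrow> norm v \<le> norm q"
    and f: "f \<in> G" "inner v f = 1"
  shows "compress v A \<in> skew_forms B (perp v G) k (c / 2) X"
proof -
  note lin = skew_formsD(1)[OF A] and skew = skew_formsD(2)[OF A]
  define W where "W = A ` span G"
  have W: "subspace W" unfolding W_def by (rule subspace_image_span[OF lin])
  have vW: "v \<in> W" using v by (simp add: W_def dual_lattice_def)
  then obtain e where e: "e \<in> span G" "v = A e" by (auto simp: W_def)
  have vG: "v \<in> span G" using e skew_formsD(3)[OF A] by simp
  have sp: "span (perp v G) = perp v (span G)" using span_perp[OF G v(1) f] .
  have Aid: "compress v A x = proj_perp v (A x)" if "inner v x = 0" for x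
    using that by (simp add: compress_def proj_perp_id)
  have 1: "linear (compress v A)"
    using linear_compose[OF linear_compose[OF linear_proj_perp[of v] lin] linear_proj_perp[of v]]
    by (simp add: compress_def[abs_def] o_def)
  have 2: "inner x (compress v A y) = - inner (compress v A x) y" for x y
    by (simp add: compress_def inner_proj_perp_swap skew)
  have 3: "compress v A x \<in> span (perp v G)" for x
    unfolding sp compress_def by (rule proj_perp_in_perp[OF _ vG v(2)]) (auto intro: skew_formsD(3)[OF A])
  have 4: "inner x (compress v A y) \<in> \<int>" if "x \<in> perp v G" "y \<in> perp v G" for x y
  proof -
    have "inner x (compress v A y) = inner x (A y)"
      using that by (simp add: Aid perp_def inner_proj_perp_swap proj_perp_id)
    then show ?thesis using skew_formsD(4)[OF A] that by (simp add: perp_def)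
  qed
  have 5: "norm (compress v A x) \<le> X * norm x" for x
  proof -
    have "0 \<le> norm (A v)" by simp
    also have "norm (A v) \<le> X * norm v" by (rule skew_formsD(5)[OF A])
    finally have X: "X \<ge> 0" using v(2) by (simp add: zero_le_mult_iff)
    have "norm (compress v A x) \<le> norm (A (proj_perp v x))" unfolding compress_def by (rule norm_proj_perp_le)
    also have "\<dots> \<le> X * norm (proj_perp v x)" by (rule skew_formsD(5)[OF A])
    also have "\<dots> \<le> X * norm x" using X by (intro mult_left_mono norm_proj_perp_le)
    finally show ?thesis .
  qed
  have 6: "\<exists>S. finite S \<and> independent S \<and> S \<subseteq> span B \<and> card B \<le> card S + 2 * k \<and> (\<forall>s\<in>S. compress v A s = 0)"
  proof -
    obtain S where S: "finite S" "independent S" "S \<subseteq> span B" "card B \<le> card S + 2 * Suc k" "\<forall>s\<in>S. A s = 0"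
      using skew_formsD(6)[OF A] by blast
    have kerS: "A x = 0" if "x \<in> span S" for x
      using linear_eq_0_on_span[OF lin, of S x] S(5) that by blast
    have eS: "e \<notin> span S" using kerS e v(2) by auto
    \<comment> \<open>|v|^2 = inner v (A e) = - inner (A v) e.\<close>
    have Av: "A v \<noteq> 0"
    proof
      assume "A v = 0"
      then have "inner v v = 0" using skew[of v e] e(2) by simp
      then show False using v(2) by simp
    qed
    have vS: "v \<notin> span (insert e S)"
    proof
      assume "v \<in> span (insert e S)"
      then obtain a where "v - a *\<^sub>R e \<in> span S" using span_breakdown_eq by blast
      then have "A (v - a *\<^sub>R e) = 0" using kerS by blast
      then have a: "A v = a *\<^sub>R v" using e by (simp add: linear_diff[OF lin] linear_scale[OF lin])
      have "inner v (A v) = - inner v (A v)" using skew[of v v] by (simp add: inner_commute)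
      then have "a = 0" using a v(2) by simp
      then show False using a Av by simp
    qed
    let ?S = "insert v (insert e S)"
    have "independent ?S" using S(2) eS vS by (simp add: independent_insertI)
    moreover have "card ?S = card S + 2" using S(1) eS vS span_base by (metis One_nat_def add_2_eq_Suc' card_insert_disjoint finite_insert)
    moreover have "?S \<subseteq> span B" using S(3) e(1) vG GB by blast
    moreover have "compress v A s = 0" if s: "s \<in> ?S" for s
    proof -
      consider "s = v" | "s = e" | "s \<in> S" using s by blast
      then show ?thesis
      proof cases
        case 1
        then show ?thesis using v(2) linear_0[OF lin] by (simp add: compress_def proj_perp_def)
      next
        case 2
        have "inner v e = 0" using skew[of e e] e(2) by (simp add: inner_commute)
        then show ?thesis using 2 e(2)[symmetric] v(2) by (simp add: Aid proj_perp_def)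
      next
        case 3
        then have "A s = 0" using S(5) by blast
        then have "inner v s = 0" using skew[of e s] e(2) by simp
        then show ?thesis using \<open>A s = 0\<close> by (simp add: Aid proj_perp_def)
      qed
    qed
    ultimately show ?thesis using S(1,4) by (intro exI[of _ ?S]) auto
  qed
  \<comment> \<open>The image of the compression lies in \<open>perp v W\<close>, so
    \<open>norm_lower_bound_dual_perp\<close> applies to its dual vectors and gives |v| / 2, where
    |v| \<ge> c.\<close>
  have 7: "c / 2 \<le> norm p" if p: "p \<in> dual_lattice (compress v A ` span (perp v G)) (perp v G)" "p \<noteq> 0" for p
  proof -
    obtain y where y: "y \<in> perp v (span G)" "p = compress v A y"
      using p(1) sp by (auto simp: dual_lattice_def)
    then have "p = proj_perp v (A y)" by (simp add: Aid perp_def)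
    moreover have "A y \<in> W" using y by (auto simp: W_def perp_def)
    ultimately have "p \<in> perp v W" using proj_perp_in_perp[OF W vW v(2)] by simp
    then have "p \<in> dual_lattice (perp v W) (perp v G)" using p(1) by (simp add: dual_lattice_def)
    then have "norm v / 2 \<le> norm p"
      using norm_lower_bound_dual_perp[OF G W v[folded W_def] min[folded W_def] f, of p] p(2) by blast
    moreover have "c \<le> norm v" using skew_formsD(7)[OF A v] .
    ultimately show ?thesis by simp
  qed
  show ?thesis unfolding skew_forms_def using 1 2 3 4 5 6 7 by blast
qed

text \<open>The difference D of the two operators has zero compression, so it is determined by D v.
  Since f = proj f + v / |v|^2, the vector u is the projection of D v divided by |v|^2. Integrality
  of D f on \<open>perp v G\<close> makes u a dual vector, and |D v| \<le> 2 X |v| bounds its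
  length. As D v is orthogonal to v by skewness, the projection loses nothing.\<close>

lemma compress_fibre:
  assumes G: "add_subgroup G" and v: "v \<in> dual_lattice (span G) G" and f: "f \<in> G" "inner v f = 1"
    and A: "A \<in> skew_forms B G k c X" and A': "A' \<in> skew_forms B G k c X"
    and eq: "compress v A = compress v A'"
  defines "u \<equiv> proj_perp v (A f - A' f)"
  shows "u \<in> dual_lattice (span (perp v G)) (perp v G)" "norm u \<le> 2 * X / norm v" "u = 0 \<Longrightarrow> A = A'"
proof -
  have v0: "v \<noteq> 0" using f by auto
  then have nv: "norm v > 0" by simp
  have vG: "v \<in> span G" using v by (simp add: dual_lattice_def)
  have sp: "span (perp v G) = perp v (span G)" using span_perp[OF G v f] .
  define D where "D x = A x - A' x" for x
  have lin: "linear D" unfolding D_def[abs_def]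
    using skew_formsD(1)[OF A] skew_formsD(1)[OF A'] by (rule linear_compose_sub)
  have skew: "inner x (D y) = - inner (D x) y" for x y
    using skew_formsD(2)[OF A, of x y] skew_formsD(2)[OF A', of x y]
    by (simp add: D_def inner_diff_left inner_diff_right)
  have D0: "proj_perp v (D (proj_perp v x)) = 0" for x
    using fun_cong[OF eq, of x] linear_diff[OF linear_proj_perp, of v "A (proj_perp v x)" "A' (proj_perp v x)"]
    by (simp add: D_def compress_def)
  have uD: "u = proj_perp v (D f)" by (simp add: u_def D_def)
  have "D f \<in> span G" unfolding D_def using skew_formsD(3)[OF A] skew_formsD(3)[OF A'] by (simp add: span_diff)
  then have "u \<in> span (perp v G)"
    unfolding sp uD by (intro proj_perp_in_perp[OF subspace_span vG v0])
  moreover have "inner u x \<in> \<int>" if x: "x \<in> perp v G" for x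
  proof -
    have "inner u x = inner x (D f)" using x
      by (simp add: uD perp_def inner_commute[of "proj_perp v (D f)"] inner_proj_perp_swap proj_perp_id)
    also have "\<dots> = inner x (A f) - inner x (A' f)" by (simp add: D_def inner_diff_right)
    finally show ?thesis using skew_formsD(4)[OF A] skew_formsD(4)[OF A'] x f by (simp add: perp_def)
  qed
  ultimately show "u \<in> dual_lattice (span (perp v G)) (perp v G)" by (simp add: dual_lattice_def)
  have "f = proj_perp v f + (1 / inner v v) *\<^sub>R v" using f by (simp add: proj_perp_def)
  then have "D f = D (proj_perp v f) + (1 / inner v v) *\<^sub>R D v"
    by (metis linear_add[OF lin] linear_scale[OF lin])
  then have u2: "u = (1 / inner v v) *\<^sub>R proj_perp v (D v)"
    unfolding uD using D0 by (simp add: linear_add[OF linear_proj_perp] linear_scale[OF linear_proj_perp])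
  have "norm u = norm (proj_perp v (D v)) / (norm v * norm v)"
    unfolding u2 by (simp add: power2_norm_eq_inner[symmetric] power2_eq_square)
  also have "norm (proj_perp v (D v)) \<le> norm (D v)" by (rule norm_proj_perp_le)
  also have "norm (D v) \<le> norm (A v) + norm (A' v)" unfolding D_def by (rule norm_triangle_ineq4)
  also have "\<dots> \<le> 2 * X * norm v" using skew_formsD(5)[OF A, of v] skew_formsD(5)[OF A', of v] by simp
  finally show "norm u \<le> 2 * X / norm v" using nv by (simp add: divide_right_mono field_simps)
  assume "u = 0"
  then have "proj_perp v (D v) = 0" using u2 v0 by simp
  moreover have "inner v (D v) = 0" using skew[of v v] by (simp add: inner_commute)
  ultimately have Dv: "D v = 0" by (simp add: proj_perp_id)
  have "D x = 0" for x
  proof -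
    have "x = proj_perp v x + (inner v x / inner v v) *\<^sub>R v" by (simp add: proj_perp_def)
    then have "D x = D (proj_perp v x) + (inner v x / inner v v) *\<^sub>R D v"
      by (metis linear_add[OF lin] linear_scale[OF lin])
    then have Dx: "D x = D (proj_perp v x)" using Dv by simp
    have "inner v (D (proj_perp v x)) = 0" using skew[of v "proj_perp v x"] Dv by simp
    then show ?thesis using D0[of x] Dx by (simp add: proj_perp_id)
  qed
  then show "A = A'" by (auto simp: D_def fun_eq_iff)
qed

section \<open>Counting by compressions and by the shortest vector\<close>

lemma card_le_card_mult_fibres:
  fixes b :: real
  assumes F': "finite F'" "h ` F \<subseteq> F'"
    and fib: "\<And>y. y \<in> F' \<Longrightarrow> finite {x \<in> F. h x = y} \<and> real (card {x \<in> F. h x = y}) \<le> b"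
  shows "finite F \<and> real (card F) \<le> real (card F') * b"
proof -
  have F: "F = (\<Union>y\<in>F'. {x \<in> F. h x = y})" using F'(2) by blast
  have "finite (\<Union>y\<in>F'. {x \<in> F. h x = y})" using F'(1) fib by blast
  then have "finite F" using F by simp
  moreover have "card F \<le> (\<Sum>y\<in>F'. card {x \<in> F. h x = y})"
    using card_UN_le[OF F'(1), of "\<lambda>y. {x \<in> F. h x = y}"] F by simp
  then have "real (card F) \<le> (\<Sum>y\<in>F'. real (card {x \<in> F. h x = y}))"
    by (metis of_nat_mono of_nat_sum)
  moreover have "\<dots> \<le> real (card F') * b" using fib by (intro sum_bounded_above) auto
  ultimately show ?thesis by linarith
qed

text \<open>The number of compressions is bounded by \<open>IH\<close> for the lattice
  \<open>perp v G\<close>, and each fibre by the dual lattice points of norm at most R. Both use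
  \<open>K'\<close>, the constant that \<open>point_bound_perp\<close> gives for
  \<open>perp v G\<close>; this is where the powers of |v| enter.\<close>

lemma card_skew_forms_with_shortest_le:
  assumes B: "finite B" and GB: "span G \<subseteq> span B" and G: "add_subgroup G"
    and pb: "point_bound (dual_lattice (span G) G) (Suc m) K"
    and v: "v \<in> dual_lattice (span G) G" "v \<noteq> 0"
    and R: "R \<ge> 1" "R \<ge> 2 * X / norm v"
    and IH: "\<And>G K. add_subgroup G \<Longrightarrow> span G \<subseteq> span B \<Longrightarrow> point_bound (dual_lattice (span G) G) m K \<Longrightarrow>
      finite (skew_forms B G k (c / 2) X) \<and> real (card (skew_forms B G k (c / 2) X)) \<le> a * K ^ (2 * k)"
    and a: "a \<ge> 0"
  defines "F \<equiv> {A \<in> skew_forms B G (Suc k) c X. v \<in> dual_lattice (A ` span G) G \<and>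
     (\<forall>q\<in>dual_lattice (A ` span G) G. q \<noteq> 0 \<longrightarrow> norm v \<le> norm q)}"
    and "K' \<equiv> 2 * 3 ^ Suc m * norm v * K"
  shows "finite F \<and> real (card F) \<le> a * K' ^ (2 * k) * (K' * R ^ m)"
proof (cases "F = {}")
  case True
  have "K \<ge> 1" using subspace_0[of "span G"] by (intro point_bound_ge_one[OF pb]) (simp add: dual_lattice_def)
  then have "0 \<le> K'" by (simp add: K'_def)
  then show ?thesis using True a R by simp
next
  case False
  then obtain A0 where A0: "A0 \<in> skew_forms B G (Suc k) c X" "v \<in> dual_lattice (A0 ` span G) G"
    "\<And>q. q \<in> dual_lattice (A0 ` span G) G \<Longrightarrow> q \<noteq> 0 \<Longrightarrow> norm v \<le> norm q"
    unfolding F_def by blast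
  \<comment> \<open>Any operator that has v as a shortest vector supplies f; this is why the empty
    case is split off.\<close>
  obtain f where f: "f \<in> G" "inner v f = 1"
    using exists_inner_eq_one_if_shortest[OF G subspace_image_span[OF skew_formsD(1)[OF A0(1)]] A0(2) v(2) A0(3)]
    by blast
  let ?D = "dual_lattice (span (perp v G)) (perp v G)"
  have sp: "span (perp v G) = perp v (span G)" using span_perp[OF G v(1) f] .
  have pb': "point_bound ?D m K'"
    unfolding K'_def sp by (rule point_bound_perp[OF G subspace_span v(1) f pb])
  have "span (perp v G) \<subseteq> span B" using GB sp by (auto simp: perp_def)
  from IH[OF add_subgroup_perp[OF G] this pb']
  have F': "finite (skew_forms B (perp v G) k (c / 2) X)"
    "real (card (skew_forms B (perp v G) k (c / 2) X)) \<le> a * K' ^ (2 * k)" by auto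
  have "K' \<ge> 1" by (rule point_bound_ge_one[OF pb']) (simp add: dual_lattice_def span_zero)
  then have nn: "0 \<le> K' * R ^ m" using R by simp
  have "finite F \<and> real (card F) \<le> real (card (skew_forms B (perp v G) k (c / 2) X)) * (K' * R ^ m)"
  proof (rule card_le_card_mult_fibres[OF F'(1)])
    show "compress v ` F \<subseteq> skew_forms B (perp v G) k (c / 2) X"
      unfolding F_def using compress_mem_skew_forms[OF B GB G _ _ v(2) _ f] by blast
    fix A'
    let ?F = "{A \<in> F. compress v A = A'}"
    let ?U = "{u \<in> ?D. norm u \<le> R}"
    have U: "finite ?U" "real (card ?U) \<le> K' * R ^ m" using point_boundD0[OF pb' R(1)] by auto
    show "finite ?F \<and> real (card ?F) \<le> K' * R ^ m"
    proof (cases "?F = {}")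
      case True
      then show ?thesis using nn by (simp only: finite.emptyI card.empty) simp
    next
      case False
      then obtain A1 where A1: "A1 \<in> ?F" by blast
      \<comment> \<open>Offsets from one fixed member of the fibre. Two members with the same offset
        have offset zero from each other and coincide by \<open>compress_fibre\<close>.\<close>
      let ?u = "\<lambda>A. proj_perp v (A f - A1 f)"
      have Fs: "A \<in> skew_forms B G (Suc k) c X" "compress v A = A'" if "A \<in> ?F" for A
        using that by (auto simp: F_def)
      have "?u ` ?F \<subseteq> ?U"
      proof
        fix u assume "u \<in> ?u ` ?F"
        then obtain A where A: "A \<in> ?F" "u = ?u A" by blast
        show "u \<in> ?U"
          using compress_fibre(1,2)[OF G v(1) f Fs(1)[OF A(1)] Fs(1)[OF A1]] Fs(2)[OF A(1)] Fs(2)[OF A1] A(2) R(2)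
          by auto
      qed
      moreover have "inj_on ?u ?F"
      proof (rule inj_onI)
        fix A A2 assume AA: "A \<in> ?F" "A2 \<in> ?F" and eq: "?u A = ?u A2"
        have "A f - A2 f = (A f - A1 f) - (A2 f - A1 f)" by simp
        then have "proj_perp v (A f - A2 f) = ?u A - ?u A2"
          by (metis linear_diff[OF linear_proj_perp])
        then have "proj_perp v (A f - A2 f) = 0" using eq by simp
        then show "A = A2"
          using compress_fibre(3)[OF G v(1) f Fs(1)[OF AA(1)] Fs(1)[OF AA(2)]] Fs(2)[OF AA(1)] Fs(2)[OF AA(2)] by simp
      qed
      ultimately have "finite ?F" "card ?F \<le> card ?U"
        using U(1) by (meson inj_on_finite, meson card_inj_on_le)
      then show ?thesis using U(2) by (meson of_nat_mono order_trans)
    qed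
  qed
  moreover have "real (card (skew_forms B (perp v G) k (c / 2) X)) * (K' * R ^ m) \<le> a * K' ^ (2 * k) * (K' * R ^ m)"
    using F'(2) nn by (rule mult_right_mono)
  ultimately show ?thesis by linarith
qed

text \<open>The constant is independent of \<open>G\<close> and \<open>K\<close> because the
  induction applies the bound to a different lattice for each v. The rank m of the dual lattice
  falls together with k, which the condition m \<ge> k makes possible.\<close>

theorem card_skew_forms_le:
  fixes B :: "'a::real_inner set"
  assumes B: "finite B"
  shows "c > 0 \<Longrightarrow> m \<ge> k \<Longrightarrow> \<exists>C\<ge>0. \<forall>(G :: 'a set) K X. add_subgroup G \<longrightarrow> span G \<subseteq> span B \<longrightarrow>
    point_bound (dual_lattice (span G) G) m K \<longrightarrow> X \<ge> 1 \<longrightarrow>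
    finite (skew_forms B G k c X) \<and> real (card (skew_forms B G k c X)) \<le> C * X ^ (k * m) * K ^ (2 * k)"
proof (induction k arbitrary: c m)
  case 0
  show ?case
  proof (intro exI[of _ 1] conjI allI impI)
    fix G :: "'a set" and K X :: real
    assume "span G \<subseteq> span B"
    note sub = skew_forms_0_subset[OF B this, of c X]
    show "finite (skew_forms B G 0 c X)" by (rule finite_subset[OF sub]) simp
    show "real (card (skew_forms B G 0 c X)) \<le> 1 * X ^ (0 * m) * K ^ (2 * 0)"
      using card_mono[OF _ sub] by simp
  qed simp
next
  case (Suc k)
  then obtain m' where m: "m = Suc m'" "m' \<ge> k" by (metis Suc_le_D Suc_le_mono)
  obtain C1 where C1: "C1 \<ge> 0" "\<And>(G :: 'a set) K X. add_subgroup G \<Longrightarrow> span G \<subseteq> span B \<Longrightarrow>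
    point_bound (dual_lattice (span G) G) m' K \<Longrightarrow> X \<ge> 1 \<Longrightarrow>
    finite (skew_forms B G k (c / 2) X) \<and>
    real (card (skew_forms B G k (c / 2) X)) \<le> C1 * X ^ (k * m') * K ^ (2 * k)"
    using Suc.IH[of "c / 2" m'] Suc.prems(1) m(2) by auto
  define T :: real where "T = 2 ^ card B"
  have T: "T \<ge> 1" unfolding T_def by (rule one_le_power) simp
  \<comment> \<open>Collects the recursive constant, the factor 2 * 3^m of
    \<open>point_bound_perp\<close> to the power 2 k for the compressions and once more for the
    fibre, and the radius factor (2 T)^m' of the fibre.\<close>
  define C2 where "C2 = C1 * (2 * 3 ^ m) ^ (2 * k + 1) * (2 * T) ^ m'"
  have C2: "C2 \<ge> 0" unfolding C2_def using C1(1) T by simp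
  define C3 where "C3 = 2 ^ (2 * Suc k + m) / c ^ m + 2 ^ (m + 1)"
  have C3: "C3 \<ge> 0" unfolding C3_def using Suc.prems(1) by simp
  show ?case
  \<comment> \<open>The summand 1 counts the zero operator, whose image contains no nonzero vector
    v.\<close>
  proof (intro exI[of _ "1 + C2 * C3 * T ^ Suc k"] conjI[OF _ allI[OF allI[OF allI]]] impI)
    show "0 \<le> 1 + C2 * C3 * T ^ Suc k" using C2 C3 T by simp
    fix G :: "'a set" and K X :: real
    assume G: "add_subgroup G" and GB: "span G \<subseteq> span B"
      and pb: "point_bound (dual_lattice (span G) G) m K" and X: "X \<ge> 1"
    let ?L = "dual_lattice (span G) G"
    have K: "K \<ge> 1" by (rule point_bound_ge_one[OF pb]) (simp add: dual_lattice_def span_zero)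
    define R where "R = sqrt (T * X)"
    have TX: "T * X \<ge> 1" using T X mult_mono[of 1 T 1 X] by simp
    then have R: "R \<ge> 1" "R\<^sup>2 = T * X" unfolding R_def by auto
    define V where "V = {v \<in> ?L. c \<le> norm v \<and> norm v \<le> R}"
    have finV: "finite V"
      by (rule finite_subset[OF _ point_boundD0(1)[OF pb R(1)]]) (auto simp: V_def)
    define F where "F v = {A \<in> skew_forms B G (Suc k) c X. v \<in> dual_lattice (A ` span G) G \<and>
     (\<forall>q\<in>dual_lattice (A ` span G) G. q \<noteq> 0 \<longrightarrow> norm v \<le> norm q)}" for v
    have sub: "skew_forms B G (Suc k) c X \<subseteq> {\<lambda>x. 0} \<union> (\<Union>v\<in>V. F v)"
    proof
      fix A assume A: "A \<in> skew_forms B G (Suc k) c X"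
      show "A \<in> {\<lambda>x. 0} \<union> (\<Union>v\<in>V. F v)"
      proof (cases "A = (\<lambda>x. 0)")
        case False
        obtain v where v: "v \<in> dual_lattice (A ` span G) G" "v \<noteq> 0" "(norm v)\<^sup>2 \<le> T * X"
          "\<forall>q\<in>dual_lattice (A ` span G) G. q \<noteq> 0 \<longrightarrow> norm v \<le> norm q"
          using exists_short_dual_vector[OF B GB G A False point_bound_imp_locally_finite[OF pb]]
          unfolding T_def by blast
        have "norm v \<le> R" unfolding R_def using v(3) by (intro real_le_rsqrt)
        moreover have "c \<le> norm v" using skew_formsD(7)[OF A v(1,2)] .
        moreover have "v \<in> ?L" using v(1) skew_formsD(3)[OF A] by (auto simp: dual_lattice_def)
        ultimately show ?thesis using A v unfolding V_def F_def by blast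
      qed simp
    qed
    have Fv: "finite (F v) \<and> real (card (F v)) \<le> C2 * X ^ (Suc k * m') * K ^ (2 * k + 1) * (norm v ^ (2 * Suc k) / norm v ^ m)"
      if v: "v \<in> V" for v
    proof -
      have nv: "norm v > 0" "v \<noteq> 0" "v \<in> ?L" "norm v \<le> R" using v Suc.prems(1) by (auto simp: V_def)
      \<comment> \<open>The fibre needs only radius 2 X / |v|, but \<open>point_bound\<close> asks
        for radius at least 1; the extra factor \<open>T\<close> ensures this, because |v| \<le> R
        \<le> R^2 = T X.\<close>
      define Rv where "Rv = 2 * T * X / norm v"
      have "R \<le> R\<^sup>2" using R(1) by (simp add: power2_eq_square)
      then have "norm v \<le> 2 * (T * X)" using nv(4) R(2) TX by linarith
      then have Rv: "Rv \<ge> 1" unfolding Rv_def using nv(1) by simp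
      have "1 * X \<le> T * X" using T X by (intro mult_right_mono) auto
      then have Rv2: "Rv \<ge> 2 * X / norm v" unfolding Rv_def using nv(1) by (intro divide_right_mono) auto
      let ?K = "2 * 3 ^ Suc m' * norm v * K"
      have "finite (F v) \<and> real (card (F v)) \<le> (C1 * X ^ (k * m')) * ?K ^ (2 * k) * (?K * Rv ^ m')"
        unfolding F_def
        by (rule card_skew_forms_with_shortest_le[OF B GB G pb[unfolded m] nv(3,2) Rv Rv2])
           (use C1 X in auto)
      moreover have "(C1 * X ^ (k * m')) * ?K ^ (2 * k) * (?K * Rv ^ m') =
         C2 * X ^ (Suc k * m') * K ^ (2 * k + 1) * (norm v ^ (2 * Suc k) / norm v ^ m)"
      proof -
        have "norm v ^ (2 * k) * norm v / norm v ^ m' = norm v ^ (2 * Suc k) / norm v ^ m"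
          unfolding m(1) using nv(1) by (simp add: power_add field_simps)
        then show ?thesis
          unfolding C2_def Rv_def m(1) power_mult_distrib power_divide power_add[symmetric]
          by (simp add: power_add power_mult_distrib algebra_simps)
      qed
      ultimately show ?thesis by simp
    qed
    have fin: "finite ({\<lambda>x. 0} \<union> (\<Union>v\<in>V. F v))" using finV Fv by blast
    have "real (card (skew_forms B G (Suc k) c X)) \<le> real (card ({\<lambda>x. 0} \<union> (\<Union>v\<in>V. F v)))"
      using card_mono[OF fin sub] by simp
    also have "\<dots> \<le> 1 + real (card (\<Union>v\<in>V. F v))"
      using card_Un_le[of "{\<lambda>x. 0}" "\<Union>v\<in>V. F v"] by simp
    also have "real (card (\<Union>v\<in>V. F v)) \<le> (\<Sum>v\<in>V. real (card (F v)))"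
      using card_UN_le[OF finV, of F] by (metis of_nat_mono of_nat_sum)
    also have "\<dots> \<le> (\<Sum>v\<in>V. C2 * X ^ (Suc k * m') * K ^ (2 * k + 1) * (norm v ^ (2 * Suc k) / norm v ^ m))"
      using Fv by (intro sum_mono) blast
    also have "\<dots> = C2 * X ^ (Suc k * m') * K ^ (2 * k + 1) * (\<Sum>v\<in>V. norm v ^ (2 * Suc k) / norm v ^ m)"
      by (simp add: sum_distrib_left)
    also have "\<dots> \<le> C2 * X ^ (Suc k * m') * K ^ (2 * k + 1) * (C3 * K * R ^ (2 * Suc k))"
      unfolding V_def C3_def using C2 X K Suc.prems(1) R(1)
      by (intro mult_left_mono sum_norm_powers_le[OF pb]) auto
    also have "R ^ (2 * Suc k) = (T * X) ^ Suc k" by (simp only: power_mult R(2))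
    also have "C2 * X ^ (Suc k * m') * K ^ (2 * k + 1) * (C3 * K * (T * X) ^ Suc k) =
      C2 * C3 * T ^ Suc k * (X ^ (Suc k * m) * K ^ (2 * Suc k))"
      unfolding m(1) by (simp add: power_add power_mult_distrib algebra_simps)
    also have "1 \<le> X ^ (Suc k * m) * K ^ (2 * Suc k)"
      using X K mult_mono[of 1 "X ^ (Suc k * m)" 1 "K ^ (2 * Suc k)"] by (simp add: one_le_power del: power_Suc mult_Suc mult_Suc_right)
    finally have "real (card (skew_forms B G (Suc k) c X)) \<le>
      X ^ (Suc k * m) * K ^ (2 * Suc k) + C2 * C3 * T ^ Suc k * (X ^ (Suc k * m) * K ^ (2 * Suc k))" by simp
    also have "\<dots> = (1 + C2 * C3 * T ^ Suc k) * X ^ (Suc k * m) * K ^ (2 * Suc k)"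
      by (simp add: algebra_simps)
    finally show "finite (skew_forms B G (Suc k) c X) \<and> real (card (skew_forms B G (Suc k) c X)) \<le>
      (1 + C2 * C3 * T ^ Suc k) * X ^ (Suc k * m) * K ^ (2 * Suc k)"
      using finite_subset[OF sub fin] by blast
  qed
qed

section \<open>Integer matrices as skew operators\<close>

text \<open>The dimension \<open>n\<close> is a variable, so the lattice \<open>\<int>\<^sup>n\<close> is placed in one
  inner product space containing all of them.\<close>

typedef fvec = "{f :: nat \<Rightarrow> real. finite {i. f i \<noteq> 0}}"
  morphisms coord Abs_fvec
  by (rule exI[of _ "\<lambda>i. 0"]) simp

setup_lifting type_definition_fvec

lemma finite_support_coord: "finite {i. coord x i \<noteq> 0}"
  using coord[of x] by simp

lemma fvec_eqI: "(\<And>i. coord x i = coord y i) \<Longrightarrow> x = y"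
  by transfer auto

instantiation fvec :: real_inner
begin

lift_definition zero_fvec :: fvec is "\<lambda>i. 0" by simp

lift_definition plus_fvec :: "fvec \<Rightarrow> fvec \<Rightarrow> fvec" is "\<lambda>f g i. f i + g i"
proof -
  fix f g :: "nat \<Rightarrow> real"
  assume "finite {i. f i \<noteq> 0}" "finite {i. g i \<noteq> 0}"
  then have "finite ({i. f i \<noteq> 0} \<union> {i. g i \<noteq> 0})" by simp
  then show "finite {i. f i + g i \<noteq> 0}" by (rule finite_subset[rotated]) auto
qed

lift_definition uminus_fvec :: "fvec \<Rightarrow> fvec" is "\<lambda>f i. - f i" by simp

lift_definition minus_fvec :: "fvec \<Rightarrow> fvec \<Rightarrow> fvec" is "\<lambda>f g i. f i - g i"
proof -
  fix f g :: "nat \<Rightarrow> real"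
  assume "finite {i. f i \<noteq> 0}" "finite {i. g i \<noteq> 0}"
  then have "finite ({i. f i \<noteq> 0} \<union> {i. g i \<noteq> 0})" by simp
  then show "finite {i. f i - g i \<noteq> 0}" by (rule finite_subset[rotated]) auto
qed

lift_definition scaleR_fvec :: "real \<Rightarrow> fvec \<Rightarrow> fvec" is "\<lambda>c f i. c * f i"
  by (rule finite_subset[rotated]) auto

definition inner_fvec :: "fvec \<Rightarrow> fvec \<Rightarrow> real" where
  "inner_fvec x y = (\<Sum>i | coord x i \<noteq> 0. coord x i * coord y i)"

definition norm_fvec :: "fvec \<Rightarrow> real" where "norm_fvec x = sqrt (inner x x)"

definition dist_fvec :: "fvec \<Rightarrow> fvec \<Rightarrow> real" where "dist_fvec x y = norm (x - y)"

definition sgn_fvec :: "fvec \<Rightarrow> fvec" where "sgn_fvec x = inverse (norm x) *\<^sub>R x"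

definition uniformity_fvec :: "(fvec \<times> fvec) filter" where
  "uniformity_fvec = (INF e\<in>{0 <..}. principal {(x, y). dist x y < e})"

definition open_fvec :: "fvec set \<Rightarrow> bool" where
  "open_fvec U \<longleftrightarrow> (\<forall>x\<in>U. eventually (\<lambda>(x', y). x' = x \<longrightarrow> y \<in> U) uniformity)"

lemma inner_fvec_eq_sum:
  assumes "finite S" "\<And>i. coord x i \<noteq> 0 \<Longrightarrow> coord y i \<noteq> 0 \<Longrightarrow> i \<in> S"
  shows "inner x y = (\<Sum>i\<in>S. coord x i * coord y i)"
  unfolding inner_fvec_def using assms finite_support_coord[of x]
  by (intro sum.mono_neutral_cong) auto

instance
proof
  fix x y z :: fvec and a b r :: real
  show "x + y + z = x + (y + z)" "x + y = y + x" "0 + x = x" "- x + x = 0" "x - y = x + - y"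
    "a *\<^sub>R (x + y) = a *\<^sub>R x + a *\<^sub>R y" "(a + b) *\<^sub>R x = a *\<^sub>R x + b *\<^sub>R x" "a *\<^sub>R b *\<^sub>R x = (a * b) *\<^sub>R x"
    "1 *\<^sub>R x = x"
    by (transfer; simp add: algebra_simps)+
  show "dist x y = norm (x - y)" "sgn x = inverse (norm x) *\<^sub>R x" "norm x = sqrt (inner x x)"
    by (simp_all add: dist_fvec_def sgn_fvec_def norm_fvec_def)
  show "uniformity = (INF e\<in>{0 <..}. principal {(x :: fvec, y). dist x y < e})"
    by (rule uniformity_fvec_def)
  show "open U \<longleftrightarrow> (\<forall>x\<in>U. eventually (\<lambda>(x', y). x' = x \<longrightarrow> y \<in> U) uniformity)" for U :: "fvec set"
    by (rule open_fvec_def)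
  let ?S = "{i. coord x i \<noteq> 0} \<union> {i. coord y i \<noteq> 0} \<union> {i. coord z i \<noteq> 0}"
  have S: "finite ?S" by (simp add: finite_support_coord)
  have plus: "coord (x + y) i = coord x i + coord y i" for x y i by transfer simp
  have scale: "coord (c *\<^sub>R x) i = c * coord x i" for c x i by transfer simp
  show "inner x y = inner y x"
    by (subst (1 2) inner_fvec_eq_sum[OF S]) (auto simp: mult.commute)
  show "inner (x + y) z = inner x z + inner y z"
    by (subst (1 2 3) inner_fvec_eq_sum[OF S]) (auto simp: plus sum.distrib algebra_simps)
  show "inner (r *\<^sub>R x) y = r * inner x y"
    by (subst (1 2) inner_fvec_eq_sum[OF S]) (auto simp: scale sum_distrib_left mult.assoc)
  show "0 \<le> inner x x" by (auto simp: inner_fvec_def intro!: sum_nonneg)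
  show "inner x x = 0 \<longleftrightarrow> x = 0"
  proof
    assume "inner x x = 0"
    then have "\<forall>i\<in>{i. coord x i \<noteq> 0}. coord x i * coord x i = 0"
      unfolding inner_fvec_def by (subst (asm) sum_nonneg_eq_0_iff) (auto simp: finite_support_coord)
    then have "coord x i = 0" for i by auto
    then show "x = 0" by (intro fvec_eqI) (simp add: zero_fvec.rep_eq)
  next
    assume "x = 0"
    then show "inner x x = 0" by (simp add: inner_fvec_def zero_fvec.rep_eq)
  qed
qed

end

lemma coord_simps [simp]:
  "coord 0 i = 0" "coord (x + y) i = coord x i + coord y i" "coord (x - y) i = coord x i - coord y i"
  "coord (- x) i = - coord x i" "coord (c *\<^sub>R x) i = c * coord x i"
  by (simp_all add: zero_fvec.rep_eq plus_fvec.rep_eq minus_fvec.rep_eq uminus_fvec.rep_eq scaleR_fvec.rep_eq)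

lemma coord_sum [simp]: "coord (sum f S) i = (\<Sum>x\<in>S. coord (f x) i)"
  by (induction S rule: infinite_finite_induct) auto

section \<open>Unit vectors and the standard lattice\<close>

definition fvec_of :: "nat \<Rightarrow> (nat \<Rightarrow> real) \<Rightarrow> fvec" where
  "fvec_of n f = Abs_fvec (\<lambda>i. if i < n then f i else 0)"

lemma coord_fvec_of [simp]: "coord (fvec_of n f) i = (if i < n then f i else 0)"
proof -
  have "finite {i. (if i < n then f i else 0) \<noteq> 0}" by (rule finite_subset[of _ "{..<n}"]) auto
  then show ?thesis unfolding fvec_of_def by (subst Abs_fvec_inverse) auto
qed

definition unit_fvec :: "nat \<Rightarrow> fvec" where
  "unit_fvec i = fvec_of (Suc i) (\<lambda>j. if j = i then 1 else 0)"

lemma coord_unit_fvec [simp]: "coord (unit_fvec i) j = (if j = i then 1 else 0)"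
  by (simp add: unit_fvec_def)

lemma inner_eq_sum_lessThan:
  assumes "\<And>i. i \<ge> n \<Longrightarrow> coord x i = 0"
  shows "inner x y = (\<Sum>i<n. coord x i * coord y i)"
  using assms by (intro inner_fvec_eq_sum) (auto simp: not_less[symmetric])

lemma inner_unit_fvec [simp]: "inner x (unit_fvec i) = coord x i"
proof -
  have "inner (unit_fvec i) x = (\<Sum>j\<in>{i}. coord (unit_fvec i) j * coord x j)"
    by (rule inner_fvec_eq_sum) (auto split: if_splits)
  then show ?thesis by (simp add: inner_commute)
qed

lemma norm_unit_fvec [simp]: "norm (unit_fvec i) = 1"
  by (simp add: norm_eq_sqrt_inner)

lemma abs_coord_le_norm: "\<bar>coord x i\<bar> \<le> norm x"
  using Cauchy_Schwarz_ineq2[of x "unit_fvec i"] by simp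

lemma fvec_expand:
  assumes "\<And>i. i \<ge> n \<Longrightarrow> coord x i = 0"
  shows "x = (\<Sum>i<n. coord x i *\<^sub>R unit_fvec i)"
proof (rule fvec_eqI)
  fix j
  show "coord x j = coord (\<Sum>i<n. coord x i *\<^sub>R unit_fvec i) j"
    using assms[of j] by (cases "j < n") (auto simp: sum.delta if_distrib cong: if_cong)
qed

lemma norm_le_sum_abs_coord:
  assumes "\<And>i. i \<ge> n \<Longrightarrow> coord x i = 0"
  shows "norm x \<le> (\<Sum>i<n. \<bar>coord x i\<bar>)"
proof -
  have "norm x = norm (\<Sum>i<n. coord x i *\<^sub>R unit_fvec i)" using fvec_expand[OF assms] by simp
  also have "\<dots> \<le> (\<Sum>i<n. norm (coord x i *\<^sub>R unit_fvec i))" by (rule norm_sum)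
  finally show ?thesis by simp
qed

definition int_fvecs :: "nat \<Rightarrow> fvec set" where
  "int_fvecs n = {x. (\<forall>i. coord x i \<in> \<int>) \<and> (\<forall>i\<ge>n. coord x i = 0)}"

definition unit_fvecs :: "nat \<Rightarrow> fvec set" where
  "unit_fvecs n = unit_fvec ` {..<n}"

lemma finite_unit_fvecs: "finite (unit_fvecs n)"
  by (simp add: unit_fvecs_def)

lemma card_unit_fvecs: "card (unit_fvecs n) = n"
proof -
  have "inj unit_fvec"
    by (rule injI) (metis coord_unit_fvec zero_neq_one)
  then show ?thesis unfolding unit_fvecs_def by (simp add: card_image inj_on_subset)
qed

lemma span_unit_fvecs: "span (unit_fvecs n) = {x. \<forall>i\<ge>n. coord x i = 0}"
proof
  show "span (unit_fvecs n) \<subseteq> {x. \<forall>i\<ge>n. coord x i = 0}"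
    by (rule span_minimal) (auto simp: unit_fvecs_def subspace_def)
  show "{x. \<forall>i\<ge>n. coord x i = 0} \<subseteq> span (unit_fvecs n)"
  proof
    fix x assume "x \<in> {x. \<forall>i\<ge>n. coord x i = 0}"
    then have "x = (\<Sum>i<n. coord x i *\<^sub>R unit_fvec i)" by (intro fvec_expand) auto
    also have "\<dots> \<in> span (unit_fvecs n)"
      by (intro span_sum span_scale span_base) (auto simp: unit_fvecs_def)
    finally show "x \<in> span (unit_fvecs n)" .
  qed
qed

lemma unit_fvecs_subset_int_fvecs: "unit_fvecs n \<subseteq> int_fvecs n"
  by (auto simp: unit_fvecs_def int_fvecs_def)

lemma span_int_fvecs: "span (int_fvecs n) = span (unit_fvecs n)"
proof
  show "span (int_fvecs n) \<subseteq> span (unit_fvecs n)"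
    by (rule span_minimal) (auto simp: span_unit_fvecs int_fvecs_def subspace_span[of "unit_fvecs n", unfolded span_unit_fvecs])
  show "span (unit_fvecs n) \<subseteq> span (int_fvecs n)" by (rule span_mono[OF unit_fvecs_subset_int_fvecs])
qed

lemma add_subgroup_int_fvecs: "add_subgroup (int_fvecs n)"
  by (auto simp: add_subgroup_def int_fvecs_def)

lemma dual_int_fvecs_subset:
  assumes "W \<subseteq> span (int_fvecs n)"
  shows "dual_lattice W (int_fvecs n) \<subseteq> int_fvecs n"
proof
  fix p assume p: "p \<in> dual_lattice W (int_fvecs n)"
  then have z: "\<forall>i\<ge>n. coord p i = 0"
    using assms by (auto simp: dual_lattice_def span_int_fvecs span_unit_fvecs)
  moreover have "coord p i \<in> \<int>" for i
  proof (cases "i < n")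
    case True
    then have "unit_fvec i \<in> int_fvecs n" using unit_fvecs_subset_int_fvecs by (auto simp: unit_fvecs_def)
    then show ?thesis using p by (metis (no_types, lifting) dual_lattice_def inner_unit_fvec mem_Collect_eq)
  qed (use z in simp)
  ultimately show "p \<in> int_fvecs n" by (simp add: int_fvecs_def)
qed

lemma norm_ge_one_int_fvecs:
  assumes "x \<in> int_fvecs n" "x \<noteq> 0"
  shows "1 \<le> norm x"
proof -
  obtain i where i: "coord x i \<noteq> 0" using assms(2) fvec_eqI[of x 0] by auto
  have "coord x i \<in> \<int>" using assms(1) by (simp add: int_fvecs_def)
  then have "1 \<le> \<bar>coord x i\<bar>" using i by (rule Ints_nonzero_abs_ge1)
  then show ?thesis using abs_coord_le_norm[of x i] by linarith
qed

lemma card_int_interval_le: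
  fixes a R :: real
  assumes "R \<ge> 1"
  shows "real (card {\<lceil>a - R\<rceil>..\<lfloor>a + R\<rfloor>}) \<le> 3 * R"
proof -
  have "real_of_int (\<lfloor>a + R\<rfloor> - \<lceil>a - R\<rceil> + 1) \<le> 2 * R + 1" by linarith
  then have "real_of_int (\<lfloor>a + R\<rfloor> - \<lceil>a - R\<rceil> + 1) \<le> 3 * R" using assms by linarith
  then show ?thesis using assms by (cases "\<lfloor>a + R\<rfloor> - \<lceil>a - R\<rceil> + 1 \<ge> 0") auto
qed

text \<open>Each coordinate of p is an integer in an interval of length 2 R, which leaves at most 2
  R + 1 \<le> 3 R values.\<close>

lemma point_bound_dual_int_fvecs:
  "point_bound (dual_lattice (span (int_fvecs n)) (int_fvecs n)) n (3 ^ n)"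
  unfolding point_bound_def
proof (intro allI impI)
  fix p0 :: fvec and R :: real assume R: "R \<ge> 1"
  let ?S = "{p \<in> dual_lattice (span (int_fvecs n)) (int_fvecs n). norm (p - p0) \<le> R}"
  let ?I = "\<lambda>i. {\<lceil>coord p0 i - R\<rceil>..\<lfloor>coord p0 i + R\<rfloor>}"
  let ?h = "\<lambda>p. restrict (\<lambda>i. \<lfloor>coord p i\<rfloor>) {..<n}"
  have S: "p \<in> int_fvecs n" if "p \<in> ?S" for p using that dual_int_fvecs_subset by blast
  have "inj_on ?h ?S"
  proof (rule inj_onI)
    fix p q assume pq: "p \<in> ?S" "q \<in> ?S" and eq: "?h p = ?h q"
    have Z: "coord p i \<in> \<int>" "coord q i \<in> \<int>" for i using S[OF pq(1)] S[OF pq(2)] by (auto simp: int_fvecs_def)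
    show "p = q"
    proof (rule fvec_eqI)
      fix i show "coord p i = coord q i"
      proof (cases "i < n")
        case True
        then have "\<lfloor>coord p i\<rfloor> = \<lfloor>coord q i\<rfloor>" using fun_cong[OF eq, of i] by simp
        then show ?thesis using Z by (metis Ints_cases floor_of_int)
      next
        case False
        then show ?thesis using S[OF pq(1)] S[OF pq(2)] by (auto simp: int_fvecs_def)
      qed
    qed
  qed
  moreover have "?h ` ?S \<subseteq> PiE {..<n} ?I"
  proof (rule image_subsetI, rule PiE_I)
    fix p i assume p: "p \<in> ?S" and i: "i \<in> {..<n}"
    have "\<bar>coord p i - coord p0 i\<bar> \<le> R" using p abs_coord_le_norm[of "p - p0" i] by auto
    moreover have "coord p i = of_int \<lfloor>coord p i\<rfloor>" using S[OF p] by (auto simp: int_fvecs_def elim!: Ints_cases)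
    ultimately have "of_int \<lfloor>coord p i\<rfloor> \<le> coord p0 i + R" "coord p0 i - R \<le> of_int \<lfloor>coord p i\<rfloor>" by linarith+
    then have "\<lfloor>coord p i\<rfloor> \<le> \<lfloor>coord p0 i + R\<rfloor>" "\<lceil>coord p0 i - R\<rceil> \<le> \<lfloor>coord p i\<rfloor>"
      by (simp only: le_floor_iff, simp only: ceiling_le_iff)
    then show "?h p i \<in> ?I i" using i by simp
  qed auto
  moreover have fin: "finite (PiE {..<n} ?I)" by (intro finite_PiE) auto
  ultimately have "finite ?S" "card ?S \<le> card (PiE {..<n} ?I)"
    by (meson inj_on_finite, meson card_inj_on_le)
  moreover have "real (card (PiE {..<n} ?I)) = (\<Prod>i<n. real (card (?I i)))"
    by (subst card_PiE) auto
  moreover have "\<dots> \<le> (\<Prod>i<n. 3 * R)"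
    by (intro prod_mono conjI of_nat_0_le_iff card_int_interval_le[OF R])
  ultimately show "finite ?S \<and> real (card ?S) \<le> 3 ^ n * R ^ n"
    by (simp add: power_mult_distrib)
qed

definition matrix_op :: "nat \<Rightarrow> (nat \<Rightarrow> nat \<Rightarrow> real) \<Rightarrow> fvec \<Rightarrow> fvec" where
  "matrix_op n a x = fvec_of n (\<lambda>i. \<Sum>j<n. a i j * coord x j)"

text \<open>The lower bound for dual vectors starts at 1, because dual vectors in the image are
  integer vectors. The operator norm is estimated crudely by the sum of all |a i j|, which is at
  most n^2 X.\<close>

lemma matrix_op_mem_skew_forms:
  fixes a :: "nat \<Rightarrow> nat \<Rightarrow> real"
  assumes a: "\<And>i j. i < n \<Longrightarrow> j < n \<Longrightarrow> a i j = - a j i" "\<And>i j. i < n \<Longrightarrow> j < n \<Longrightarrow> a i j \<in> \<int>"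
    "\<And>i j. i < n \<Longrightarrow> j < n \<Longrightarrow> \<bar>a i j\<bar> \<le> X"
    and S: "finite S" "independent S" "S \<subseteq> span (unit_fvecs n)" "n \<le> card S + 2 * k" "\<And>s. s \<in> S \<Longrightarrow> matrix_op n a s = 0"
  shows "matrix_op n a \<in> skew_forms (unit_fvecs n) (int_fvecs n) k 1 (real n ^ 2 * X)"
proof -
  have co: "coord (matrix_op n a x) i = (if i < n then \<Sum>j<n. a i j * coord x j else 0)" for x i
    by (simp add: matrix_op_def)
  have 1: "linear (matrix_op n a)"
    by (rule linearI; rule fvec_eqI) (auto simp: co algebra_simps sum.distrib sum_distrib_left)
  have in1: "inner (matrix_op n a x) y = (\<Sum>i<n. \<Sum>j<n. a i j * coord x j * coord y i)" for x y
    by (subst inner_eq_sum_lessThan[of n]) (auto simp: co sum_distrib_right)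
  have 2: "inner x (matrix_op n a y) = - inner (matrix_op n a x) y" for x y
  proof -
    have "inner x (matrix_op n a y) = (\<Sum>i<n. \<Sum>j<n. a i j * coord y j * coord x i)"
      using in1[of y x] by (simp add: inner_commute)
    also have "\<dots> = (\<Sum>j<n. \<Sum>i<n. a i j * coord y j * coord x i)" by (rule sum.swap)
    also have "\<dots> = (\<Sum>j<n. \<Sum>i<n. - (a j i * coord x i * coord y j))"
    proof (intro sum.cong refl)
      fix i j assume "i \<in> {..<n}" "j \<in> {..<n}"
      then have "a i j = - a j i" using a(1)[of i j] by simp
      then show "a i j * coord y j * coord x i = - (a j i * coord x i * coord y j)" by (simp only:) simp
    qed
    finally show ?thesis by (simp add: in1 sum_negf)
  qed
  have 3: "matrix_op n a x \<in> span (int_fvecs n)" for x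
    by (simp add: span_int_fvecs span_unit_fvecs co)
  have 4: "inner x (matrix_op n a y) \<in> \<int>" if "x \<in> int_fvecs n" "y \<in> int_fvecs n" for x y
    unfolding 2 in1 using that a(2) by (auto simp: int_fvecs_def intro!: Ints_minus Ints_sum Ints_mult)
  have 5: "norm (matrix_op n a x) \<le> (real n ^ 2 * X) * norm x" for x
  proof -
    have "norm (matrix_op n a x) \<le> (\<Sum>i<n. \<bar>coord (matrix_op n a x) i\<bar>)"
      by (rule norm_le_sum_abs_coord) (simp add: co)
    also have "\<dots> \<le> (\<Sum>i<n. \<Sum>j<n. X * norm x)"
    proof (rule sum_mono)
      fix i assume i: "i \<in> {..<n}"
      have "\<bar>coord (matrix_op n a x) i\<bar> \<le> (\<Sum>j<n. \<bar>a i j * coord x j\<bar>)" using i by (simp add: co)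
      also have "\<dots> \<le> (\<Sum>j<n. X * norm x)"
      proof (rule sum_mono)
        fix j assume j: "j \<in> {..<n}"
        have "0 \<le> \<bar>a i j\<bar>" by simp
        then have "0 \<le> X" using a(3)[of i j] i j by simp
        then show "\<bar>a i j * coord x j\<bar> \<le> X * norm x"
          unfolding abs_mult using a(3) i j abs_coord_le_norm by (intro mult_mono) auto
      qed
      finally show "\<bar>coord (matrix_op n a x) i\<bar> \<le> (\<Sum>j<n. X * norm x)" .
    qed
    also have "\<dots> = (real n ^ 2 * X) * norm x" by (simp add: power2_eq_square)
    finally show ?thesis .
  qed
  have 7: "1 \<le> norm p" if p: "p \<in> dual_lattice (matrix_op n a ` span (int_fvecs n)) (int_fvecs n)" "p \<noteq> 0" for p
  proof -
    have "matrix_op n a ` span (int_fvecs n) \<subseteq> span (int_fvecs n)" using 3 by blast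
    then have "p \<in> int_fvecs n" using dual_int_fvecs_subset p(1) by blast
    then show ?thesis using norm_ge_one_int_fvecs p(2) by blast
  qed
  have "\<exists>S. finite S \<and> independent S \<and> S \<subseteq> span (unit_fvecs n) \<and> card (unit_fvecs n) \<le> card S + 2 * k \<and>
    (\<forall>s\<in>S. matrix_op n a s = 0)"
    using S by (intro exI[of _ S]) (simp add: card_unit_fvecs)
  then show ?thesis unfolding skew_forms_def using 1 2 3 4 5 7 by blast
qed

text \<open>Apply a \<open>\<rat>\<close>-linear functional \<open>\<real> \<rightarrow> \<rat>\<close> not vanishing at the given coefficient, then clear denominators.\<close>

lemma exists_int_relation:
  fixes u :: "'b \<Rightarrow> real"
  assumes I: "finite I" and s0: "s0 \<in> I" "u s0 \<noteq> 0"
  shows "\<exists>b :: 'b \<Rightarrow> int. b s0 \<noteq> 0 \<and>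
    (\<forall>z :: 'b \<Rightarrow> int. (\<Sum>s\<in>I. u s * of_int (z s)) = 0 \<longrightarrow> (\<Sum>s\<in>I. b s * z s) = 0)"
proof -
  interpret V: vector_space_pair "\<lambda>(q::rat) (x::real). of_rat q * x" "\<lambda>(q::rat) (x::rat). q * x"
    by unfold_locales (auto simp: algebra_simps of_rat_add of_rat_mult)
  have "V.vs1.independent {u s0}" using s0(2) by (simp add: V.vs1.dependent_single)
  from V.linear_independent_extend[OF this, of "\<lambda>x. 1"]
  obtain g where g: "Vector_Spaces.linear (\<lambda>(q::rat) (x::real). of_rat q * x) (\<lambda>(q::rat) (x::rat). q * x) g" "g (u s0) = 1"
    by auto
  have gmul: "g (u s * of_int k) = g (u s) * of_int k" for s k
    using V.linear_scale[OF g(1), of "of_int k" "u s"] by (simp add: mult.commute)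
  define d where "d = (\<Prod>s\<in>I. snd (quotient_of (g (u s))))"
  have d0: "d \<noteq> 0" unfolding d_def using I by (simp add: quotient_of_denom_pos' less_imp_neq[symmetric])
  have "\<exists>k. rat_of_int k = rat_of_int d * g (u s)" if "s \<in> I" for s
  proof -
    obtain p q where pq: "quotient_of (g (u s)) = (p, q)" by fastforce
    then have q0: "q > 0" and eq: "g (u s) = rat_of_int p / rat_of_int q"
      by (auto simp: quotient_of_denom_pos quotient_of_div)
    have "d = q * (\<Prod>t\<in>I - {s}. snd (quotient_of (g (u t))))"
      unfolding d_def using I that pq by (simp add: prod.remove)
    then have "rat_of_int ((\<Prod>t\<in>I - {s}. snd (quotient_of (g (u t)))) * p) = rat_of_int d * g (u s)"
      using q0 eq by simp
    then show ?thesis by blast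
  qed
  then obtain b where b: "\<And>s. s \<in> I \<Longrightarrow> rat_of_int (b s) = rat_of_int d * g (u s)" by metis
  have "b s0 \<noteq> 0" using b[OF s0(1)] g(2) d0 by auto
  moreover have "(\<Sum>s\<in>I. b s * z s) = 0" if z: "(\<Sum>s\<in>I. u s * of_int (z s)) = 0" for z :: "'b \<Rightarrow> int"
  proof -
    have "rat_of_int (\<Sum>s\<in>I. b s * z s) = (\<Sum>s\<in>I. rat_of_int d * (g (u s) * of_int (z s)))"
      unfolding of_int_sum by (intro sum.cong) (auto simp: b)
    also have "\<dots> = rat_of_int d * (\<Sum>s\<in>I. g (u s * of_int (z s)))"
      by (simp add: gmul sum_distrib_left)
    also have "(\<Sum>s\<in>I. g (u s * of_int (z s))) = g (\<Sum>s\<in>I. u s * of_int (z s))"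
      by (rule V.linear_sum[OF g(1), symmetric])
    also have "\<dots> = 0" using z V.linear_0[OF g(1)] by simp
    finally have "rat_of_int (\<Sum>s\<in>I. b s * z s) = 0" by simp
    then show ?thesis by (simp only: of_int_eq_0_iff)
  qed
  ultimately show ?thesis by blast
qed

section \<open>Kernel rank over the integers and over the reals\<close>

definition fvec_of_vec :: "nat \<Rightarrow> int vec \<Rightarrow> fvec" where
  "fvec_of_vec n w = fvec_of n (\<lambda>i. of_int (w $ i))"

lemma inj_on_fvec_of_vec: "inj_on (fvec_of_vec n) (carrier_vec n)"
proof (rule inj_onI)
  fix w w' :: "int vec" assume w: "w \<in> carrier_vec n" "w' \<in> carrier_vec n" and eq: "fvec_of_vec n w = fvec_of_vec n w'"
  have "coord (fvec_of_vec n w) i = coord (fvec_of_vec n w') i" for i using eq by simp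
  then have "w $ i = w' $ i" if "i < n" for i using that by (simp add: fvec_of_vec_def) (metis of_int_eq_iff)
  then show "w = w'" using w by (intro eq_vecI) auto
qed

text \<open>A real relation holds coordinate by coordinate. \<open>exists_int_relation\<close>
  replaces its coefficients by integers that satisfy all coordinate relations at once, with a
  prescribed coefficient still nonzero.\<close>

lemma independent_fvec_of_vec:
  assumes S: "finite S" "S \<subseteq> carrier_vec n"
    and indep: "\<not> LinearCombinations.module.lin_dep class_ring (module_vec TYPE(int) n) S"
  shows "independent (fvec_of_vec n ` S)"
proof
  interpret Z: vec_module "TYPE(int)" n .
  assume "dependent (fvec_of_vec n ` S)"
  then obtain u v where u: "(\<Sum>x\<in>fvec_of_vec n ` S. u x *\<^sub>R x) = 0" "v \<in> fvec_of_vec n ` S" "u v \<noteq> 0"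
    using dependent_finite[of "fvec_of_vec n ` S"] S(1) by auto
  obtain s0 where s0: "s0 \<in> S" "v = fvec_of_vec n s0" using u(2) by blast
  define u' where "u' s = u (fvec_of_vec n s)" for s
  have "u' s0 \<noteq> 0" using s0 u(3) by (simp add: u'_def)
  from exists_int_relation[of S s0 u', OF S(1) s0(1) this]
  obtain b :: "int vec \<Rightarrow> int" where b: "b s0 \<noteq> 0"
    "\<And>z :: int vec \<Rightarrow> int. (\<Sum>s\<in>S. u' s * of_int (z s)) = 0 \<Longrightarrow> (\<Sum>s\<in>S. b s * z s) = 0" by blast
  have inj: "inj_on (fvec_of_vec n) S" using inj_on_fvec_of_vec S(2) by (rule inj_on_subset)
  have rel: "(\<Sum>s\<in>S. u' s * of_int (s $ i)) = 0" if "i < n" for i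
  proof -
    have "coord (\<Sum>x\<in>fvec_of_vec n ` S. u x *\<^sub>R x) i = 0" using u(1) by simp
    then have "(\<Sum>s\<in>S. u' s * coord (fvec_of_vec n s) i) = 0" by (simp add: sum.reindex[OF inj] u'_def)
    then show ?thesis using that by (simp add: fvec_of_vec_def)
  qed
  have "Z.lincomb b S = 0\<^sub>v n"
  proof (rule eq_vecI)
    show "dim_vec (Z.lincomb b S) = dim_vec (0\<^sub>v n :: int vec)"
      using Z.lincomb_closed[OF S(2), of b] by simp
  next
    fix i assume "i < dim_vec (0\<^sub>v n :: int vec)"
    then have i: "i < n" by simp
    have "Z.lincomb b S $ i = (\<Sum>x\<in>S. (b x \<cdot>\<^sub>v x) $ i)"
      unfolding Z.lincomb_def using S(2) by (intro Z.finsum_index[OF i]) auto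
    also have "\<dots> = (\<Sum>x\<in>S. b x * x $ i)"
      using S(2) i by (intro sum.cong) auto
    also have "\<dots> = 0" by (rule b(2)[OF rel[OF i]])
    finally show "Z.lincomb b S $ i = 0\<^sub>v n $ i" using i by simp
  qed
  then have "Z.lin_dep S" unfolding Z.lin_dep_def using S(1) s0(1) b(1) by blast
  then show False using indep by simp
qed

lemma mat_kernel_subset_carrier: "A \<in> carrier_mat n n \<Longrightarrow> mat_kernel A \<subseteq> carrier_vec n"
  by (auto simp: mat_kernel_def)

lemma finite_indep_cards:
  assumes "L \<subseteq> carrier_vec n"
  shows "finite {card S | S. finite S \<and> S \<subseteq> L \<and>
     \<not> LinearCombinations.module.lin_dep class_ring (module_vec TYPE(int) n) S}"
proof (rule finite_subset)
  show "{card S | S. finite S \<and> S \<subseteq> L \<and>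
     \<not> LinearCombinations.module.lin_dep class_ring (module_vec TYPE(int) n) S} \<subseteq> {..n}"
    using int_lin_indpt_card_le[of _ n] assms by blast
qed simp

lemma lattice_rank_attained:
  assumes "L \<subseteq> carrier_vec n"
  obtains S where "finite S" "S \<subseteq> L" "card S = lattice_rank n L"
    "\<not> LinearCombinations.module.lin_dep class_ring (module_vec TYPE(int) n) S"
proof -
  interpret Z: vec_module "TYPE(int)" n .
  let ?C = "{card S | S. finite S \<and> S \<subseteq> L \<and> \<not> Z.lin_dep S}"
  have "\<not> Z.lin_dep {}" by (auto simp: Z.lin_dep_def)
  then have "?C \<noteq> {}" by blast
  then have "lattice_rank n L \<in> ?C"
    unfolding lattice_rank_def using finite_indep_cards[OF assms] by (intro Max_in) auto
  then show ?thesis using that by force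
qed

text \<open>A matrix is determined by its operator, and a kernel of rank at least r supplies r real
  independent kernel vectors, which is the rank condition in \<open>skew_forms\<close>.\<close>

lemma card_alt_mats_upper_bound:
  assumes "2 * k + r = n"
  shows "\<exists>C>0. \<forall>X\<ge>1. real (card {A \<in> alt_mats n X. r \<le> lattice_rank n (mat_kernel A)}) \<le> C * X ^ (n * k)"
proof -
  let ?B = "unit_fvecs n" and ?G = "int_fvecs n"
  obtain C where C: "C \<ge> 0" "\<And>X :: real. X \<ge> 1 \<Longrightarrow> finite (skew_forms ?B ?G k 1 X) \<and>
    real (card (skew_forms ?B ?G k 1 X)) \<le> C * X ^ (k * n) * (3 ^ n) ^ (2 * k)"
  proof -
    have "(0::real) < 1" "k \<le> n" using assms by auto
    from card_skew_forms_le[OF finite_unit_fvecs[of n] this]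
    obtain C where C: "C \<ge> 0" "\<forall>(G :: fvec set) K X. add_subgroup G \<longrightarrow> span G \<subseteq> span ?B \<longrightarrow>
      point_bound (dual_lattice (span G) G) n K \<longrightarrow> X \<ge> 1 \<longrightarrow> finite (skew_forms ?B G k 1 X) \<and>
      real (card (skew_forms ?B G k 1 X)) \<le> C * X ^ (k * n) * K ^ (2 * k)" by (elim exE conjE)
    show thesis
      by (rule that[OF C(1)]; rule C(2)[rule_format])
        (simp_all add: add_subgroup_int_fvecs point_bound_dual_int_fvecs span_int_fvecs[symmetric])
  qed
  define C' where "C' = C * (real n ^ 2 + 1) ^ (k * n) * (3 ^ n) ^ (2 * k) + 1"
  have C': "C' > 0" unfolding C'_def using C(1) by (intro add_nonneg_pos mult_nonneg_nonneg) auto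
  show ?thesis
  proof (intro exI[of _ C'] conjI C' allI impI)
    fix X :: real assume X: "X \<ge> 1"
    \<comment> \<open>The summand 1 keeps Y \<ge> 1 also for n = 0.\<close>
    define Y where "Y = (real n ^ 2 + 1) * X"
    have "1 * 1 \<le> (real n ^ 2 + 1) * X" using X by (intro mult_mono) auto
    then have Y: "Y \<ge> 1" by (simp add: Y_def)
    let ?M = "{A \<in> alt_mats n X. r \<le> lattice_rank n (mat_kernel A)}"
    let ?h = "\<lambda>A :: int mat. matrix_op n (\<lambda>i j. of_int (A $$ (i, j)))"
    have alt: "A \<in> carrier_mat n n" "\<And>i j. i < n \<Longrightarrow> j < n \<Longrightarrow> A $$ (i, j) = - A $$ (j, i)"
      "\<And>i j. i < n \<Longrightarrow> j < n \<Longrightarrow> \<bar>real_of_int (A $$ (i, j))\<bar> \<le> X" if "A \<in> alt_mats n X" for A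
    proof -
      show A: "A \<in> carrier_mat n n" using that by (simp add: alt_mats_def)
      have T: "transpose_mat A = - A" using that by (simp add: alt_mats_def)
      show "A $$ (i, j) = - A $$ (j, i)" if ij: "i < n" "j < n" for i j
      proof -
        have "transpose_mat A $$ (j, i) = (- A) $$ (j, i)" using T by simp
        then show ?thesis using A ij by simp
      qed
      show "\<bar>real_of_int (A $$ (i, j))\<bar> \<le> X" if ij: "i < n" "j < n" for i j
        using that \<open>A \<in> alt_mats n X\<close> by (simp add: alt_mats_def)
    qed
    have "?h ` ?M \<subseteq> skew_forms ?B ?G k 1 Y"
    proof (rule image_subsetI)
      fix A assume A: "A \<in> ?M"
      then have A': "A \<in> alt_mats n X" by simp
      note alt = alt[OF A']
      obtain S where S: "finite S" "S \<subseteq> mat_kernel A" "card S = lattice_rank n (mat_kernel A)"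
        "\<not> LinearCombinations.module.lin_dep class_ring (module_vec TYPE(int) n) S"
        using lattice_rank_attained[OF mat_kernel_subset_carrier[OF alt(1)]] by metis
      have Sc: "S \<subseteq> carrier_vec n" using S(2) mat_kernel_subset_carrier[OF alt(1)] by blast
      let ?S = "fvec_of_vec n ` S"
      have card: "card ?S = card S" using inj_on_fvec_of_vec Sc by (meson card_image inj_on_subset)
      have "?h A \<in> skew_forms ?B ?G k 1 (real n ^ 2 * X)"
      proof (rule matrix_op_mem_skew_forms[where S = ?S])
        show "independent ?S" by (rule independent_fvec_of_vec[OF S(1) Sc S(4)])
        show "?S \<subseteq> span ?B" by (auto simp: span_unit_fvecs fvec_of_vec_def)
        show "n \<le> card ?S + 2 * k" using A S(3) card assms by simp
        show "real_of_int (A $$ (i, j)) = - real_of_int (A $$ (j, i))" if "i < n" "j < n" for i j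
          using alt(2)[OF that] by simp
        show "?h A s = 0" if s: "s \<in> ?S" for s
        proof -
          obtain w where w: "w \<in> S" "s = fvec_of_vec n w" using s by blast
          then have wA: "w \<in> carrier_vec n" "A *\<^sub>v w = 0\<^sub>v n" using S(2) alt(1) by (auto simp: mat_kernel_def)
          show ?thesis
          proof (rule fvec_eqI)
            fix i
            show "coord (?h A s) i = coord 0 i"
            proof (cases "i < n")
              case True
              have "(A *\<^sub>v w) $ i = (\<Sum>j<n. A $$ (i, j) * w $ j)"
                using True alt(1) wA(1) by (simp add: scalar_prod_def row_def atLeast0LessThan)
              then have "(\<Sum>j<n. A $$ (i, j) * w $ j) = 0" using wA(2) True by simp
              then have "real_of_int (\<Sum>j<n. A $$ (i, j) * w $ j) = 0" by simp
              then show ?thesis using True w(2) by (simp add: matrix_op_def fvec_of_vec_def)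
            qed (simp add: matrix_op_def)
          qed
        qed
      qed (use S(1) alt(3) in auto)
      moreover have "real n ^ 2 * X \<le> Y" unfolding Y_def using X by (intro mult_right_mono) auto
      ultimately show "?h A \<in> skew_forms ?B ?G k 1 Y" using skew_forms_mono by blast
    qed
    moreover have "inj_on ?h ?M"
    proof (rule inj_onI)
      fix A A' assume AA: "A \<in> ?M" "A' \<in> ?M" and eq: "?h A = ?h A'"
      have "A $$ (i, j) = A' $$ (i, j)" if ij: "i < n" "j < n" for i j
      proof -
        have "coord (?h D (unit_fvec j)) i = of_int (D $$ (i, j))" for D
          using ij by (simp add: matrix_op_def if_distrib sum.delta cong: if_cong)
        then show ?thesis using eq by (metis of_int_eq_iff)
      qed
      moreover have "A \<in> carrier_mat n n" "A' \<in> carrier_mat n n" using AA alt(1) by auto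
      ultimately show "A = A'" by (intro eq_matI) auto
    qed
    ultimately have "card ?M \<le> card (skew_forms ?B ?G k 1 Y)"
      using C(2)[OF Y] card_inj_on_le by blast
    then have "real (card ?M) \<le> C * Y ^ (k * n) * (3 ^ n) ^ (2 * k)"
      using C(2)[OF Y] by (meson of_nat_mono order_trans)
    also have "\<dots> = (C * (real n ^ 2 + 1) ^ (k * n) * (3 ^ n) ^ (2 * k)) * X ^ (n * k)"
      unfolding Y_def power_mult_distrib by (simp add: mult.commute mult.left_commute)
    also have "\<dots> \<le> C' * X ^ (n * k)" unfolding C'_def using X by (intro mult_right_mono) auto
    finally show "real (card ?M) \<le> C' * X ^ (n * k)" .
  qed
qed

section \<open>Isotropic tuples in the discriminant group\<close>

text \<open>Translation by h permutes \<open>H\<close> and multiplies the sum by \<open>f h\<close>.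
  Only injectivity of the translation enters, so \<open>comb\<close> may be addition modulo 1 on
  representatives.\<close>

lemma sum_character_eq_0:
  fixes f :: "'a \<Rightarrow> complex"
  assumes H: "finite H" "\<And>x. x \<in> H \<Longrightarrow> comb x h \<in> H" "inj_on (\<lambda>x. comb x h) H"
    and f: "\<And>x. x \<in> H \<Longrightarrow> f (comb x h) = f x * f h" "f h \<noteq> 1"
  shows "sum f H = 0"
proof -
  have "(\<lambda>x. comb x h) ` H = H" using H by (intro endo_inj_surj) auto
  then have "sum f H = (\<Sum>x\<in>H. f (comb x h))" using sum.reindex[OF H(3), of f] by simp
  also have "\<dots> = sum f H * f h" using f(1) by (simp add: sum_distrib_right)
  finally have "sum f H * (1 - f h) = 0" by (simp add: algebra_simps)
  then show ?thesis using f(2) by simp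
qed

text \<open>With \<open>P = T\<^sup>\<bottom>\<close> and \<open>I = P\<^sup>\<bottom>\<close>, summing the pairing over \<open>I \<times> G\<close> in both orders gives
  \<open>card G \<le> card I * card P\<close>, while \<open>I \<subseteq> P\<close> because \<open>T\<close> is isotropic.\<close>

lemma card_le_card_perp_squared:
  fixes \<chi> :: "'a \<Rightarrow> 'a \<Rightarrow> complex"
  assumes G: "finite G" "\<And>x h. x \<in> G \<Longrightarrow> h \<in> G \<Longrightarrow> comb x h \<in> G" "\<And>h. h \<in> G \<Longrightarrow> inj_on (\<lambda>x. comb x h) G"
    and \<chi>: "\<And>x h y. x \<in> G \<Longrightarrow> h \<in> G \<Longrightarrow> y \<in> G \<Longrightarrow> \<chi> (comb x h) y = \<chi> x y * \<chi> h y"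
      "\<And>x h y. x \<in> G \<Longrightarrow> h \<in> G \<Longrightarrow> y \<in> G \<Longrightarrow> \<chi> y (comb x h) = \<chi> y x * \<chi> y h"
      "\<And>x y. x \<in> G \<Longrightarrow> y \<in> G \<Longrightarrow> \<chi> x y = 1 \<Longrightarrow> \<chi> y x = 1"
    and z: "z \<in> G" "\<And>y. y \<in> G \<Longrightarrow> \<chi> z y = 1"
    and T: "T \<subseteq> G" "\<And>x y. x \<in> T \<Longrightarrow> y \<in> T \<Longrightarrow> \<chi> x y = 1"
  shows "card G \<le> (card {y \<in> G. \<forall>x\<in>T. \<chi> x y = 1})\<^sup>2"
proof -
  define P where "P = {y \<in> G. \<forall>x\<in>T. \<chi> x y = 1}"
  define I where "I = {x \<in> G. \<forall>y\<in>P. \<chi> x y = 1}"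
  have fin: "finite P" "finite I" using G(1) by (auto simp: P_def I_def)
  have TI: "T \<subseteq> I" using T by (auto simp: I_def P_def)
  have IP: "I \<subseteq> P" using T \<chi>(3) by (auto simp: I_def P_def subset_iff)
  have Gsum: "(\<Sum>y\<in>G. \<chi> x y) = (if \<forall>y\<in>G. \<chi> x y = 1 then of_nat (card G) else 0)" if x: "x \<in> G" for x
  proof (cases "\<forall>y\<in>G. \<chi> x y = 1")
    case False
    then obtain h where h: "h \<in> G" "\<chi> x h \<noteq> 1" by blast
    have "(\<Sum>y\<in>G. \<chi> x y) = 0"
      by (rule sum_character_eq_0[where comb = comb and h = h]) (use G \<chi>(2) x h in auto)
    then show ?thesis using False by auto
  qed simp
  have Isum: "(\<Sum>x\<in>I. \<chi> x y) = (if y \<in> P then of_nat (card I) else 0)" if y: "y \<in> G" for y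
  proof (cases "y \<in> P")
    case True
    then show ?thesis by (simp add: I_def)
  next
    case False
    then obtain h where h: "h \<in> T" "\<chi> h y \<noteq> 1" using y by (auto simp: P_def)
    have "(\<Sum>x\<in>I. \<chi> x y) = 0"
    proof (rule sum_character_eq_0[where comb = comb and h = h])
      show "comb x h \<in> I" if "x \<in> I" for x using that h TI G(2) \<chi>(1) by (auto simp: I_def P_def subset_iff)
      show "inj_on (\<lambda>x. comb x h) I" using G(3)[of h] h(1) T(1) by (auto simp: I_def inj_on_def)
      show "\<chi> (comb x h) y = \<chi> x y * \<chi> h y" if "x \<in> I" for x using that h T(1) \<chi>(1) y by (auto simp: I_def)
    qed (use fin h in auto)
    then show ?thesis using False by simp
  qed
  have "of_nat (card I * card P) = (\<Sum>y\<in>G. if y \<in> P then of_nat (card I) else (0::complex))"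
    using G(1) by (simp add: sum.If_cases P_def Int_def cong: conj_cong)
  also have "\<dots> = (\<Sum>y\<in>G. \<Sum>x\<in>I. \<chi> x y)" by (simp add: Isum)
  also have "\<dots> = (\<Sum>x\<in>I. \<Sum>y\<in>G. \<chi> x y)" by (rule sum.swap)
  also have "\<dots> = (\<Sum>x\<in>I. if \<forall>y\<in>G. \<chi> x y = 1 then of_nat (card G) else 0)"
    using Gsum by (intro sum.cong) (auto simp: I_def)
  also have "\<dots> = of_nat (\<Sum>x\<in>I. if \<forall>y\<in>G. \<chi> x y = 1 then card G else 0)" by (simp add: if_distrib cong: if_cong)
  finally have "card I * card P = (\<Sum>x\<in>I. if \<forall>y\<in>G. \<chi> x y = 1 then card G else 0)" by (simp only: of_nat_eq_iff)
  moreover have "z \<in> I" using z by (auto simp: I_def P_def)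
  then have "(if \<forall>y\<in>G. \<chi> z y = 1 then card G else 0) \<le> (\<Sum>x\<in>I. if \<forall>y\<in>G. \<chi> x y = 1 then card G else 0)"
    using fin by (intro member_le_sum) auto
  ultimately have "card G \<le> card I * card P" using z(2) by simp
  also have "\<dots> \<le> card P * card P" using card_mono[OF fin(1) IP] by simp
  finally show ?thesis by (simp add: P_def power2_eq_square)
qed

section \<open>Discriminant groups of dominant alternating matrices\<close>

lemma cis_2pi_eq_1_iff: "cis (2 * pi * t) = 1 \<longleftrightarrow> t \<in> \<int>"
proof
  assume "cis (2 * pi * t) = 1"
  then have "cos (2 * pi * t) = 1" by (metis cis.simps(1) one_complex.simps(1))
  then obtain m :: int where "2 * pi * t = of_int m * 2 * pi" using cos_one_2pi_int by blast
  then have "t = of_int m" by simp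
  then show "t \<in> \<int>" by simp
qed (rule cis_multiple_2pi)

text \<open>The involution exchanging i and i + k, which marks the nonzero positions of the standard
  symplectic form; these positions carry the dominant entries.\<close>

definition pair_index :: "nat \<Rightarrow> nat \<Rightarrow> nat" where
  "pair_index k i = (if i < k then i + k else i - k)"

definition bform :: "nat \<Rightarrow> (nat \<Rightarrow> nat \<Rightarrow> int) \<Rightarrow> (nat \<Rightarrow> real) \<Rightarrow> (nat \<Rightarrow> real) \<Rightarrow> real" where
  "bform d P x y = (\<Sum>i<d. \<Sum>j<d. x i * of_int (P i j) * y j)"

text \<open>Representatives in \<open>[0,1)\<^sup>d\<close> of \<open>P\<^sup>-\<^sup>1 \<int>\<^sup>d / \<int>\<^sup>d\<close>.\<close>

definition disc_group :: "nat \<Rightarrow> (nat \<Rightarrow> nat \<Rightarrow> int) \<Rightarrow> (nat \<Rightarrow> real) set" where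
  "disc_group d P = {c. (\<forall>i. 0 \<le> c i \<and> c i < 1) \<and> (\<forall>i\<ge>d. c i = 0) \<and>
     (\<forall>i<d. (\<Sum>j<d. of_int (P i j) * c j) \<in> \<int>)}"

text \<open>Lists rather than sets: the entries become the columns c_j, so order and repetition
  matter for the count.\<close>

definition isotropic_lists :: "nat \<Rightarrow> (nat \<Rightarrow> nat \<Rightarrow> int) \<Rightarrow> nat \<Rightarrow> (nat \<Rightarrow> real) list set" where
  "isotropic_lists d P r = {cs. length cs = r \<and> set cs \<subseteq> disc_group d P \<and>
     (\<forall>x\<in>set cs. \<forall>y\<in>set cs. bform d P x y \<in> \<int>)}"

text \<open>After permuting columns by \<open>pair_index\<close> the matrix is diagonally dominant:
  an entry of at least 6 k z faces fewer than 2 k others of size at most z, which leaves a margin of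
  4 k z. The scale z is later taken proportional to X.\<close>

locale dominant_alternating =
  fixes k :: nat and z :: nat and P :: "nat \<Rightarrow> nat \<Rightarrow> int"
  assumes k: "k \<ge> 1" and z: "z \<ge> 1"
    and alt: "\<And>i j. i < 2 * k \<Longrightarrow> j < 2 * k \<Longrightarrow> P i j = - P j i"
    and main: "\<And>i. i < 2 * k \<Longrightarrow> \<bar>P i (pair_index k i)\<bar> \<ge> int (6 * k * z)"
    and off: "\<And>i j. i < 2 * k \<Longrightarrow> j < 2 * k \<Longrightarrow> j \<noteq> pair_index k i \<Longrightarrow> \<bar>P i j\<bar> \<le> int z"
begin

abbreviation "d \<equiv> 2 * k"
abbreviation "G \<equiv> disc_group d P"
abbreviation "\<beta> \<equiv> bform d P"

lemma pair_index_less: "i < d \<Longrightarrow> pair_index k i < d"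
  using k by (auto simp: pair_index_def)

lemma pair_index_invol: "i < d \<Longrightarrow> pair_index k (pair_index k i) = i"
  by (auto simp: pair_index_def)

text \<open>Take a coordinate of largest absolute value and read the row in which it meets the
  dominant entry. This bounds the inverse of P by 1 / (4 k z) in the maximum norm.\<close>

lemma dominance:
  assumes b: "\<And>i. i < d \<Longrightarrow> \<bar>\<Sum>j<d. of_int (P i j) * x j\<bar> \<le> b" and j: "j < d"
  shows "real (4 * k * z) * \<bar>x j\<bar> \<le> b"
proof -
  let ?M = "Max ((\<lambda>j. \<bar>x j\<bar>) ` {..<d})"
  have "?M \<in> (\<lambda>j. \<bar>x j\<bar>) ` {..<d}" using k by (intro Max_in) (auto simp: lessThan_empty_iff)
  then obtain j0 where j0: "j0 < d" "?M = \<bar>x j0\<bar>" by auto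
  have le: "\<bar>x j\<bar> \<le> \<bar>x j0\<bar>" if "j < d" for j
    unfolding j0(2)[symmetric] using that by (intro Max_ge) auto
  define i where "i = pair_index k j0"
  have i: "i < d" "pair_index k i = j0" using pair_index_less pair_index_invol j0 by (auto simp: i_def)
  have "(\<Sum>j<d. of_int (P i j) * x j) = of_int (P i j0) * x j0 + (\<Sum>j\<in>{..<d} - {j0}. of_int (P i j) * x j)"
    using j0 by (simp add: sum.remove)
  then have "\<bar>of_int (P i j0) * x j0\<bar> \<le> \<bar>\<Sum>j<d. of_int (P i j) * x j\<bar> + \<bar>\<Sum>j\<in>{..<d} - {j0}. of_int (P i j) * x j\<bar>"
    by linarith
  also have "\<bar>\<Sum>j\<in>{..<d} - {j0}. of_int (P i j) * x j\<bar> \<le> (\<Sum>j\<in>{..<d} - {j0}. real z * \<bar>x j0\<bar>)"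
  proof (rule order_trans[OF sum_abs sum_mono])
    fix j assume j: "j \<in> {..<d} - {j0}"
    have "\<bar>P i j\<bar> \<le> int z" using off[of i j] i j by auto
    then have "real_of_int \<bar>P i j\<bar> \<le> real z" by linarith
    then show "\<bar>of_int (P i j) * x j\<bar> \<le> real z * \<bar>x j0\<bar>"
      unfolding abs_mult using le[of j] j by (intro mult_mono) auto
  qed
  also have "\<dots> = real (card ({..<d} - {j0})) * (real z * \<bar>x j0\<bar>)" by simp
  also have "\<dots> \<le> real d * (real z * \<bar>x j0\<bar>)"
    by (intro mult_right_mono of_nat_mono) (auto simp: card_Diff_singleton j0)
  finally have 1: "\<bar>of_int (P i j0) * x j0\<bar> \<le> b + real d * (real z * \<bar>x j0\<bar>)" using b[OF i(1)] by simp
  have "int (6 * k * z) \<le> \<bar>P i j0\<bar>" using main[OF i(1)] i(2) by simp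
  then have "real (6 * k * z) \<le> real_of_int \<bar>P i j0\<bar>" by linarith
  then have "real (6 * k * z) * \<bar>x j0\<bar> \<le> \<bar>of_int (P i j0) * x j0\<bar>"
    unfolding abs_mult by (intro mult_right_mono) auto
  then have "real (4 * k * z) * \<bar>x j0\<bar> \<le> b" using 1 by (simp add: algebra_simps)
  moreover have "real (4 * k * z) * \<bar>x j\<bar> \<le> real (4 * k * z) * \<bar>x j0\<bar>" using le[OF j] by (intro mult_left_mono) auto
  ultimately show ?thesis by linarith
qed

lemma kernel_trivial:
  assumes "\<And>i. i < d \<Longrightarrow> (\<Sum>j<d. of_int (P i j) * x j) = (0::real)" "j < d"
  shows "x j = 0"
  using dominance[of x 0 j] assms k z by (simp add: mult_le_0_iff)

lemma solvable: "\<exists>x :: nat \<Rightarrow> real. (\<forall>i\<ge>d. x i = 0) \<and> (\<forall>i<d. (\<Sum>j<d. of_int (P i j) * x j) = q i)"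
proof -
  define M where "M = mat d d (\<lambda>(i, j). real_of_int (P i j))"
  have M: "M \<in> carrier_mat d d" by (simp add: M_def)
  have mv: "(M *\<^sub>v v) $ i = (\<Sum>j<d. of_int (P i j) * v $ j)" if "v \<in> carrier_vec d" "i < d" for v i
    using that by (simp add: M_def scalar_prod_def row_def atLeast0LessThan)
  have "det M \<noteq> 0"
  proof
    assume "det M = 0"
    then obtain v where v: "v \<in> carrier_vec d" "v \<noteq> 0\<^sub>v d" "M *\<^sub>v v = 0\<^sub>v d"
      using det_0_iff_vec_prod_zero[OF M] by blast
    have "(\<Sum>j<d. of_int (P i j) * v $ j) = 0" if "i < d" for i
      using mv[OF v(1) that] v(3) that by simp
    then have "v $ j = 0" if "j < d" for j using kernel_trivial[of "\<lambda>j. v $ j"] that by blast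
    then have "v = 0\<^sub>v d" using v(1) by (intro eq_vecI) auto
    then show False using v(2) by simp
  qed
  define w where "w = (1 / det M) \<cdot>\<^sub>v (adj_mat M *\<^sub>v vec d q)"
  have adj: "adj_mat M \<in> carrier_mat d d" "M * adj_mat M = det M \<cdot>\<^sub>m 1\<^sub>m d" using adj_mat[OF M] by auto
  have w: "w \<in> carrier_vec d" using adj(1) by (simp add: w_def)
  have "M *\<^sub>v w = (1 / det M) \<cdot>\<^sub>v (M *\<^sub>v (adj_mat M *\<^sub>v vec d q))"
    unfolding w_def using M adj(1) by (intro mult_mat_vec) auto
  also have "M *\<^sub>v (adj_mat M *\<^sub>v vec d q) = (M * adj_mat M) *\<^sub>v vec d q"
    using M adj(1) by (intro assoc_mult_mat_vec[symmetric]) auto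
  also have "\<dots> = det M \<cdot>\<^sub>v vec d q"
    unfolding adj(2) by (intro eq_vecI) (auto simp: scalar_prod_def row_def if_distribR if_distrib sum.delta cong: if_cong)
  finally have "(M *\<^sub>v w) $ i = q i" if "i < d" for i using that \<open>det M \<noteq> 0\<close> by simp
  then show ?thesis using mv[OF w] by (intro exI[of _ "\<lambda>i. if i < d then w $ i else 0"]) simp
qed

lemma bform_swap: "\<beta> x y = - \<beta> y x"
proof -
  have "\<beta> x y = (\<Sum>j<d. \<Sum>i<d. x i * of_int (P i j) * y j)" unfolding bform_def by (rule sum.swap)
  also have "\<dots> = (\<Sum>j<d. \<Sum>i<d. - (y j * of_int (P j i) * x i))"
  proof (intro sum.cong refl)
    fix i j assume "i \<in> {..<d}" "j \<in> {..<d}"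
    then have "P i j = - P j i" using alt[of i j] by simp
    then show "x i * of_int (P i j) * y j = - (y j * of_int (P j i) * x i)" by (simp only:) simp
  qed
  finally show ?thesis by (simp add: bform_def sum_negf)
qed

lemma bform_self: "\<beta> x x = 0" using bform_swap[of x x] by simp

lemma bform_eq: "\<beta> x y = (\<Sum>i<d. x i * (\<Sum>j<d. of_int (P i j) * y j))"
  by (simp add: bform_def sum_distrib_left mult.assoc)

lemma bform_add_left: "\<beta> (\<lambda>i. x i + y i) u = \<beta> x u + \<beta> y u"
  unfolding bform_eq by (simp add: distrib_right sum.distrib)

lemma bform_int_left: "(\<And>i. i < d \<Longrightarrow> m i \<in> \<int>) \<Longrightarrow> y \<in> G \<Longrightarrow> \<beta> m y \<in> \<int>"
  unfolding bform_eq by (rule Ints_sum) (auto intro!: Ints_mult simp: disc_group_def)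

lemma frac_mem_disc_group:
  assumes "\<And>i. i \<ge> d \<Longrightarrow> x i = 0" "\<And>i. i < d \<Longrightarrow> (\<Sum>j<d. of_int (P i j) * x j) \<in> \<int>"
  shows "(\<lambda>i. frac (x i)) \<in> G"
proof -
  have "(\<Sum>j<d. of_int (P i j) * frac (x j)) \<in> \<int>" if "i < d" for i
  proof -
    have "(\<Sum>j<d. of_int (P i j) * frac (x j)) = (\<Sum>j<d. of_int (P i j) * x j) - of_int (\<Sum>j<d. P i j * \<lfloor>x j\<rfloor>)"
      by (simp add: frac_def algebra_simps sum_subtractf)
    then show ?thesis by (simp only: Ints_diff[OF assms(2)[OF that] Ints_of_int])
  qed
  then show ?thesis using assms(1) by (auto simp: disc_group_def frac_lt_1)
qed

text \<open>The vector P c is integral and bounded on the unit cube, and it determines c because P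
  is injective.\<close>

lemma finite_disc_group: "finite G"
proof -
  let ?B = "\<Sum>i<d. \<Sum>j<d. \<bar>P i j\<bar>"
  define p where "p c i = \<lfloor>\<Sum>j<d. of_int (P i j) * c j\<rfloor>" for c :: "nat \<Rightarrow> real" and i
  let ?h = "\<lambda>c. restrict (p c) {..<d}"
  have Z: "of_int (p c i) = (\<Sum>j<d. of_int (P i j) * c j)" if "c \<in> G" "i < d" for c i
    using that by (auto simp: p_def disc_group_def of_int_floor)
  have "inj_on ?h G"
  proof (rule inj_onI)
    fix c c' assume c: "c \<in> G" "c' \<in> G" and eq: "?h c = ?h c'"
    have "(\<Sum>j<d. of_int (P i j) * (c j - c' j)) = 0" if "i < d" for i
    proof -
      have "p c i = p c' i"
        using fun_cong[OF eq, of i] that by simp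
      then have "(\<Sum>j<d. of_int (P i j) * c j) = (\<Sum>j<d. of_int (P i j) * c' j)"
        using Z[OF c(1) that] Z[OF c(2) that] by simp
      then show ?thesis by (simp add: right_diff_distrib sum_subtractf)
    qed
    then have "c j - c' j = 0" if "j < d" for j using kernel_trivial[of "\<lambda>j. c j - c' j"] that by blast
    moreover have "c j = c' j" if "j \<ge> d" for j using c that by (simp add: disc_group_def)
    ultimately show "c = c'" by (intro ext) (metis eq_iff_diff_eq_0 not_le)
  qed
  moreover have "?h ` G \<subseteq> PiE {..<d} (\<lambda>i. {-?B..?B})"
  proof (rule image_subsetI, rule PiE_I)
    fix c i assume c: "c \<in> G" and i: "i \<in> {..<d}"
    have c1: "\<bar>c j\<bar> \<le> 1" for j using c by (auto simp: disc_group_def abs_le_iff less_imp_le intro: order_trans[of _ 0])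
    have "\<bar>\<Sum>j<d. of_int (P i j) * c j\<bar> \<le> (\<Sum>j<d. real_of_int \<bar>P i j\<bar>)"
    proof (rule order_trans[OF sum_abs sum_mono])
      fix j show "\<bar>of_int (P i j) * c j\<bar> \<le> real_of_int \<bar>P i j\<bar>"
        using mult_left_mono[OF c1[of j], of "\<bar>real_of_int (P i j)\<bar>"] by (simp add: abs_mult)
    qed
    also have "\<dots> = real_of_int (\<Sum>j<d. \<bar>P i j\<bar>)" by simp
    also have "(\<Sum>j<d. \<bar>P i j\<bar>) \<le> ?B" using i by (intro member_le_sum[of i "{..<d}" "\<lambda>i. \<Sum>j<d. \<bar>P i j\<bar>"]) (auto intro: sum_nonneg)
    finally have "\<bar>\<Sum>j<d. of_int (P i j) * c j\<bar> \<le> real_of_int ?B" by simp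
    moreover have "\<bar>\<Sum>j<d. of_int (P i j) * c j\<bar> = real_of_int \<bar>p c i\<bar>" using Z[OF c, of i] i by (simp only: of_int_abs) simp
    ultimately have "\<bar>p c i\<bar> \<le> ?B" by (simp only: of_int_le_iff)
    then show "?h c i \<in> {-?B..?B}" using i by auto
  qed auto
  moreover have "finite (PiE {..<d} (\<lambda>i. {-?B..?B}))" by (intro finite_PiE) auto
  ultimately show ?thesis by (meson inj_on_finite)
qed

text \<open>There are z^d integer vectors q that differ by at most z in each coordinate from the
  image under P of the centre (1/2, ..., 1/2). By \<open>dominance\<close> their preimages are
  within 1 / (4 k) of the centre, hence inside the unit cube. This avoids computing the group order
  |det P|.\<close>

lemma card_disc_group_ge: "z ^ d \<le> card G"
proof -
  define t where "t i = (\<Sum>j<d. of_int (P i j) * (1 / 2 :: real))" for i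
  let ?Q = "PiE {..<d} (\<lambda>i. {\<lceil>t i\<rceil>..<\<lceil>t i\<rceil> + int z})"
  obtain s where s: "\<And>q :: nat \<Rightarrow> int. (\<forall>i\<ge>d. s q i = 0) \<and> (\<forall>i<d. (\<Sum>j<d. of_int (P i j) * s q j) = real_of_int (q i))"
  proof -
    have "\<forall>q :: nat \<Rightarrow> int. \<exists>x. (\<forall>i\<ge>d. x i = 0) \<and> (\<forall>i<d. (\<Sum>j<d. of_int (P i j) * x j) = real_of_int (q i))"
      by (rule allI) (rule solvable)
    from choice[OF this] show thesis by (elim exE) (rule that, erule spec)
  qed
  have "s q \<in> G" if q: "q \<in> ?Q" for q
  proof -
    have "\<bar>\<Sum>j<d. of_int (P i j) * (s q j - 1 / 2)\<bar> \<le> real z" if i: "i < d" for i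
    proof -
      have "(\<Sum>j<d. of_int (P i j) * (s q j - 1 / 2)) = of_int (q i) - t i"
        using s[of q] i by (simp add: t_def right_diff_distrib sum_subtractf)
      moreover have "q i \<in> {\<lceil>t i\<rceil>..<\<lceil>t i\<rceil> + int z}" by (rule PiE_mem[OF q]) (use i in simp)
      then have "\<lceil>t i\<rceil> \<le> q i" "q i + 1 \<le> \<lceil>t i\<rceil> + int z" by (simp_all only: atLeastLessThan_iff) linarith
      then have "t i \<le> of_int (q i)" "of_int (q i) + 1 \<le> of_int \<lceil>t i\<rceil> + real z" by linarith+
      moreover have "of_int \<lceil>t i\<rceil> < t i + 1" by linarith
      ultimately show ?thesis by linarith
    qed
    then have b: "real (4 * k * z) * \<bar>s q j - 1 / 2\<bar> \<le> real z" if "j < d" for j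
      using dominance[of "\<lambda>j. s q j - 1 / 2" "real z" j] that by blast
    have b4: "\<bar>s q j - 1 / 2\<bar> \<le> 1 / 4" if "j < d" for j
    proof -
      have "real (4 * z) * \<bar>s q j - 1 / 2\<bar> \<le> real (4 * k * z) * \<bar>s q j - 1 / 2\<bar>"
        using k by (intro mult_right_mono of_nat_mono) auto
      then have "real z * (4 * \<bar>s q j - 1 / 2\<bar>) \<le> real z * 1" using b[OF that] by (simp add: mult.assoc mult.left_commute)
      then have "4 * \<bar>s q j - 1 / 2\<bar> \<le> 1" using z by (subst (asm) mult_le_cancel_left_pos) auto
      then show ?thesis by simp
    qed
    have "0 \<le> s q j \<and> s q j < 1" for j
    proof (cases "j < d")
      case True
      then show ?thesis using b4[OF True] by linarith
    next
      case False
      then show ?thesis using s[of q] by simp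
    qed
    then show ?thesis using s[of q] unfolding disc_group_def by auto
  qed
  then have "s ` ?Q \<subseteq> G" by blast
  moreover have "inj_on s ?Q"
  proof (rule inj_onI)
    fix q q' assume q: "q \<in> ?Q" "q' \<in> ?Q" and eq: "s q = s q'"
    have "q i = q' i" if "i < d" for i
    proof -
      have "real_of_int (q i) = real_of_int (q' i)" using s[of q] s[of q'] eq that by metis
      then show ?thesis by simp
    qed
    then show "q = q'" using q by (intro PiE_ext[of q "{..<d}" _ q']) auto
  qed
  ultimately have "card ?Q \<le> card G" using finite_disc_group card_inj_on_le by blast
  moreover have "card ?Q = z ^ d" by (subst card_PiE) auto
  ultimately show ?thesis by simp
qed

text \<open>Composing the form with t to exp (2 pi i t) gives a bicharacter for addition modulo 1,
  so \<open>card_le_card_perp_squared\<close> applies, and the square root of z^(2 k) is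
  z^k.\<close>

lemma card_perp_ge:
  assumes T: "T \<subseteq> G" "\<And>x y. x \<in> T \<Longrightarrow> y \<in> T \<Longrightarrow> \<beta> x y \<in> \<int>"
  shows "z ^ k \<le> card {y \<in> G. \<forall>x\<in>T. \<beta> x y \<in> \<int>}"
proof -
  define \<chi> where "\<chi> x y = cis (2 * pi * \<beta> x y)" for x y
  define comb where "comb x h = (\<lambda>i. frac (x i + h i))" for x h :: "nat \<Rightarrow> real"
  have \<chi>1: "\<chi> x y = 1 \<longleftrightarrow> \<beta> x y \<in> \<int>" for x y by (simp add: \<chi>_def cis_2pi_eq_1_iff)
  have cis_cong: "cis (2 * pi * a) = cis (2 * pi * b)" if "a - b \<in> \<int>" for a b
  proof -
    have "cis (2 * pi * a) = cis (2 * pi * b) * cis (2 * pi * (a - b))" by (simp add: cis_mult algebra_simps)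
    then show ?thesis using that by (simp add: cis_multiple_2pi)
  qed
  \<comment> \<open>Reducing x + h modulo 1 changes the form by its value on an integer vector and
    y, which is an integer because P y is integral.\<close>
  have left: "\<chi> (comb x h) y = \<chi> x y * \<chi> h y" if "y \<in> G" for x h y
  proof -
    have "\<beta> (comb x h) y - (\<beta> x y + \<beta> h y) = \<beta> (\<lambda>i. - of_int \<lfloor>x i + h i\<rfloor>) y"
    proof -
      have "comb x h = (\<lambda>i. (x i + h i) + - of_int \<lfloor>x i + h i\<rfloor>)" by (simp add: comb_def frac_def)
      then have "\<beta> (comb x h) y = \<beta> (\<lambda>i. x i + h i) y + \<beta> (\<lambda>i. - of_int \<lfloor>x i + h i\<rfloor>) y"
        using bform_add_left[of "\<lambda>i. x i + h i" "\<lambda>i. - of_int \<lfloor>x i + h i\<rfloor>" y] by simp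
      then show ?thesis by (simp add: bform_add_left)
    qed
    also have "\<dots> \<in> \<int>" using that by (intro bform_int_left) auto
    finally have "cis (2 * pi * \<beta> (comb x h) y) = cis (2 * pi * (\<beta> x y + \<beta> h y))" by (rule cis_cong)
    then show ?thesis by (simp add: \<chi>_def cis_mult distrib_left)
  qed
  have inv: "\<chi> y x = inverse (\<chi> x y)" for x y using bform_swap[of y x] by (simp add: \<chi>_def cis_inverse)
  have "card G \<le> (card {y \<in> G. \<forall>x\<in>T. \<chi> x y = 1})\<^sup>2"
  proof (rule card_le_card_perp_squared[where comb = comb and z = "\<lambda>i. 0"])
    show "comb x h \<in> G" if "x \<in> G" "h \<in> G" for x h
      unfolding comb_def using that
      by (intro frac_mem_disc_group) (auto simp: disc_group_def distrib_left sum.distrib)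
    show "inj_on (\<lambda>x. comb x h) G" if "h \<in> G" for h
    proof (rule inj_onI)
      fix x y assume xy: "x \<in> G" "y \<in> G" and eq: "comb x h = comb y h"
      show "x = y"
      proof
        fix i
        have "frac (x i + h i) = frac (y i + h i)" using fun_cong[OF eq, of i] by (simp add: comb_def)
        then have "x i - y i = of_int (\<lfloor>x i + h i\<rfloor> - \<lfloor>y i + h i\<rfloor>)" by (simp add: frac_def)
        moreover have "\<bar>x i - y i\<bar> < 1" using xy by (simp add: disc_group_def abs_less_iff) (smt (verit))
        ultimately show "x i = y i" by (metis eq_iff_diff_eq_0 of_int_0 of_int_abs of_int_less_1_iff zabs_less_one_iff)
      qed
    qed
    show "\<chi> y (comb x h) = \<chi> y x * \<chi> y h" if "x \<in> G" "h \<in> G" "y \<in> G" for x h y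
      using left[OF that(3)] inv[of y "comb x h"] inv[of y x] inv[of y h] by simp
    show "\<chi> y x = 1" if "\<chi> x y = 1" for x y using that inv[of y x] by simp
    show "\<chi> x y = 1" if "x \<in> T" "y \<in> T" for x y using that T(2) by (simp add: \<chi>1)
    show "\<chi> (\<lambda>i. 0) y = 1" for y by (simp add: \<chi>_def bform_def)
  qed (use finite_disc_group left T(1) in \<open>auto simp: disc_group_def\<close>)
  then have "z ^ d \<le> (card {y \<in> G. \<forall>x\<in>T. \<beta> x y \<in> \<int>})\<^sup>2" using card_disc_group_ge by (simp add: \<chi>1)
  moreover have "z ^ d = (z ^ k)\<^sup>2" by (metis mult.commute power_mult)
  ultimately have "(z ^ k)\<^sup>2 \<le> (card {y \<in> G. \<forall>x\<in>T. \<beta> x y \<in> \<int>})\<^sup>2" by simp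
  then show ?thesis by (rule power2_le_imp_le) simp
qed

lemma finite_isotropic_lists: "finite (isotropic_lists d P r)"
  by (rule finite_subset[OF _ finite_lists_length_eq[OF finite_disc_group, of r]])
     (auto simp: isotropic_lists_def)

text \<open>A single element is isotropic because the form is alternating, so one entry is free and
  gives z^d. Every further entry ranges over the orthogonal complement of the previous ones and
  gives z^k.\<close>

lemma card_isotropic_lists_ge: "z ^ (d + k * r) \<le> card (isotropic_lists d P (Suc r))"
proof (induction r)
  case 0
  have "(\<lambda>c. [c]) ` G \<subseteq> isotropic_lists d P (Suc 0)" by (auto simp: isotropic_lists_def bform_self)
  then have "card ((\<lambda>c. [c]) ` G) \<le> card (isotropic_lists d P (Suc 0))"
    using finite_isotropic_lists by (intro card_mono) auto
  then have "card G \<le> card (isotropic_lists d P (Suc 0))" by (simp add: card_image inj_on_def)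
  then show ?case using card_disc_group_ge by simp
next
  case (Suc r)
  let ?L = "isotropic_lists d P (Suc r)"
  let ?p = "\<lambda>cs. {y \<in> G. \<forall>x\<in>set cs. \<beta> x y \<in> \<int>}"
  have "d + k * Suc r = d + k * r + k" by simp
  then have "z ^ (d + k * Suc r) = z ^ (d + k * r) * z ^ k" by (simp only: power_add)
  also have "\<dots> \<le> card ?L * z ^ k" using Suc.IH by simp
  also have "\<dots> \<le> (\<Sum>cs\<in>?L. card (?p cs))"
  proof -
    have "(\<Sum>cs\<in>?L. z ^ k) \<le> (\<Sum>cs\<in>?L. card (?p cs))"
    proof (rule sum_mono)
      fix cs assume "cs \<in> ?L"
      then show "z ^ k \<le> card (?p cs)" by (intro card_perp_ge) (auto simp: isotropic_lists_def)
    qed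
    then show ?thesis by simp
  qed
  also have "\<dots> = card (Sigma ?L ?p)"
    using finite_isotropic_lists finite_disc_group by (simp add: card_SigmaI)
  also have "\<dots> = card ((\<lambda>(cs, y). y # cs) ` Sigma ?L ?p)" by (rule card_image[symmetric]) (auto simp: inj_on_def)
  also have "\<dots> \<le> card (isotropic_lists d P (Suc (Suc r)))"
  proof (rule card_mono[OF finite_isotropic_lists], rule image_subsetI)
    fix p assume "p \<in> Sigma ?L ?p"
    then obtain cs y where p: "p = (cs, y)" "cs \<in> ?L" "y \<in> ?p cs" by blast
    have "\<beta> y x \<in> \<int>" if "x \<in> set cs" for x using p(3) that bform_swap[of y x] by auto
    then show "(case p of (cs, y) \<Rightarrow> y # cs) \<in> isotropic_lists d P (Suc (Suc r))"
      using p by (auto simp: isotropic_lists_def bform_self)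
  qed
  finally show ?case .
qed

text \<open>Pigeonhole: the multiples of c modulo 1 stay in a finite set, so two of them agree. The
  resulting t clears denominators in the kernel vectors of
  \<open>lattice_rank_congruent_mat\<close>.\<close>

lemma exists_multiple_integral:
  assumes c: "c \<in> G"
  shows "\<exists>t :: nat. t > 0 \<and> (\<forall>i. real t * c i \<in> \<int>)"
proof -
  define s where "s t = (\<lambda>i. frac (real t * c i))" for t :: nat
  have "s t \<in> G" for t
  proof -
    have "(\<Sum>j<d. of_int (P i j) * (real t * c j)) = real t * (\<Sum>j<d. of_int (P i j) * c j)" for i
      by (simp add: sum_distrib_left mult.left_commute)
    then show ?thesis unfolding s_def using c by (intro frac_mem_disc_group) (auto simp: disc_group_def)
  qed
  then have "finite (range s)" by (intro finite_subset[OF _ finite_disc_group]) auto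
  then have "\<not> inj s" using finite_imageD infinite_UNIV_nat by blast
  then obtain a b where ab: "a \<noteq> b" "s a = s b" by (auto simp: inj_def)
  have *: "real (b - a) * c i \<in> \<int>" if "a < b" "s a = s b" for a b i
  proof -
    have "frac (real a * c i) = frac (real b * c i)" using fun_cong[OF that(2), of i] by (simp add: s_def)
    then have "real b * c i - real a * c i = of_int (\<lfloor>real b * c i\<rfloor> - \<lfloor>real a * c i\<rfloor>)" by (simp add: frac_def)
    then have "real b * c i - real a * c i \<in> \<int>" by (metis Ints_of_int)
    then show ?thesis using that(1) by (simp add: of_nat_diff left_diff_distrib)
  qed
  show ?thesis
  proof (cases "a < b")
    case True
    then show ?thesis using *[OF True ab(2)] by (intro exI[of _ "b - a"]) auto
  next
    case False
    then have "b < a" using ab(1) by simp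
    then show ?thesis using *[OF _ ab(2)[symmetric]] by (intro exI[of _ "a - b"]) auto
  qed
qed

end

section \<open>Matrices built from isotropic tuples\<close>

text \<open>Each \<open>w j\<close> has a coordinate \<open>p j\<close> at which all the other
  vectors vanish, which forces every coefficient of a relation to be 0.\<close>

lemma lattice_rank_ge:
  fixes w :: "nat \<Rightarrow> int vec" and p :: "nat \<Rightarrow> nat"
  assumes L: "L \<subseteq> carrier_vec n" and w: "\<And>j. j < r \<Longrightarrow> w j \<in> L"
    and p: "\<And>j. j < r \<Longrightarrow> p j < n" "\<And>j. j < r \<Longrightarrow> w j $ p j \<noteq> 0"
      "\<And>i j. i < r \<Longrightarrow> j < r \<Longrightarrow> i \<noteq> j \<Longrightarrow> w i $ p j = 0"
  shows "r \<le> lattice_rank n L"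
proof -
  interpret Z: vec_module "TYPE(int)" n .
  let ?S = "w ` {..<r}"
  have inj: "inj_on w {..<r}"
  proof (rule inj_onI)
    fix i j assume ij: "i \<in> {..<r}" "j \<in> {..<r}" "w i = w j"
    then have "w i $ p j \<noteq> 0" using p(2)[of j] by simp
    then show "i = j" using p(3)[of i j] ij by auto
  qed
  have S: "?S \<subseteq> carrier_vec n" using L w by auto
  have "\<not> Z.lin_dep ?S"
  proof
    assume "Z.lin_dep ?S"
    then obtain B a v where B: "finite B" "B \<subseteq> ?S" and a: "Z.lincomb a B = 0\<^sub>v n" and v: "v \<in> B" "a v \<noteq> 0"
      unfolding Z.lin_dep_def by auto
    obtain j where j: "j < r" "v = w j" using v(1) B(2) by blast
    have "0 = Z.lincomb a B $ p j" using a p(1)[OF j(1)] by simp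
    also have "\<dots> = (\<Sum>x\<in>B. (a x \<cdot>\<^sub>v x) $ p j)"
      unfolding Z.lincomb_def using B S p(1)[OF j(1)] by (intro Z.finsum_index) auto
    also have "\<dots> = (\<Sum>x\<in>B. if x = v then a v * w j $ p j else 0)"
    proof (rule sum.cong[OF refl])
      fix x assume x: "x \<in> B"
      then obtain i where i: "i < r" "x = w i" using B(2) by blast
      have "x \<in> carrier_vec n" using x B(2) S by blast
      then have "(a x \<cdot>\<^sub>v x) $ p j = a x * x $ p j" using p(1)[OF j(1)] by simp
      moreover have "x $ p j = 0" if "x \<noteq> v" using p(3)[OF i(1) j(1)] i(2) j(2) that by auto
      ultimately show "(a x \<cdot>\<^sub>v x) $ p j = (if x = v then a v * w j $ p j else 0)" using j(2) by auto
    qed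
    also have "\<dots> = a v * w j $ p j" using B(1) v(1) by (simp add: sum.delta)
    finally show False using v(2) p(2)[OF j(1)] by simp
  qed
  moreover have "?S \<subseteq> L" using w by auto
  moreover have "card ?S = r" using inj by (simp add: card_image)
  ultimately have "r \<in> {card S | S. finite S \<and> S \<subseteq> L \<and> \<not> Z.lin_dep S}"
    by (intro CollectI exI[of _ ?S]) auto
  then show ?thesis unfolding lattice_rank_def by (intro Max_ge finite_indep_cards[OF L])
qed

section \<open>The family of matrices P\<close>

definition alt_of :: "(nat \<times> nat \<Rightarrow> int) \<Rightarrow> nat \<Rightarrow> nat \<Rightarrow> int" where
  "alt_of f i j = (if j < i then - f (i, j) else if i < j then f (j, i) else 0)"

text \<open>Pairs are written (larger, smaller): f (b, a) with a < b is the entry of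
  \<open>alt_of f\<close> in row a and column b.\<close>

definition index_pairs :: "nat \<Rightarrow> (nat \<times> nat) set" where
  "index_pairs k = Sigma {..<2 * k} (\<lambda>b. {..<b})"

text \<open>Every range has at least z elements, while the window starting at 6 k z makes all
  choices satisfy \<open>dominant_alternating\<close>.\<close>

definition entry_range :: "nat \<Rightarrow> nat \<Rightarrow> nat \<times> nat \<Rightarrow> int set" where
  "entry_range k z = (\<lambda>(b, a). if b = a + k then {int (6 * k * z)..int (6 * k * z) + int z} else {- int z..int z})"

lemma card_index_pairs: "card (index_pairs k) = k * (2 * k - 1)"
proof -
  have "card (index_pairs k) = (\<Sum>b<2 * k. b)" by (simp add: index_pairs_def card_SigmaI)
  also have "\<dots> = k * (2 * k - 1)"
  proof (induction k)
    case (Suc k)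
    have "(\<Sum>b<2 * Suc k. b) = k * (2 * k - 1) + 2 * k + (2 * k + 1)" using Suc by simp
    then show ?case by (cases k) (auto simp: algebra_simps)
  qed simp
  finally show ?thesis .
qed

lemma card_entries_ge: "z ^ (k * (2 * k - 1)) \<le> card (PiE (index_pairs k) (entry_range k z))"
proof -
  have fin: "finite (index_pairs k)" by (simp add: index_pairs_def)
  have "(\<Prod>x\<in>index_pairs k. z) \<le> (\<Prod>x\<in>index_pairs k. card (entry_range k z x))"
    by (rule prod_mono) (auto simp: entry_range_def)
  then show ?thesis using fin by (simp add: card_PiE card_index_pairs)
qed

lemma alt_of_props:
  assumes f: "f \<in> PiE (index_pairs k) (entry_range k z)" and k: "k \<ge> 1" and z: "z \<ge> 1"
  shows "dominant_alternating k z (alt_of f)"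
    "i < 2 * k \<Longrightarrow> j < 2 * k \<Longrightarrow> \<bar>alt_of f i j\<bar> \<le> int ((6 * k + 1) * z)"
proof -
  have mem: "f (b, a) \<in> entry_range k z (b, a)" if "a < b" "b < 2 * k" for a b
    by (rule PiE_mem[OF f]) (use that in \<open>simp add: index_pairs_def\<close>)
  have on: "int (6 * k * z) \<le> f (a + k, a)" if "a < k" for a
    using mem[of a "a + k"] that k by (simp add: entry_range_def)
  have off: "\<bar>f (b, a)\<bar> \<le> int z" if "a < b" "b < 2 * k" "b \<noteq> a + k" for a b
    using mem[OF that(1,2)] that(3) by (auto simp: entry_range_def)
  have bd: "\<bar>f (b, a)\<bar> \<le> int ((6 * k + 1) * z)" if "a < b" "b < 2 * k" for a b
  proof (cases "b = a + k")
    case True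
    then have "f (b, a) \<in> {int (6 * k * z)..int (6 * k * z) + int z}" using mem[OF that] by (simp add: entry_range_def)
    moreover have "int (6 * k * z) + int z = int ((6 * k + 1) * z)" by (simp add: algebra_simps)
    moreover have "int (6 * k * z) \<ge> 0" by simp
    ultimately show ?thesis by (simp only: atLeastAtMost_iff) linarith
  next
    case False
    have "int z \<le> int ((6 * k + 1) * z)" by (simp only: of_nat_le_iff) simp
    then show ?thesis using off[OF that False] by linarith
  qed
  show "dominant_alternating k z (alt_of f)"
  proof
    show "alt_of f i j = - alt_of f j i" for i j by (simp add: alt_of_def)
    show "int (6 * k * z) \<le> \<bar>alt_of f i (pair_index k i)\<bar>" if i: "i < 2 * k" for i
    proof (cases "i < k")
      case True
      then have "alt_of f i (pair_index k i) = f (i + k, i)" using k by (simp add: alt_of_def pair_index_def)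
      then show ?thesis using on[OF True] by linarith
    next
      case False
      then have "alt_of f i (pair_index k i) = - f ((i - k) + k, i - k)" using k by (simp add: alt_of_def pair_index_def)
      moreover have "i - k < k" using i False by simp
      ultimately show ?thesis using on[of "i - k"] by linarith
    qed
    show "\<bar>alt_of f i j\<bar> \<le> int z" if ij: "i < 2 * k" "j < 2 * k" "j \<noteq> pair_index k i" for i j
    proof (cases i j rule: linorder_cases)
      case less
      then have "j \<noteq> i + k" using ij by (auto simp: pair_index_def split: if_splits)
      then show ?thesis using off[of i j] less ij by (simp add: alt_of_def)
    next
      case equal
      then show ?thesis by (simp add: alt_of_def)
    next
      case greater
      then have "i \<noteq> j + k" using ij by (auto simp: pair_index_def split: if_splits)
      then show ?thesis using off[of j i] greater ij by (simp add: alt_of_def)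
    qed
  qed (use k z in auto)
  assume "i < 2 * k" "j < 2 * k"
  then show "\<bar>alt_of f i j\<bar> \<le> int ((6 * k + 1) * z)"
    using bd[of i j] bd[of j i] by (auto simp: alt_of_def simp del: of_nat_mult)
qed

section \<open>The matrices built from P and isotropic lists, and their kernels\<close>

definition column :: "nat \<Rightarrow> (nat \<Rightarrow> real) list \<Rightarrow> nat \<Rightarrow> nat \<Rightarrow> real" where
  "column d cs a = (if a < d then (\<lambda>i. if i = a then 1 else 0) else cs ! (a - d))"

text \<open>The matrix \<open>C\<^sup>T P C\<close> with \<open>C = (I | cs)\<close>; its entries are integers when \<open>cs\<close> is isotropic.\<close>

definition congruent_mat :: "nat \<Rightarrow> nat \<Rightarrow> (nat \<Rightarrow> nat \<Rightarrow> int) \<Rightarrow> (nat \<Rightarrow> real) list \<Rightarrow> int mat" where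
  "congruent_mat n d P cs = mat n n (\<lambda>(a, b). \<lfloor>bform d P (column d cs a) (column d cs b)\<rfloor>)"

context dominant_alternating
begin

lemma bform_unit_left: "a < d \<Longrightarrow> \<beta> (\<lambda>i. if i = a then 1 else 0) y = (\<Sum>j<d. of_int (P a j) * y j)"
  unfolding bform_eq by (simp add: if_distribR if_distrib sum.delta cong: if_cong)

lemma bform_units: "a < d \<Longrightarrow> b < d \<Longrightarrow> \<beta> (\<lambda>i. if i = a then 1 else 0) (\<lambda>i. if i = b then 1 else 0) = of_int (P a b)"
  by (simp add: bform_unit_left if_distrib sum.delta cong: if_cong)

text \<open>Two unit columns give an entry of P, a unit column and an entry c of \<open>cs\<close>
  give up to sign a coordinate of P c, and two entries of \<open>cs\<close> pair integrally by
  isotropy.\<close>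

lemma bform_column_int:
  assumes cs: "cs \<in> isotropic_lists d P r" and ab: "a < d + r" "b < d + r"
  shows "\<beta> (column d cs a) (column d cs b) \<in> \<int>"
proof -
  have mem: "cs ! (a - d) \<in> set cs" if "\<not> a < d" "a < d + r" for a
    using that cs by (intro nth_mem) (auto simp: isotropic_lists_def)
  have unit: "\<beta> (\<lambda>i. if i = a then 1 else 0) y \<in> \<int>" if "a < d" "y \<in> set cs" for a y
    using that cs by (auto simp: bform_unit_left isotropic_lists_def disc_group_def)
  consider "a < d" "b < d" | "a < d" "\<not> b < d" | "\<not> a < d" "b < d" | "\<not> a < d" "\<not> b < d" by blast
  then show ?thesis
  proof cases
    case 1
    then show ?thesis by (simp add: column_def bform_units)
  next
    case 2
    then show ?thesis using unit mem ab by (simp add: column_def)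
  next
    case 3
    then have "\<beta> (column d cs b) (column d cs a) \<in> \<int>" using unit mem ab by (simp add: column_def)
    then show ?thesis using bform_swap[of "column d cs a" "column d cs b"] by simp
  next
    case 4
    then show ?thesis using mem ab cs by (auto simp: column_def isotropic_lists_def)
  qed
qed

lemma column_bounds:
  assumes cs: "cs \<in> isotropic_lists d P r" and a: "a < d + r"
  shows "\<bar>column d cs a i\<bar> \<le> 1"
proof (cases "a < d")
  case False
  then have "cs ! (a - d) \<in> G" using cs a by (auto simp: isotropic_lists_def subset_iff)
  then have "0 \<le> (cs ! (a - d)) i" "(cs ! (a - d)) i < 1" by (auto simp: disc_group_def)
  then show ?thesis using False by (simp add: column_def)
qed (simp add: column_def)

lemma congruent_mat_entry:
  assumes "cs \<in> isotropic_lists d P r" "a < d + r" "b < d + r"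
  shows "of_int (congruent_mat (d + r) d P cs $$ (a, b)) = \<beta> (column d cs a) (column d cs b)"
  using bform_column_int[OF assms] assms(2,3) by (simp add: congruent_mat_def of_int_floor)

lemma congruent_mat_mem_alt_mats:
  assumes cs: "cs \<in> isotropic_lists d P r"
    and bd: "\<And>i j. i < d \<Longrightarrow> j < d \<Longrightarrow> \<bar>P i j\<bar> \<le> int b" and X: "real (d * d * b) \<le> X"
  shows "congruent_mat (d + r) d P cs \<in> alt_mats (d + r) X"
proof -
  let ?A = "congruent_mat (d + r) d P cs"
  note entry = congruent_mat_entry[OF cs]
  have carrier: "?A \<in> carrier_mat (d + r) (d + r)" by (simp add: congruent_mat_def)
  have skew: "?A $$ (i, j) = - ?A $$ (j, i)" if "i < d + r" "j < d + r" for i j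
  proof -
    have "real_of_int (?A $$ (i, j)) = - real_of_int (?A $$ (j, i))"
      unfolding entry[OF that] entry[OF that(2,1)] by (rule bform_swap)
    then show ?thesis by linarith
  qed
  have "transpose_mat ?A = - ?A"
  proof (rule eq_matI)
    fix i j assume "i < dim_row (- ?A)" "j < dim_col (- ?A)"
    then have ij: "i < d + r" "j < d + r" using carrier by auto
    then show "transpose_mat ?A $$ (i, j) = (- ?A) $$ (i, j)" using carrier skew[OF ij(2,1)] by simp
  qed (use carrier in auto)
  moreover have "?A $$ (i, i) = 0" if "i < d + r" for i using skew[OF that that] by simp
  moreover have "\<bar>real_of_int (?A $$ (i, j))\<bar> \<le> X" if ij: "i < d + r" "j < d + r" for i j
  proof -
    have "\<bar>\<beta> (column d cs i) (column d cs j)\<bar> \<le> (\<Sum>a<d. \<Sum>b'<d. real b)"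
      unfolding bform_def
    proof (rule order_trans[OF sum_abs sum_mono], rule order_trans[OF sum_abs sum_mono])
      fix a b' assume ab: "a \<in> {..<d}" "b' \<in> {..<d}"
      have "real_of_int \<bar>P a b'\<bar> \<le> real_of_int (int b)" unfolding of_int_le_iff using bd ab by simp
      then have P: "\<bar>real_of_int (P a b')\<bar> \<le> real b" by simp
      have "\<bar>column d cs i a\<bar> * \<bar>real_of_int (P a b')\<bar> * \<bar>column d cs j b'\<bar> \<le> 1 * real b * 1"
        using column_bounds[OF cs] ij P by (intro mult_mono) auto
      then show "\<bar>column d cs i a * real_of_int (P a b') * column d cs j b'\<bar> \<le> real b"
        by (simp add: abs_mult)
    qed
    also have "\<dots> = real (d * d * b)" by simp
    finally show ?thesis using X unfolding entry[OF ij] by linarith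
  qed
  ultimately show ?thesis using carrier by (auto simp: alt_mats_def)
qed

text \<open>The vector t (- c_m, e_m), with t clearing the denominators of c_m, is killed already by
  C, hence by C^T P C. Coordinate d + m is nonzero only in the m-th of these vectors.\<close>

lemma lattice_rank_congruent_mat:
  assumes cs: "cs \<in> isotropic_lists d P r"
  shows "r \<le> lattice_rank (d + r) (mat_kernel (congruent_mat (d + r) d P cs))"
proof -
  let ?A = "congruent_mat (d + r) d P cs"
  have carrier: "?A \<in> carrier_mat (d + r) (d + r)" by (simp add: congruent_mat_def)
  have csG: "cs ! m \<in> G" if "m < r" for m using cs that by (auto simp: isotropic_lists_def subset_iff)
  have "\<forall>m. \<exists>t :: nat. m < r \<longrightarrow> t > 0 \<and> (\<forall>i. real t * (cs ! m) i \<in> \<int>)"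
    using exists_multiple_integral csG by blast
  from choice[OF this] obtain t :: "nat \<Rightarrow> nat"
    where t: "\<And>m. m < r \<Longrightarrow> t m > 0" "\<And>m i. m < r \<Longrightarrow> real (t m) * (cs ! m) i \<in> \<int>" by auto
  define w where "w m = vec (d + r) (\<lambda>a. if a < d then - \<lfloor>real (t m) * (cs ! m) a\<rfloor> else if a = d + m then int (t m) else 0)" for m
  have "w m \<in> mat_kernel ?A" if m: "m < r" for m
  proof (rule mat_kernelI[OF carrier])
    show wc: "w m \<in> carrier_vec (d + r)" by (simp add: w_def)
    show "?A *\<^sub>v w m = 0\<^sub>v (d + r)"
    proof (rule eq_vecI)
      fix a assume "a < dim_vec (0\<^sub>v (d + r) :: int vec)"
      then have a: "a < d + r" by simp
      \<comment> \<open>Coordinate j of C w: the unit column j contributes - t c_m(j), and column d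
        + m contributes t c_m(j).\<close>
      have comb0: "(\<Sum>b<d + r. column d cs b j * of_int (w m $ b)) = 0" if j: "j < d" for j
      proof -
        have "column d cs b j * of_int (w m $ b) =
          (if b = j then - (real (t m) * (cs ! m) j) else 0) + (if b = d + m then real (t m) * (cs ! m) j else 0)"
          if b: "b < d + r" for b
        proof (cases "b < d")
          case True
          then show ?thesis using b t(2)[OF m, of j] by (auto simp: column_def w_def of_int_floor)
        next
          case False
          then show ?thesis using b j by (auto simp: column_def w_def)
        qed
        then have "(\<Sum>b<d + r. column d cs b j * of_int (w m $ b)) = (\<Sum>b<d + r.
          (if b = j then - (real (t m) * (cs ! m) j) else 0) + (if b = d + m then real (t m) * (cs ! m) j else 0))"
          by (intro sum.cong) auto
        then show ?thesis using j m by (simp add: sum.distrib sum.delta)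
      qed
      have "(?A *\<^sub>v w m) $ a = (\<Sum>b<d + r. ?A $$ (a, b) * w m $ b)"
        using a carrier wc by (simp add: scalar_prod_def row_def atLeast0LessThan)
      then have "real_of_int ((?A *\<^sub>v w m) $ a) = (\<Sum>b<d + r. real_of_int (?A $$ (a, b)) * of_int (w m $ b))"
        by simp
      also have "\<dots> = (\<Sum>b<d + r. \<beta> (column d cs a) (column d cs b) * of_int (w m $ b))"
        using congruent_mat_entry[OF cs a] by (intro sum.cong) auto
      also have "\<dots> = (\<Sum>b<d + r. \<Sum>i<d. \<Sum>j<d. column d cs a i * of_int (P i j) * (column d cs b j * of_int (w m $ b)))"
        by (simp add: bform_def sum_distrib_right mult.assoc)
      also have "\<dots> = (\<Sum>i<d. \<Sum>b<d + r. \<Sum>j<d. column d cs a i * of_int (P i j) * (column d cs b j * of_int (w m $ b)))"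
        by (rule sum.swap)
      also have "\<dots> = (\<Sum>i<d. \<Sum>j<d. \<Sum>b<d + r. column d cs a i * of_int (P i j) * (column d cs b j * of_int (w m $ b)))"
        by (intro sum.cong refl sum.swap)
      also have "\<dots> = (\<Sum>i<d. \<Sum>j<d. column d cs a i * of_int (P i j) * (\<Sum>b<d + r. column d cs b j * of_int (w m $ b)))"
        by (simp only: sum_distrib_left)
      also have "\<dots> = 0" using comb0 by (intro sum.neutral ballI) auto
      finally have "(?A *\<^sub>v w m) $ a = 0" by (simp only: of_int_eq_0_iff)
      then show "(?A *\<^sub>v w m) $ a = 0\<^sub>v (d + r) $ a" using a by simp
    qed (use carrier in simp)
  qed
  then show ?thesis
    by (intro lattice_rank_ge[where w = w and p = "\<lambda>j. d + j"] mat_kernel_subset_carrier[OF carrier])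
       (use t in \<open>auto simp: w_def\<close>)
qed

text \<open>The upper right block of the matrix consists of the vectors P c_m, and P is
  injective.\<close>

lemma congruent_mat_inject:
  assumes cs: "cs \<in> isotropic_lists d P r" and cs': "cs' \<in> isotropic_lists d P r"
    and eq: "congruent_mat (d + r) d P cs = congruent_mat (d + r) d P cs'"
  shows "cs = cs'"
proof (rule nth_equalityI)
  show "length cs = length cs'" using cs cs' by (simp add: isotropic_lists_def)
  fix m assume "m < length cs"
  then have m: "m < r" using cs by (simp add: isotropic_lists_def)
  have G: "cs ! m \<in> G" "cs' ! m \<in> G" using cs cs' m by (auto simp: isotropic_lists_def subset_iff)
  have "(\<Sum>j<d. of_int (P a j) * ((cs ! m) j - (cs' ! m) j)) = 0" if a: "a < d" for a
  proof -
    have "\<beta> (column d cs a) (column d cs (d + m)) = \<beta> (column d cs' a) (column d cs' (d + m))"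
      using congruent_mat_entry[OF cs, of a "d + m"] congruent_mat_entry[OF cs', of a "d + m"] a m eq by simp
    then show ?thesis using a by (simp add: column_def bform_unit_left right_diff_distrib sum_subtractf)
  qed
  then have eq: "(cs ! m) j - (cs' ! m) j = 0" if "j < d" for j
    using kernel_trivial[of "\<lambda>j. (cs ! m) j - (cs' ! m) j" j] that by blast
  show "cs ! m = cs' ! m"
  proof
    fix j show "(cs ! m) j = (cs' ! m) j"
      using eq[of j] G by (cases "j < d") (auto simp: disc_group_def)
  qed
qed

end

text \<open>P is the upper left block, so the matrix determines P and, through
  \<open>congruent_mat_inject\<close>, the list. The bound on X allows for (2 k)^2 terms, with
  entries of P up to (6 k + 1) z. With r + 1 list entries the exponents add up to k (2 k - 1) + 2 k
  + k r = n k.\<close>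

lemma card_alt_mats_ge_power:
  fixes k z r :: nat
  assumes k: "k \<ge> 1" and z: "z \<ge> 1" and X: "real (2 * k * (2 * k) * ((6 * k + 1) * z)) \<le> X"
  defines "n \<equiv> 2 * k + Suc r"
  shows "z ^ (n * k) \<le> card {A \<in> alt_mats n X. Suc r \<le> lattice_rank n (mat_kernel A)}"
proof -
  let ?d = "2 * k"
  let ?F = "PiE (index_pairs k) (entry_range k z)"
  let ?I = "\<lambda>f. isotropic_lists ?d (alt_of f) (Suc r)"
  let ?h = "\<lambda>(f, cs). congruent_mat n ?d (alt_of f) cs"
  let ?M = "{A \<in> alt_mats n X. Suc r \<le> lattice_rank n (mat_kernel A)}"
  have dom: "dominant_alternating k z (alt_of f)" if "f \<in> ?F" for f using alt_of_props(1)[OF that k z] .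
  have finF: "finite ?F" by (intro finite_PiE) (auto simp: index_pairs_def entry_range_def)
  have "n * k = k * (2 * k - 1) + (?d + k * r)"
  proof -
    have "k * (2 * k - 1) + ?d = k * (2 * k) + k" using k by (cases k) (auto simp: algebra_simps)
    then show ?thesis by (simp add: n_def algebra_simps)
  qed
  then have "z ^ (n * k) = z ^ (k * (2 * k - 1)) * z ^ (?d + k * r)" by (simp only: power_add)
  also have "\<dots> \<le> card ?F * z ^ (?d + k * r)" using card_entries_ge by simp
  also have "\<dots> = (\<Sum>f\<in>?F. z ^ (?d + k * r))" by simp
  also have "\<dots> \<le> (\<Sum>f\<in>?F. card (?I f))"
    using dominant_alternating.card_isotropic_lists_ge[OF dom] by (intro sum_mono)
  also have "\<dots> = card (Sigma ?F ?I)"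
    using finF dominant_alternating.finite_isotropic_lists[OF dom] by (simp add: card_SigmaI)
  also have "\<dots> \<le> card ?M"
  proof (rule card_inj_on_le)
    show "?h ` Sigma ?F ?I \<subseteq> ?M"
    proof (rule image_subsetI)
      fix x assume "x \<in> Sigma ?F ?I"
      then obtain f cs where x: "x = (f, cs)" "f \<in> ?F" "cs \<in> ?I f" by blast
      interpret dominant_alternating k z "alt_of f" by (rule dom[OF x(2)])
      show "?h x \<in> ?M"
        using congruent_mat_mem_alt_mats[OF x(3) alt_of_props(2)[OF x(2) k z] X] lattice_rank_congruent_mat[OF x(3)]
        by (simp add: x(1) n_def)
    qed
    show "inj_on ?h (Sigma ?F ?I)"
    proof (rule inj_onI)
      fix x y assume "x \<in> Sigma ?F ?I" "y \<in> Sigma ?F ?I" and eq: "?h x = ?h y"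
      then obtain f cs g cs' where x: "x = (f, cs)" "f \<in> ?F" "cs \<in> ?I f" and y: "y = (g, cs')" "g \<in> ?F" "cs' \<in> ?I g"
        by blast
      have eq': "congruent_mat n ?d (alt_of f) cs = congruent_mat n ?d (alt_of g) cs'" using eq x(1) y(1) by simp
      have entry: "congruent_mat n ?d (alt_of f) cs $$ (a, b) = alt_of f a b"
        if f: "f \<in> ?F" and ab: "a < ?d" "b < ?d" for f a b cs
        using dominant_alternating.bform_units[OF dom[OF f] ab] ab by (simp add: congruent_mat_def column_def n_def)
      have "f p = g p" if p: "p \<in> index_pairs k" for p
      proof -
        obtain a b where p: "p = (b, a)" "a < b" "b < ?d" using p by (auto simp: index_pairs_def)
        have "alt_of f a b = alt_of g a b" using entry[OF x(2), of a b cs] entry[OF y(2), of a b cs'] eq' p by simp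
        then show ?thesis using p by (simp add: alt_of_def)
      qed
      then have fg: "f = g" using x(2) y(2) by (intro PiE_ext)
      then have "cs = cs'"
        using dominant_alternating.congruent_mat_inject[OF dom[OF x(2)] x(3)] y(3) eq' by (simp add: n_def)
      then show "x = y" using fg x(1) y(1) by simp
    qed
    show "finite ?M" using finite_alt_mats by simp
  qed
  finally show ?thesis .
qed

lemma zero_mat_mem_alt_mats_rank:
  assumes "r \<le> n" "X \<ge> 0"
  shows "0\<^sub>m n n \<in> {A \<in> alt_mats n X. r \<le> lattice_rank n (mat_kernel A)}"
proof -
  have "r \<le> lattice_rank n (mat_kernel (0\<^sub>m n n))"
    by (rule lattice_rank_ge[where w = "\<lambda>j. unit_vec n j" and p = "\<lambda>j. j"])
       (use assms(1) in \<open>auto simp: mat_kernel_def\<close>)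
  moreover have "0\<^sub>m n n \<in> alt_mats n X" using assms(2) by (auto simp: alt_mats_def intro!: eq_matI)
  ultimately show ?thesis by simp
qed

lemma card_alt_mats_lower_bound:
  assumes n: "2 * k + r = n" and r: "r \<ge> 1"
  shows "\<exists>c>0. \<forall>X\<ge>1. c * X ^ (n * k) \<le> real (card {A \<in> alt_mats n X. r \<le> lattice_rank n (mat_kernel A)})"
proof -
  \<comment> \<open>The factor of z in the size condition of \<open>card_alt_mats_ge_power\<close>;
    the summand 1 keeps H positive for k = 0, where the product vanishes.\<close>
  define H where "H = real (2 * k * (2 * k) * (6 * k + 1)) + 1"
  have H: "H \<ge> 1" by (simp add: H_def)
  show ?thesis
  \<comment> \<open>Rounding X / H down to an integer loses at most a factor 2 once X \<ge> H, hence
    2 H.\<close>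
  proof (intro exI[of _ "1 / (2 * H) ^ (n * k)"] conjI allI impI)
    show "1 / (2 * H) ^ (n * k) > 0" using H by simp
    fix X :: real assume X: "X \<ge> 1"
    let ?M = "{A \<in> alt_mats n X. r \<le> lattice_rank n (mat_kernel A)}"
    have finM: "finite ?M" using finite_alt_mats by simp
    have eq: "1 / (2 * H) ^ (n * k) * X ^ (n * k) = (X / (2 * H)) ^ (n * k)" by (simp add: power_divide)
    show "1 / (2 * H) ^ (n * k) * X ^ (n * k) \<le> real (card ?M)"
    proof (cases "k \<ge> 1 \<and> X \<ge> H")
      case True
      define z where "z = nat \<lfloor>X / H\<rfloor>"
      have q: "X / H \<ge> 1" using True H by simp
      have z1: "z \<ge> 1" using q by (simp add: z_def le_nat_floor)
      have zle: "real z \<le> X / H" using q by (simp add: z_def)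
      have "X / H < real z + 1" unfolding z_def using q by linarith
      then have "X / H \<le> 2 * real z" using z1 by linarith
      then have zge: "X / (2 * H) \<le> real z" by (simp add: field_simps)
      have "real (2 * k * (2 * k) * ((6 * k + 1) * z)) = real (2 * k * (2 * k) * (6 * k + 1)) * real z"
        by (simp only: mult.assoc flip: of_nat_mult)
      also have "\<dots> \<le> H * real z" by (intro mult_right_mono) (auto simp: H_def)
      also have "\<dots> \<le> X" using zle H by (simp add: field_simps)
      finally have b: "real (2 * k * (2 * k) * ((6 * k + 1) * z)) \<le> X" .
      obtain r' where r': "r = Suc r'" using r by (cases r) auto
      have "z ^ (n * k) \<le> card ?M"
        using card_alt_mats_ge_power[of k z X r'] True z1 b n r' by auto
      then have "real z ^ (n * k) \<le> real (card ?M)" by (metis of_nat_mono of_nat_power)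
      moreover have "(X / (2 * H)) ^ (n * k) \<le> real z ^ (n * k)" using zge X H by (intro power_mono) auto
      ultimately show ?thesis unfolding eq by linarith
    next
      case False
      \<comment> \<open>Here k = 0 or X < H, and the zero matrix alone suffices.\<close>
      have "(X / (2 * H)) ^ (n * k) \<le> 1"
      proof (cases "k = 0")
        case False
        then have "X / (2 * H) \<le> 1" using \<open>\<not> (k \<ge> 1 \<and> X \<ge> H)\<close> H by simp
        then show ?thesis using X H by (intro power_le_one) auto
      qed simp
      moreover have "card ?M \<noteq> 0" using zero_mat_mem_alt_mats_rank[of r n X] X n finM by auto
      then have "1 \<le> real (card ?M)" by simp
      ultimately show ?thesis unfolding eq by linarith
    qed
  qed
qed

theorem theorem9p1p1:
  fixes n :: nat
  shows "\<exists>c C :: real. 0 < c \<and> 0 < C \<and>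
    (\<forall>(r :: nat) (X :: real). 1 \<le> r \<longrightarrow> r \<le> n \<longrightarrow> even (n - r) \<longrightarrow> 1 \<le> X \<longrightarrow>
      c * X powr (real n * (real n - real r) / 2)
        \<le> real (card {A \<in> alt_mats n X. r \<le> lattice_rank n (mat_kernel A)}) \<and>
      real (card {A \<in> alt_mats n X. r \<le> lattice_rank n (mat_kernel A)})
        \<le> C * X powr (real n * (real n - real r) / 2))"
proof -
  let ?N = "\<lambda>r X. real (card {A \<in> alt_mats n X. r \<le> lattice_rank n (mat_kernel A)})"
  let ?e = "\<lambda>r. real n * (real n - real r) / 2"
  define Q where "Q r c C \<longleftrightarrow> 0 < c \<and> 0 < C \<and> (1 \<le> r \<longrightarrow> r \<le> n \<longrightarrow> even (n - r) \<longrightarrow>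
    (\<forall>X\<ge>1. c * X powr ?e r \<le> ?N r X \<and> ?N r X \<le> C * X powr ?e r))" for r and c C :: real
  have "\<exists>c C. Q r c C" for r
  proof (cases "1 \<le> r \<and> r \<le> n \<and> even (n - r)")
    case True
    then obtain k where k: "n - r = 2 * k" by (elim conjE evenE)
    then have n: "2 * k + r = n" using True by linarith
    have e: "X powr ?e r = X ^ (n * k)" if "X \<ge> 1" for X :: real
    proof -
      have "?e r = real (n * k)" using n by (simp add: n[symmetric])
      then show ?thesis using that by (simp only: powr_realpow)
    qed
    obtain c where "c > 0" "\<forall>X\<ge>1. c * X ^ (n * k) \<le> ?N r X" using card_alt_mats_lower_bound[OF n] True by blast
    moreover obtain C where "C > 0" "\<forall>X\<ge>1. ?N r X \<le> C * X ^ (n * k)" using card_alt_mats_upper_bound[OF n] by blast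
    ultimately have "Q r c C" unfolding Q_def using e by simp
    then show ?thesis by blast
  next
    case False
    \<comment> \<open>Values of r outside the range of the theorem get the constants 1, which keeps
      the minimum below positive.\<close>
    then have "Q r 1 1" by (auto simp: Q_def)
    then show ?thesis by blast
  qed
  then have "\<forall>r. \<exists>p. Q r (fst p) (snd p)" by simp
  from choice[OF this] obtain p where p: "\<And>r. Q r (fst (p r)) (snd (p r))" by blast
  \<comment> \<open>Only the finitely many r \<le> n occur, so minimum and maximum give constants
    that depend on n alone.\<close>
  define c where "c = Min ((\<lambda>r. fst (p r)) ` {..n})"
  define C where "C = Max ((\<lambda>r. snd (p r)) ` {..n})"
  have c: "c > 0" unfolding c_def using p by (subst Min_gr_iff) (auto simp: Q_def)
  have "snd (p 0) \<le> C" unfolding C_def by (intro Max_ge) auto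
  then have C: "C > 0" using p[of 0] by (simp add: Q_def)
  show ?thesis
  proof (rule exI[of _ c], rule exI[of _ C], intro conjI c C allI impI)
    fix r :: nat and X :: real
    assume r: "1 \<le> r" "r \<le> n" "even (n - r)" and X: "1 \<le> X"
    have pr: "fst (p r) * X powr ?e r \<le> ?N r X" "?N r X \<le> snd (p r) * X powr ?e r"
      using p[of r] r X unfolding Q_def by auto
    have "c \<le> fst (p r)" unfolding c_def using r(2) by (intro Min_le) auto
    then have "c * X powr ?e r \<le> fst (p r) * X powr ?e r" by (intro mult_right_mono) auto
    then show "c * X powr ?e r \<le> ?N r X" using pr(1) by (rule order_trans)
    have "snd (p r) \<le> C" unfolding C_def using r(2) by (intro Max_ge) auto
    then have "snd (p r) * X powr ?e r \<le> C * X powr ?e r" by (intro mult_right_mono) auto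
    with pr(2) show "?N r X \<le> C * X powr ?e r" by (rule order_trans)
  qed
qed

end
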